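(* Let $(X,\tau,\mathsf d)$ be an extended metric-topological space, $\mathfrak m\in\mathcal P(X)$, and let $(\mathsf d_i)_{i\in I}$ be a monotone family ($I$ a directed set, $\mathsf d_i\le\mathsf d_j$ for $i\le j$) of bounded $(\tau\times\tau)$-continuous semidistances $\mathsf d_i:X\times X\to[0,\infty)$ with $\mathsf d=\sup_{i\in I}\mathsf d_i$. Let $\mathrm{Ch}$ be the Cheeger energy of $(X,\tau,\mathsf d,\mathfrak m)$ and $\mathrm{Ch}_i$ the Cheeger energy associated with $\mathsf d_i$. Let $\rho_0\in L^\infty_+(X,\mathfrak m)$, let $\rho^i_t$ be the $L^2(X,\mathfrak m)$ gradient curve of $\mathrm{Ch}_i$ starting from $\rho^i_0$, the $L^2(X,\mathfrak m)$ projection of $\rho_0$ on $\overline{D(\mathrm{Ch}_i)}$, and let $\rho_t$ be the $L^2(X,\mathfrak m)$ gradient curve of $\mathrm{Ch}$ starting from $\rho_0$. Then $\rho^i_t\to\rho_t$ strongly in $L^2(X,\mathfrak m)$ (as a net in $i\in I$) for all $t\ge0$. In addition, for all $f\in D(\mathrm{Ch})$ there exist a subnet $\beta:J\to I$ and bounded $\mathsf d_{\beta(j)}$-Lipschitz functions $f_j$, $j\in J$, with $f_j\to f$ in $L^2(X,\mathfrak m)$ and $\mathrm{Lip}_a(f_j,\mathsf d_{\beta(j)},\cdot)\to|\mathrm Df|_w$ in $L^2(X,\mathfrak m)$.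
   Context: An extended metric space $(X,\mathsf d)$ is a set with a symmetric $\mathsf d:X\times X\to[0,\infty]$ satisfying the triangle inequality and $\mathsf d(x,y)=0$ iff $x=y$; for a semidistance the last condition is weakened to $\mathsf d(x,x)=0$. For a Hausdorff topology $\tau$ on $X$, $\mathrm{Lip}_b(X,\tau,\mathsf d)$ is the set of bounded, $\mathsf d$-Lipschitz, $\tau$-continuous functions $f:X\to\mathbb R$. $(X,\tau,\mathsf d)$ is an extended metric-topological space if (a) $\mathsf d$ is the supremum of a family of $(\tau\times\tau)$-continuous bounded semidistances $X\times X\to[0,\infty)$; (b) $\tau$ is generated by $\mathrm{Lip}_b(X,\tau,\mathsf d)$. $\mathcal P(X)$ is the set of Radon probability measures on the Borel sets of $\tau$. Cheeger energy of $(X,\tau,\mathsf d,\mathfrak m)$: for a $\mathsf d$-Lipschitz $f$ ($\mathsf d$ an extended distance or a semidistance), $\mathrm{Lip}_a(f,\mathsf d,x)=\lim_{r\downarrow0}\sup\{|f(y)-f(z)|/\mathsf d(y,z):\ \mathsf d(y,x)\vee\mathsf d(z,x)<r,\ \mathsf d(y,z)>0\}$ ($=0$ if there are no such pairs for small $r$). For $f\in\mathrm{Lip}_b(X,\tau,\mathsf d)$, $\mathrm{Lip}_a^*(f,\cdot)$ is the $\mathfrak m$-essentially smallest $\mathfrak m$-measurable function which is $\ge\mathrm{Lip}_a(f,\mathsf d,\cdot)$ $\mathfrak m$-a.e. For $f\in L^2(X,\mathfrak m)$, $\mathrm{Ch}(f)=\inf\liminf_n\int(\mathrm{Lip}_a^*(f_n,\cdot))^2\,d\mathfrak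 m$ over sequences $f_n\in\mathrm{Lip}_b(X,\tau,\mathsf d)$ with $f_n\to f$ in $L^2(X,\mathfrak m)$; $D(\mathrm{Ch})=\{\mathrm{Ch}<\infty\}$. A relaxed slope of $f$ is any $G\ge g$ with $g$ a weak $L^2(X,\mathfrak m)$ limit point of $\mathrm{Lip}_a^*(f_n,\cdot)$ for some $f_n\in\mathrm{Lip}_b(X,\tau,\mathsf d)$, $f_n\to f$ in $L^2(X,\mathfrak m)$; $|\mathrm Df|_w$ is the relaxed slope of smallest $L^2$ norm. Definition of $\mathrm{Ch}_i$: let $(X_i,\tilde{\mathsf d}_i)$ be the metric space quotient of $(X,\mathsf d_i)$ (identifying $x,y$ with $\mathsf d_i(x,y)=0$), $\pi^i:X\to X_i$ the projection, $\tau_i$ the topology induced by $\tilde{\mathsf d}_i$, $\mathfrak m_i=(\pi^i)_\sharp\mathfrak m$, and $\widetilde{\mathrm{Ch}}_i$ the Cheeger energy of $(X_i,\tau_i,\tilde{\mathsf d}_i,\mathfrak m_i)$. Then $\mathrm{Ch}_i(f)=\widetilde{\mathrm{Ch}}_i(g)$ if $f=g\circ\pi^i$ with $g\in L^2(X_i,\mathfrak m_i)$, and $\mathrm{Ch}_i(f)=+\infty$ otherwise. The gradient curve of a convex lower semicontinuous $\Phi:L^2(X,\mathfrak m)\to[0,\infty]$ starting from $\bar f\in\overline{D(\Phi)}$ is the unique curve $f:[0,\infty)\to L^2(X,\mathfrak m)$, continuous, locally absolutely continuous in $(0,\infty)$, with $f_0=\bar f$ and $-f_t'\in\partial\Phi(f_t)$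 for a.e. $t>0$ ($\partial\Phi$ the convex subdifferential). *)

theory Defs
  imports "HOL-Probability.Probability"
begin

section \<open>Nets\<close>

definition directed_set :: "'i set \<Rightarrow> ('i \<Rightarrow> 'i \<Rightarrow> bool) \<Rightarrow> bool" where
  "directed_set I le \<longleftrightarrow>
     I \<noteq> {} \<and> (\<forall>i\<in>I. le i i) \<and>
     (\<forall>i\<in>I. \<forall>j\<in>I. \<forall>k\<in>I. le i j \<longrightarrow> le j k \<longrightarrow> le i k) \<and>
     (\<forall>i\<in>I. \<forall>j\<in>I. \<exists>k\<in>I. le i k \<and> le j k)"

definition net_filter :: "'i set \<Rightarrow> ('i \<Rightarrow> 'i \<Rightarrow> bool) \<Rightarrow> 'i filter" where
  "net_filter I le = (INF i\<in>I. principal {j\<in>I. le i j})"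

lemma eventually_net_filter:
  assumes "directed_set I le"
  shows "eventually P (net_filter I le) \<longleftrightarrow> (\<exists>i\<in>I. \<forall>j\<in>I. le i j \<longrightarrow> P j)"
proof -
  have "\<exists>x\<in>I. principal {j\<in>I. le x j} \<le> inf (principal {j\<in>I. le a j}) (principal {j\<in>I. le b j})"
    if ab: "a \<in> I" "b \<in> I" for a b
  proof -
    obtain k where k: "k \<in> I" "le a k" "le b k"
      using assms ab unfolding directed_set_def by meson
    then have "{j\<in>I. le k j} \<subseteq> {j\<in>I. le a j} \<inter> {j\<in>I. le b j}"
      using assms ab unfolding directed_set_def by blast
    then show ?thesis using k(1) by (intro bexI[of _ k]) simp_all
  qed
  moreover have "I \<noteq> {}" using assms by (simp add: directed_set_def)
  ultimately have "eventually P (INF i\<in>I. principal {j\<in>I. le i j}) \<longleftrightarrow>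
      (\<exists>i\<in>I. eventually P (principal {j\<in>I. le i j}))"
    by (rule eventually_INF_base[rotated])
  then show ?thesis unfolding net_filter_def eventually_principal by (auto simp: imp_conjL)
qed

text \<open>Subnet index maps are taken monotone with cofinal range, so that \<open>\<beta>\<close> is also a subnet in the
  sense that only asks that \<open>\<beta> j\<close> eventually dominate each \<open>i\<close>.\<close>

definition subnet_map ::
  "'j set \<Rightarrow> ('j \<Rightarrow> 'j \<Rightarrow> bool) \<Rightarrow> 'i set \<Rightarrow> ('i \<Rightarrow> 'i \<Rightarrow> bool) \<Rightarrow> ('j \<Rightarrow> 'i) \<Rightarrow> bool" where
  "subnet_map J leJ I leI \<beta> \<longleftrightarrow>
     directed_set J leJ \<and> \<beta> ` J \<subseteq> I \<and>
     (\<forall>j\<in>J. \<forall>k\<in>J. leJ j k \<longrightarrow> leI (\<beta> j) (\<beta> k)) \<and>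
     (\<forall>i\<in>I. \<exists>j\<in>J. leI i (\<beta> j))"


section \<open>Extended metric-topological spaces\<close>

definition extended_distance_on :: "'a set \<Rightarrow> ('a \<Rightarrow> 'a \<Rightarrow> ennreal) \<Rightarrow> bool" where
  "extended_distance_on X d \<longleftrightarrow>
     (\<forall>x\<in>X. \<forall>y\<in>X. d x y = 0 \<longleftrightarrow> x = y) \<and>
     (\<forall>x\<in>X. \<forall>y\<in>X. d x y = d y x) \<and>
     (\<forall>x\<in>X. \<forall>y\<in>X. \<forall>z\<in>X. d x z \<le> d x y + d y z)"

definition semidistance_on :: "'a set \<Rightarrow> ('a \<Rightarrow> 'a \<Rightarrow> real) \<Rightarrow> bool" where
  "semidistance_on X \<delta> \<longleftrightarrow>
     (\<forall>x\<in>X. \<forall>y\<in>X. 0 \<le> \<delta> x y) \<and>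
     (\<forall>x\<in>X. \<delta> x x = 0) \<and>
     (\<forall>x\<in>X. \<forall>y\<in>X. \<delta> x y = \<delta> y x) \<and>
     (\<forall>x\<in>X. \<forall>y\<in>X. \<forall>z\<in>X. \<delta> x z \<le> \<delta> x y + \<delta> y z)"

definition bounded_continuous_semidistance :: "'a topology \<Rightarrow> ('a \<Rightarrow> 'a \<Rightarrow> real) \<Rightarrow> bool" where
  "bounded_continuous_semidistance T \<delta> \<longleftrightarrow>
     semidistance_on (topspace T) \<delta> \<and>
     (\<exists>C. \<forall>x\<in>topspace T. \<forall>y\<in>topspace T. \<delta> x y \<le> C) \<and>
     continuous_map (prod_topology T T) euclideanreal (\<lambda>(x, y). \<delta> x y)"

definition lipschitz_wrt :: "'a set \<Rightarrow> ('a \<Rightarrow> 'a \<Rightarrow> ennreal) \<Rightarrow> ('a \<Rightarrow> real) \<Rightarrow> bool" where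
  "lipschitz_wrt X d f \<longleftrightarrow>
     (\<exists>L\<ge>0. \<forall>x\<in>X. \<forall>y\<in>X. ennreal \<bar>f x - f y\<bar> \<le> ennreal L * d x y)"

definition lip_b :: "'a topology \<Rightarrow> ('a \<Rightarrow> 'a \<Rightarrow> ennreal) \<Rightarrow> ('a \<Rightarrow> real) set" where
  "lip_b T d = {f. bounded (f ` topspace T) \<and> lipschitz_wrt (topspace T) d f \<and>
                   continuous_map T euclideanreal f}"

definition ext_metric_top_space :: "'a topology \<Rightarrow> ('a \<Rightarrow> 'a \<Rightarrow> ennreal) \<Rightarrow> bool" where
  "ext_metric_top_space T d \<longleftrightarrow>
     Hausdorff_space T \<and> extended_distance_on (topspace T) d \<and>
     (\<exists>D. (\<forall>\<delta>\<in>D. bounded_continuous_semidistance T \<delta>) \<and>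
          (\<forall>x\<in>topspace T. \<forall>y\<in>topspace T. d x y = (SUP \<delta>\<in>D. ennreal (\<delta> x y)))) \<and>
     T = topology_generated_by {f -` U \<inter> topspace T | f U. f \<in> lip_b T d \<and> open U}"

definition borel_of :: "'a topology \<Rightarrow> 'a measure" where
  "borel_of T = sigma (topspace T) {U. openin T U}"

definition radon_prob :: "'a topology \<Rightarrow> 'a measure \<Rightarrow> bool" where
  "radon_prob T m \<longleftrightarrow>
     prob_space m \<and> sets m = sets (borel_of T) \<and>
     (\<forall>B\<in>sets m. emeasure m B = (SUP K\<in>{K. compactin T K \<and> K \<subseteq> B}. emeasure m K))"


section \<open>The space \<open>L\<^sup>2(m)\<close>\<close>

text \<open>Elements of \<open>L\<^sup>2(m)\<close> are represented by Borel functions, two of them being the same element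
  when they agree almost everywhere. Since every function measurable for the completion of \<open>m\<close>
  agrees almost everywhere with a Borel one, no class is lost.\<close>

definition L2 :: "'a measure \<Rightarrow> ('a \<Rightarrow> real) set" where
  "L2 m = {f \<in> borel_measurable m. integrable m (\<lambda>x. (f x)\<^sup>2)}"

definition l2norm :: "'a measure \<Rightarrow> ('a \<Rightarrow> real) \<Rightarrow> real" where
  "l2norm m f = sqrt (\<integral>x. (f x)\<^sup>2 \<partial>m)"

definition l2_tendsto ::
  "'a measure \<Rightarrow> ('i \<Rightarrow> 'a \<Rightarrow> real) \<Rightarrow> ('a \<Rightarrow> real) \<Rightarrow> 'i filter \<Rightarrow> bool" where
  "l2_tendsto m F f net \<longleftrightarrow>
     (\<forall>\<^sub>F i in net. F i \<in> L2 m) \<and> f \<in> L2 m \<and>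
     ((\<lambda>i. l2norm m (\<lambda>x. F i x - f x)) \<longlongrightarrow> 0) net"

definition l2_closure :: "'a measure \<Rightarrow> ('a \<Rightarrow> real) set \<Rightarrow> ('a \<Rightarrow> real) set" where
  "l2_closure m S = {f \<in> L2 m. \<forall>\<epsilon>>0. \<exists>g\<in>S. l2norm m (\<lambda>x. f x - g x) < \<epsilon>}"

definition is_l2_projection ::
  "'a measure \<Rightarrow> ('a \<Rightarrow> real) set \<Rightarrow> ('a \<Rightarrow> real) \<Rightarrow> ('a \<Rightarrow> real) \<Rightarrow> bool" where
  "is_l2_projection m K f p \<longleftrightarrow>
     p \<in> K \<and> (\<forall>q\<in>K. l2norm m (\<lambda>x. f x - p x) \<le> l2norm m (\<lambda>x. f x - q x))"

text \<open>Limit points are cluster points for the weak topology, whose basic neighbourhoods of \<open>g\<close> are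
  given by finitely many test functions.\<close>

definition l2_weak_limit_point ::
  "'a measure \<Rightarrow> (nat \<Rightarrow> 'a \<Rightarrow> real) \<Rightarrow> ('a \<Rightarrow> real) \<Rightarrow> bool" where
  "l2_weak_limit_point m h g \<longleftrightarrow>
     g \<in> L2 m \<and>
     (\<forall>\<Phi> \<epsilon>. finite \<Phi> \<and> \<Phi> \<subseteq> L2 m \<and> 0 < \<epsilon> \<longrightarrow>
        (\<exists>\<^sub>F n in sequentially. \<forall>\<phi>\<in>\<Phi>. \<bar>\<integral>x. (h n x - g x) * \<phi> x \<partial>m\<bar> < \<epsilon>))"

definition Linf_plus :: "'a measure \<Rightarrow> ('a \<Rightarrow> real) set" where
  "Linf_plus m = {f \<in> borel_measurable m. (AE x in m. 0 \<le> f x) \<and> (\<exists>C. AE x in m. f x \<le> C)}"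


section \<open>Cheeger energies\<close>

text \<open>The supremum is taken in \<open>[0,\<infinity>]\<close>, where the empty supremum is \<open>0\<close> and \<open>c / \<infinity> = 0\<close> for finite
  \<open>c\<close>. The conversion to a real number loses nothing for Lipschitz \<open>f\<close>, the only case of interest.\<close>

definition lip_a :: "'a set \<Rightarrow> ('a \<Rightarrow> 'a \<Rightarrow> ennreal) \<Rightarrow> ('a \<Rightarrow> real) \<Rightarrow> 'a \<Rightarrow> real" where
  "lip_a X d f x = enn2real (Lim (at_right 0) (\<lambda>r::real.
     Sup {ennreal \<bar>f y - f z\<bar> / d y z | y z.
            y \<in> X \<and> z \<in> X \<and> max (d y x) (d z x) < ennreal r \<and> 0 < d y z}))"

definition is_ess_envelope :: "'a measure \<Rightarrow> ('a \<Rightarrow> real) \<Rightarrow> ('a \<Rightarrow> real) \<Rightarrow> bool" where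
  "is_ess_envelope m g h \<longleftrightarrow>
     h \<in> borel_measurable m \<and> (AE x in m. g x \<le> h x) \<and>
     (\<forall>k\<in>borel_measurable m. (AE x in m. g x \<le> k x) \<longrightarrow> (AE x in m. h x \<le> k x))"

definition lip_a_star ::
  "'a topology \<Rightarrow> ('a \<Rightarrow> 'a \<Rightarrow> ennreal) \<Rightarrow> 'a measure \<Rightarrow> ('a \<Rightarrow> real) \<Rightarrow> 'a \<Rightarrow> real" where
  "lip_a_star T d m f = (SOME h. is_ess_envelope m (lip_a (topspace T) d f) h)"

definition cheeger ::
  "'a topology \<Rightarrow> ('a \<Rightarrow> 'a \<Rightarrow> ennreal) \<Rightarrow> 'a measure \<Rightarrow> ('a \<Rightarrow> real) \<Rightarrow> ennreal" where
  "cheeger T d m f =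
     (INF F\<in>{F :: nat \<Rightarrow> 'a \<Rightarrow> real. (\<forall>n. F n \<in> lip_b T d) \<and> l2_tendsto m F f sequentially}.
        liminf (\<lambda>n. \<integral>\<^sup>+x. ennreal ((lip_a_star T d m (F n) x)\<^sup>2) \<partial>m))"

definition energy_domain :: "'a measure \<Rightarrow> (('a \<Rightarrow> real) \<Rightarrow> ennreal) \<Rightarrow> ('a \<Rightarrow> real) set" where
  "energy_domain m \<Phi> = {f \<in> L2 m. \<Phi> f < \<infinity>}"

definition relaxed_slope ::
  "'a topology \<Rightarrow> ('a \<Rightarrow> 'a \<Rightarrow> ennreal) \<Rightarrow> 'a measure \<Rightarrow> ('a \<Rightarrow> real) \<Rightarrow> ('a \<Rightarrow> real) \<Rightarrow> bool" where
  "relaxed_slope T d m f G \<longleftrightarrow>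
     G \<in> L2 m \<and>
     (\<exists>F g. (\<forall>n. F n \<in> lip_b T d) \<and> l2_tendsto m F f sequentially \<and>
            l2_weak_limit_point m (\<lambda>n. lip_a_star T d m (F n)) g \<and> (AE x in m. g x \<le> G x))"

definition min_relaxed_slope ::
  "'a topology \<Rightarrow> ('a \<Rightarrow> 'a \<Rightarrow> ennreal) \<Rightarrow> 'a measure \<Rightarrow> ('a \<Rightarrow> real) \<Rightarrow> 'a \<Rightarrow> real" where
  "min_relaxed_slope T d m f =
     (SOME G. relaxed_slope T d m f G \<and>
              (\<forall>G'. relaxed_slope T d m f G' \<longrightarrow> l2norm m G \<le> l2norm m G'))"


section \<open>The Cheeger energy of a semidistance\<close>

definition zero_rel :: "'a set \<Rightarrow> ('a \<Rightarrow> 'a \<Rightarrow> real) \<Rightarrow> ('a \<times> 'a) set" where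
  "zero_rel X \<delta> = {(x, y). x \<in> X \<and> y \<in> X \<and> \<delta> x y = 0}"

definition quot_proj :: "'a set \<Rightarrow> ('a \<Rightarrow> 'a \<Rightarrow> real) \<Rightarrow> 'a \<Rightarrow> 'a set" where
  "quot_proj X \<delta> x = zero_rel X \<delta> `` {x}"

text \<open>The value \<open>0\<close> outside the quotient is only there because the locale \<open>Metric_space\<close> asks for
  nonnegativity and symmetry on the whole type.\<close>

definition quot_dist :: "'a set \<Rightarrow> ('a \<Rightarrow> 'a \<Rightarrow> real) \<Rightarrow> 'a set \<Rightarrow> 'a set \<Rightarrow> real" where
  "quot_dist X \<delta> A B =
     (if A \<in> X // zero_rel X \<delta> \<and> B \<in> X // zero_rel X \<delta>
      then \<delta> (SOME x. x \<in> A) (SOME y. y \<in> B) else 0)"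

lemma equiv_zero_rel:
  assumes "semidistance_on X \<delta>"
  shows "equiv X (zero_rel X \<delta>)"
proof (rule equivI)
  show "zero_rel X \<delta> \<subseteq> X \<times> X" by (auto simp: zero_rel_def)
  show "refl_on X (zero_rel X \<delta>)"
    using assms by (auto simp: refl_on_def zero_rel_def semidistance_on_def)
  show "sym (zero_rel X \<delta>)"
    using assms by (auto simp: sym_def zero_rel_def semidistance_on_def)
  show "trans (zero_rel X \<delta>)"
  proof (rule transI)
    fix x y z assume "(x, y) \<in> zero_rel X \<delta>" "(y, z) \<in> zero_rel X \<delta>"
    then have *: "x \<in> X" "y \<in> X" "z \<in> X" "\<delta> x y = 0" "\<delta> y z = 0"
      by (auto simp: zero_rel_def)
    then have "\<delta> x z \<le> \<delta> x y + \<delta> y z" "0 \<le> \<delta> x z"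
      using assms unfolding semidistance_on_def by blast+
    then show "(x, z) \<in> zero_rel X \<delta>" using * by (simp add: zero_rel_def)
  qed
qed

lemma quot_dist_proj:
  assumes \<delta>: "semidistance_on X \<delta>" and "x \<in> X" "y \<in> X"
  shows "quot_dist X \<delta> (quot_proj X \<delta> x) (quot_proj X \<delta> y) = \<delta> x y"
proof -
  have some: "(SOME u. u \<in> quot_proj X \<delta> v) \<in> X \<and> \<delta> v (SOME u. u \<in> quot_proj X \<delta> v) = 0"
    if "v \<in> X" for v
  proof -
    have "v \<in> quot_proj X \<delta> v"
      using that \<delta> by (auto simp: quot_proj_def zero_rel_def semidistance_on_def)
    then have "(SOME u. u \<in> quot_proj X \<delta> v) \<in> quot_proj X \<delta> v" by (rule someI)
    then show ?thesis by (auto simp: quot_proj_def zero_rel_def)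
  qed
  define a where "a = (SOME u. u \<in> quot_proj X \<delta> x)"
  define b where "b = (SOME u. u \<in> quot_proj X \<delta> y)"
  have ab: "a \<in> X" "b \<in> X" "\<delta> x a = 0" "\<delta> y b = 0"
    using some assms by (auto simp: a_def b_def)
  have tri: "\<And>u v w. u \<in> X \<Longrightarrow> v \<in> X \<Longrightarrow> w \<in> X \<Longrightarrow> \<delta> u w \<le> \<delta> u v + \<delta> v w"
    and sym: "\<And>u v. u \<in> X \<Longrightarrow> v \<in> X \<Longrightarrow> \<delta> u v = \<delta> v u"
    using \<delta> by (auto simp: semidistance_on_def)
  have "\<delta> a b = \<delta> x y"
    using tri[of a x b] tri[of x y b] tri[of x a y] tri[of a b y] sym[of a x] sym[of b y] ab assms
    by linarith
  moreover have "quot_proj X \<delta> x \<in> X // zero_rel X \<delta>" "quot_proj X \<delta> y \<in> X // zero_rel X \<delta>"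
    using assms by (auto simp: quot_proj_def quotientI)
  ultimately show ?thesis by (simp add: quot_dist_def a_def b_def)
qed

lemma Metric_space_quot:
  assumes \<delta>: "semidistance_on X \<delta>"
  shows "Metric_space (X // zero_rel X \<delta>) (quot_dist X \<delta>)"
proof -
  have rep: "\<exists>x\<in>X. A = quot_proj X \<delta> x" if "A \<in> X // zero_rel X \<delta>" for A
    using that by (auto simp: quot_proj_def quotient_def)
  note [simp] = quot_dist_proj[OF \<delta>]
  have out: "quot_dist X \<delta> A B = 0"
    if "\<not> (A \<in> X // zero_rel X \<delta> \<and> B \<in> X // zero_rel X \<delta>)" for A B
    using that unfolding quot_dist_def by presburger
  show ?thesis
  proof
    fix A B
    consider (inside) x y where "x \<in> X" "y \<in> X" "A = quot_proj X \<delta> x" "B = quot_proj X \<delta> y"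
      | (outside) "quot_dist X \<delta> A B = 0" "quot_dist X \<delta> B A = 0"
      using rep out by meson
    then have "0 \<le> quot_dist X \<delta> A B \<and> quot_dist X \<delta> A B = quot_dist X \<delta> B A"
      using \<delta> by cases (simp_all add: semidistance_on_def)
    then show "0 \<le> quot_dist X \<delta> A B" "quot_dist X \<delta> A B = quot_dist X \<delta> B A"
      by blast+
  next
    fix A B assume "A \<in> X // zero_rel X \<delta>" "B \<in> X // zero_rel X \<delta>"
    then obtain x y where xy: "x \<in> X" "y \<in> X" "A = quot_proj X \<delta> x" "B = quot_proj X \<delta> y"
      using rep by meson
    have "quot_proj X \<delta> x = quot_proj X \<delta> y \<longleftrightarrow> (x, y) \<in> zero_rel X \<delta>"
      unfolding quot_proj_def using xy equiv_zero_rel[OF \<delta>] by (simp add: eq_equiv_class_iff)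
    then show "quot_dist X \<delta> A B = 0 \<longleftrightarrow> A = B"
      using xy by (simp add: zero_rel_def)
  next
    fix A B C
    assume "A \<in> X // zero_rel X \<delta>" "B \<in> X // zero_rel X \<delta>" "C \<in> X // zero_rel X \<delta>"
    then obtain x y z where "x \<in> X" "y \<in> X" "z \<in> X"
      "A = quot_proj X \<delta> x" "B = quot_proj X \<delta> y" "C = quot_proj X \<delta> z"
      using rep by meson
    then show "quot_dist X \<delta> A C \<le> quot_dist X \<delta> A B + quot_dist X \<delta> B C"
      using \<delta> by (simp add: semidistance_on_def)
  qed
qed

definition quot_topology :: "'a topology \<Rightarrow> ('a \<Rightarrow> 'a \<Rightarrow> real) \<Rightarrow> 'a set topology" where
  "quot_topology T \<delta> =
     Metric_space.mtopology (topspace T // zero_rel (topspace T) \<delta>) (quot_dist (topspace T) \<delta>)"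

definition quot_measure ::
  "'a topology \<Rightarrow> ('a \<Rightarrow> 'a \<Rightarrow> real) \<Rightarrow> 'a measure \<Rightarrow> 'a set measure" where
  "quot_measure T \<delta> m = distr m (borel_of (quot_topology T \<delta>)) (quot_proj (topspace T) \<delta>)"

definition cheeger_quot ::
  "'a topology \<Rightarrow> ('a \<Rightarrow> 'a \<Rightarrow> real) \<Rightarrow> 'a measure \<Rightarrow> ('a set \<Rightarrow> real) \<Rightarrow> ennreal" where
  "cheeger_quot T \<delta> m =
     cheeger (quot_topology T \<delta>) (\<lambda>A B. ennreal (quot_dist (topspace T) \<delta> A B))
       (quot_measure T \<delta> m)"

definition factors_to ::
  "'a topology \<Rightarrow> ('a \<Rightarrow> 'a \<Rightarrow> real) \<Rightarrow> 'a measure \<Rightarrow> ('a \<Rightarrow> real) \<Rightarrow> ('a set \<Rightarrow> real) \<Rightarrow> bool" where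
  "factors_to T \<delta> m f g \<longleftrightarrow>
     g \<in> L2 (quot_measure T \<delta> m) \<and> (AE x in m. f x = g (quot_proj (topspace T) \<delta> x))"

definition cheeger_semi ::
  "'a topology \<Rightarrow> ('a \<Rightarrow> 'a \<Rightarrow> real) \<Rightarrow> 'a measure \<Rightarrow> ('a \<Rightarrow> real) \<Rightarrow> ennreal" where
  "cheeger_semi T \<delta> m f =
     (if \<exists>g. factors_to T \<delta> m f g
      then cheeger_quot T \<delta> m (SOME g. factors_to T \<delta> m f g) else \<infinity>)"


section \<open>Gradient curves\<close>

definition subdifferential ::
  "'a measure \<Rightarrow> (('a \<Rightarrow> real) \<Rightarrow> ennreal) \<Rightarrow> ('a \<Rightarrow> real) \<Rightarrow> ('a \<Rightarrow> real) set" where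
  "subdifferential m \<Phi> f =
     {\<xi> \<in> L2 m. f \<in> energy_domain m \<Phi> \<and>
        (\<forall>h\<in>L2 m. enn2ereal (\<Phi> f) + ereal (\<integral>x. \<xi> x * (h x - f x) \<partial>m) \<le> enn2ereal (\<Phi> h))}"

definition l2_has_derivative ::
  "'a measure \<Rightarrow> (real \<Rightarrow> 'a \<Rightarrow> real) \<Rightarrow> ('a \<Rightarrow> real) \<Rightarrow> real \<Rightarrow> bool" where
  "l2_has_derivative m u v t \<longleftrightarrow> l2_tendsto m (\<lambda>s x. (u s x - u t x) / (s - t)) v (at t)"

definition l2_loc_abs_continuous :: "'a measure \<Rightarrow> (real \<Rightarrow> 'a \<Rightarrow> real) \<Rightarrow> bool" where
  "l2_loc_abs_continuous m u \<longleftrightarrow>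
     (\<forall>a b. 0 < a \<and> a \<le> b \<longrightarrow>
        (\<exists>w :: real \<Rightarrow> real. set_integrable lborel {a..b} w \<and>
           (\<forall>s t. a \<le> s \<and> s \<le> t \<and> t \<le> b \<longrightarrow>
              l2norm m (\<lambda>x. u t x - u s x) \<le> (LINT r:{s..t}|lborel. w r))))"

text \<open>That the starting point lies in the closure of the domain of \<open>\<Phi>\<close> is a consequence: the curve
  takes values in the domain at almost every positive time and is continuous at \<open>0\<close>.\<close>

definition gradient_curve ::
  "'a measure \<Rightarrow> (('a \<Rightarrow> real) \<Rightarrow> ennreal) \<Rightarrow> ('a \<Rightarrow> real) \<Rightarrow> (real \<Rightarrow> 'a \<Rightarrow> real) \<Rightarrow> bool" where
  "gradient_curve m \<Phi> f0 u \<longleftrightarrow>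
     (\<forall>t\<ge>0. u t \<in> L2 m) \<and>
     (\<forall>t\<ge>0. l2_tendsto m u (u t) (at t within {0..})) \<and>
     l2_loc_abs_continuous m u \<and>
     (AE x in m. u 0 x = f0 x) \<and>
     (AE t in lborel. 0 < t \<longrightarrow>
        (\<exists>v\<in>L2 m. l2_has_derivative m u v t \<and> (\<lambda>x. - v x) \<in> subdifferential m \<Phi> (u t)))"

end

theory Submission
  imports Defs
begin

text \<open>
  Everything rests on one approximation statement: for \<open>f \<in> Lip\<^sub>b(X,\<tau>,d)\<close> there are an index \<open>i\<close> and a bounded
  \<open>d\<^sub>i\<close>-Lipschitz \<open>F\<close> that is close to \<open>f\<close> in \<open>L\<^sup>2\<close> and whose \<open>d\<^sub>i\<close>-slope exceeds the envelope of the
  \<open>d\<close>-slope of \<open>f\<close> only by little. On a compact set \<open>K\<close> of almost full measure the slope of \<open>f\<close> is bounded by a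
  continuous \<open>s\<close> at a fixed \<open>d\<close>-scale \<open>r\<close>, and compactness of \<open>K \<times> K \<times> K\<close> transfers this bound, up to an
  error \<open>\<theta>\<close>, to one \<open>d\<^sub>i\<close>. Then \<open>F\<close> is the infimum of \<open>f(x\<^sub>N) + \<Sum> cost(x\<^sub>k, x\<^sub>k\<^sub>+\<^sub>1)\<close> over finite chains
  ending in \<open>K\<close>, where short steps cost \<open>s\<close> times their \<open>d\<^sub>i\<close>-length. Grouping the steps into blocks of length about
  \<open>r\<close> makes the number of errors proportional to the length, so \<open>F\<close> is not much smaller than \<open>f\<close> on \<open>K\<close>.

  Hence the energies \<open>Ch\<^sub>i\<close> lie above \<open>Ch\<close> and admit recovery sequences. The evolution variational inequality, applied
  to both curves on the intervals of a fine partition, turns this into convergence of the gradient curves without any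
  bound on their velocities. For the slopes, near-minimisers of the \<open>L\<^sup>2\<close> norm among upper bounds of the slopes of
  functions close to \<open>f\<close> form a Cauchy sequence by the parallelogram identity.
\<close>

section \<open>The space of square integrable functions\<close>

text \<open>Being Lipschitz for \<open>d\<close> says nothing about a single \<open>di i\<close>:
  its balls are far larger, and an extension with the global constant would only have that constant
  as slope bound. So the weight must vary with the point, and compactness must choose the index.
  Compactness yields inequalities only up to an additive error, and a chain may have arbitrarily
  many tiny steps; one error per step would be fatal, hence a surcharge proportional to length,
  which pays once per block.

  The slope of f for \<open>d\<close> need not be measurable. It is handled through measurable upper
  bounds, and the set where it is controlled at a given scale through projections of compact sets.

  For the flows the partition is fixed before the index: finitely many recovery functions suffice,
  one per partition time, and one index dominates all that they require.

  A relaxed slope only lies above a weak limit point. It is compared with the strong limit of the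
  near-minimisers by testing against elements of minimal norm, whose first-order condition is linear
  and so survives weak limits.\<close>

lemma L2_measurable [measurable_dest]: "f \<in> L2 m \<Longrightarrow> f \<in> borel_measurable m"
  by (simp add: L2_def)

lemma L2_integrable_square: "f \<in> L2 m \<Longrightarrow> integrable m (\<lambda>x. (f x)\<^sup>2)"
  by (simp add: L2_def)

lemma L2_mult_integrable:
  assumes "f \<in> L2 m" "g \<in> L2 m"
  shows "integrable m (\<lambda>x. f x * g x)"
proof (rule Bochner_Integration.integrable_bound)
  show "integrable m (\<lambda>x. (f x)\<^sup>2 + (g x)\<^sup>2)"
    using assms by (intro Bochner_Integration.integrable_add L2_integrable_square)
  show "(\<lambda>x. f x * g x) \<in> borel_measurable m" using assms by measurable
  have "\<bar>a * b\<bar> \<le> a\<^sup>2 + b\<^sup>2" for a b :: real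
  proof -
    have "0 \<le> \<bar>a\<bar> * \<bar>b\<bar>" by simp
    moreover have "2 * (\<bar>a\<bar> * \<bar>b\<bar>) \<le> a\<^sup>2 + b\<^sup>2"
      using sum_squares_bound[of "\<bar>a\<bar>" "\<bar>b\<bar>"] by (simp add: mult.assoc)
    ultimately show ?thesis unfolding abs_mult by linarith
  qed
  then show "AE x in m. norm (f x * g x) \<le> norm ((f x)\<^sup>2 + (g x)\<^sup>2)" by simp
qed

lemma L2_add:
  assumes "f \<in> L2 m" "g \<in> L2 m"
  shows "(\<lambda>x. f x + g x) \<in> L2 m"
proof -
  have "integrable m (\<lambda>x. (f x)\<^sup>2 + (g x)\<^sup>2 + 2 * (f x * g x))"
    using assms by (intro Bochner_Integration.integrable_add L2_integrable_square
        Bochner_Integration.integrable_mult_right L2_mult_integrable)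
  then show ?thesis using assms by (auto simp: L2_def power2_sum algebra_simps)
qed

lemma L2_scale: "f \<in> L2 m \<Longrightarrow> (\<lambda>x. c * f x) \<in> L2 m"
  by (auto simp: L2_def power_mult_distrib)

lemma L2_divide: "f \<in> L2 m \<Longrightarrow> (\<lambda>x. f x / c) \<in> L2 m"
  using L2_scale[of f m "1 / c"] by simp

lemma L2_uminus: "f \<in> L2 m \<Longrightarrow> (\<lambda>x. - f x) \<in> L2 m"
  using L2_scale[of f m "- 1"] by simp

lemma L2_diff: "f \<in> L2 m \<Longrightarrow> g \<in> L2 m \<Longrightarrow> (\<lambda>x. f x - g x) \<in> L2 m"
  using L2_add[of f m "\<lambda>x. - g x"] L2_uminus by auto

lemma L2_zero: "(\<lambda>x. 0) \<in> L2 m" by (simp add: L2_def)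

lemma L2_const: "finite_measure m \<Longrightarrow> (\<lambda>x. c) \<in> L2 m"
  by (simp add: L2_def finite_measure.integrable_const)

lemma L2_AE_cong:
  assumes "f \<in> L2 m" "g \<in> borel_measurable m" "AE x in m. f x = g x"
  shows "g \<in> L2 m"
proof -
  have "integrable m (\<lambda>x. (g x)\<^sup>2)"
    using L2_integrable_square[OF assms(1)] assms
    by (subst integrable_cong_AE[where g="\<lambda>x. (f x)\<^sup>2"]) auto
  then show ?thesis using assms by (simp add: L2_def)
qed

lemma L2_bound:
  assumes "g \<in> L2 m" "f \<in> borel_measurable m" "AE x in m. \<bar>f x\<bar> \<le> \<bar>g x\<bar>"
  shows "f \<in> L2 m"
proof -
  have "integrable m (\<lambda>x. (f x)\<^sup>2)"
    by (rule Bochner_Integration.integrable_bound[OF L2_integrable_square[OF assms(1)]])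
       (use assms in \<open>auto simp: abs_le_square_iff\<close>)
  then show ?thesis using assms by (simp add: L2_def)
qed

lemma L2_bounded:
  assumes "finite_measure m" "f \<in> borel_measurable m" "AE x in m. \<bar>f x\<bar> \<le> C"
  shows "f \<in> L2 m"
  by (rule L2_bound[OF L2_const[OF assms(1), of C] assms(2)]) (use assms(3) in auto)

section \<open>Norm, inner product and completeness\<close>

abbreviation "l2dist m f g \<equiv> l2norm m (\<lambda>x. f x - g x)"

lemma l2norm_nonneg [simp]: "0 \<le> l2norm m f" by (simp add: l2norm_def)

lemma l2norm_square: "(l2norm m f)\<^sup>2 = (\<integral>x. (f x)\<^sup>2 \<partial>m)"
  by (simp add: l2norm_def integral_nonneg_AE)

lemma l2norm_AE_cong:
  assumes "f \<in> borel_measurable m" "g \<in> borel_measurable m" "AE x in m. f x = g x"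
  shows "l2norm m f = l2norm m g"
  unfolding l2norm_def using assms by (intro arg_cong[where f=sqrt] integral_cong_AE) auto

lemma l2norm_mono:
  assumes "g \<in> L2 m" "f \<in> borel_measurable m" "AE x in m. \<bar>f x\<bar> \<le> \<bar>g x\<bar>"
  shows "l2norm m f \<le> l2norm m g"
  unfolding l2norm_def
  by (intro real_sqrt_le_mono integral_mono_AE L2_integrable_square L2_bound[OF assms] assms(1))
     (use assms(3) in \<open>auto simp: abs_le_square_iff\<close>)

lemma l2norm_scale: "l2norm m (\<lambda>x. c * f x) = \<bar>c\<bar> * l2norm m f"
  by (simp add: l2norm_def power_mult_distrib real_sqrt_mult)

lemma l2norm_minus: "l2norm m (\<lambda>x. - f x) = l2norm m f"
  by (simp add: l2norm_def)

lemma l2norm_commute: "l2dist m f g = l2dist m g f"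
  by (simp add: l2norm_def power2_commute)

lemma l2norm_zero [simp]: "l2norm m (\<lambda>x. 0) = 0" by (simp add: l2norm_def)

lemma l2norm_add_square:
  assumes "f \<in> L2 m" "g \<in> L2 m"
  shows "(l2norm m (\<lambda>x. f x + g x))\<^sup>2 = (l2norm m f)\<^sup>2 + 2 * (\<integral>x. f x * g x \<partial>m) + (l2norm m g)\<^sup>2"
proof -
  have "(\<integral>x. (f x + g x)\<^sup>2 \<partial>m) = (\<integral>x. (f x)\<^sup>2 + 2 * (f x * g x) + (g x)\<^sup>2 \<partial>m)"
    by (intro Bochner_Integration.integral_cong) (auto simp: power2_sum algebra_simps)
  also have "\<dots> = (\<integral>x. (f x)\<^sup>2 \<partial>m) + 2 * (\<integral>x. f x * g x \<partial>m) + (\<integral>x. (g x)\<^sup>2 \<partial>m)"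
    using L2_mult_integrable[OF assms] L2_integrable_square[OF assms(1)] L2_integrable_square[OF assms(2)]
    by simp
  finally show ?thesis by (simp add: l2norm_square)
qed

lemma l2norm_diff_square:
  assumes "f \<in> L2 m" "g \<in> L2 m"
  shows "(l2dist m f g)\<^sup>2 = (l2norm m f)\<^sup>2 - 2 * (\<integral>x. f x * g x \<partial>m) + (l2norm m g)\<^sup>2"
  using l2norm_add_square[OF assms(1) L2_uminus[OF assms(2)]] by (simp add: l2norm_minus)

lemma l2_Cauchy_Schwarz:
  assumes "f \<in> L2 m" "g \<in> L2 m"
  shows "\<bar>\<integral>x. f x * g x \<partial>m\<bar> \<le> l2norm m f * l2norm m g"
proof -
  define P where "P = (\<integral>x. f x * g x \<partial>m)"
  define a where "a = (l2norm m f)\<^sup>2"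
  define b where "b = (l2norm m g)\<^sup>2"
  have q: "0 \<le> a + 2 * t * P + t\<^sup>2 * b" for t
  proof -
    have "0 \<le> (l2norm m (\<lambda>x. f x + t * g x))\<^sup>2" by simp
    also have "\<dots> = a + 2 * t * P + t\<^sup>2 * b"
      using l2norm_add_square[OF assms(1) L2_scale[OF assms(2), of t]]
      by (simp add: l2norm_scale power_mult_distrib a_def b_def P_def mult.left_commute[of _ t] mult.assoc)
    finally show ?thesis .
  qed
  have "P\<^sup>2 \<le> a * b"
  proof (cases "b = 0")
    case True
    have "P = 0"
    proof (rule ccontr)
      assume "P \<noteq> 0"
      \<comment> \<open>For b = 0 the quadratic is affine in t, and this t gives it the value
        -1.\<close>
      then have "2 * (- (a + 1) / (2 * P)) * P = - (a + 1)" by (simp add: field_simps)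
      then show False using q[of "- (a + 1) / (2 * P)"] True by simp
    qed
    then show ?thesis using True by simp
  next
    case False
    then have b: "0 < b" by (simp add: b_def)
    \<comment> \<open>The quadratic is evaluated at its minimiser t = -P/b.\<close>
    have "0 \<le> a - P\<^sup>2 / b"
      using q[of "- P / b"] b by (simp add: field_simps power2_eq_square)
    then show ?thesis using b by (simp add: field_simps)
  qed
  then have "P\<^sup>2 \<le> (l2norm m f * l2norm m g)\<^sup>2" by (simp add: a_def b_def power_mult_distrib)
  then have "\<bar>P\<bar> \<le> \<bar>l2norm m f * l2norm m g\<bar>" by (simp only: abs_le_square_iff)
  then show ?thesis by (simp add: P_def)
qed

lemma l2norm_add_le:
  assumes "f \<in> L2 m" "g \<in> L2 m"
  shows "l2norm m (\<lambda>x. f x + g x) \<le> l2norm m f + l2norm m g"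
proof (rule power2_le_imp_le)
  show "(l2norm m (\<lambda>x. f x + g x))\<^sup>2 \<le> (l2norm m f + l2norm m g)\<^sup>2"
    using l2norm_add_square[OF assms] l2_Cauchy_Schwarz[OF assms] by (simp add: power2_sum)
qed simp

lemma l2norm_triangle:
  assumes "f \<in> L2 m" "g \<in> L2 m" "h \<in> L2 m"
  shows "l2dist m f h \<le> l2dist m f g + l2dist m g h"
  using l2norm_add_le[OF L2_diff[OF assms(1,2)] L2_diff[OF assms(2,3)]] by simp

lemma l2norm_le_diff:
  assumes "f \<in> L2 m" "g \<in> L2 m"
  shows "l2norm m f \<le> l2norm m g + l2dist m f g"
  using l2norm_add_le[OF assms(2) L2_diff[OF assms]] by simp

lemma l2norm_parallelogram:
  assumes "f \<in> L2 m" "g \<in> L2 m"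
  shows "(l2dist m f g)\<^sup>2 =
    2 * (l2norm m f)\<^sup>2 + 2 * (l2norm m g)\<^sup>2 - 4 * (l2norm m (\<lambda>x. (f x + g x) / 2))\<^sup>2"
proof -
  have "l2norm m (\<lambda>x. (f x + g x) / 2) = l2norm m (\<lambda>x. f x + g x) / 2"
    using l2norm_scale[of m "1/2" "\<lambda>x. f x + g x"] by simp
  then have "4 * (l2norm m (\<lambda>x. (f x + g x) / 2))\<^sup>2 = (l2norm m (\<lambda>x. f x + g x))\<^sup>2"
    by (simp only: power_divide) simp
  then show ?thesis
    using l2norm_add_square[OF assms] l2norm_diff_square[OF assms] by linarith
qed

lemma l2norm_eq_0_AE:
  assumes "f \<in> L2 m" "l2norm m f = 0"
  shows "AE x in m. f x = 0"
proof -
  have "(\<integral>x. (f x)\<^sup>2 \<partial>m) = 0" using assms(2) l2norm_square[of m f] by simp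
  then show ?thesis
    using integral_nonneg_eq_0_iff_AE[OF L2_integrable_square[OF assms(1)]] by simp
qed

lemma nn_integral_square_L2:
  assumes "f \<in> L2 m"
  shows "(\<integral>\<^sup>+x. ennreal ((f x)\<^sup>2) \<partial>m) = ennreal ((l2norm m f)\<^sup>2)"
  using nn_integral_eq_integral[OF L2_integrable_square[OF assms]] by (simp add: l2norm_square)

lemma L2_if_nn_integral:
  assumes "f \<in> borel_measurable m" "(\<integral>\<^sup>+x. ennreal ((f x)\<^sup>2) \<partial>m) < \<infinity>"
  shows "f \<in> L2 m"
  using assms by (auto simp: L2_def intro!: integrableI_bounded)

lemma L1_le_l2norm:
  assumes "prob_space m" "f \<in> L2 m"
  shows "integrable m f" "(\<integral>x. \<bar>f x\<bar> \<partial>m) \<le> l2norm m f"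
proof -
  interpret prob_space m by fact
  have one: "(\<lambda>x. 1) \<in> L2 m" by (rule L2_const) (rule finite_measure_axioms)
  show "integrable m f" using L2_mult_integrable[OF assms(2) one] by simp
  have abs: "(\<lambda>x. \<bar>f x\<bar>) \<in> L2 m" using assms by (auto simp: L2_def)
  have "l2norm m (\<lambda>x. 1) = 1" by (simp add: l2norm_def prob_space)
  moreover have "l2norm m (\<lambda>x. \<bar>f x\<bar>) = l2norm m f" by (simp add: l2norm_def)
  ultimately show "(\<integral>x. \<bar>f x\<bar> \<partial>m) \<le> l2norm m f"
    using l2_Cauchy_Schwarz[OF abs one] by simp
qed

text \<open>Riesz-Fischer for representatives: on a probability space an L2-Cauchy sequence is
  L1-Cauchy, so a subsequence converges almost everywhere, and Fatou turns the Cauchy estimate into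
  an estimate of the distance to its limit.\<close>

proposition L2_complete:
  assumes "prob_space m" and F: "\<And>n::nat. F n \<in> L2 m"
    and "\<forall>e>0. \<exists>N. \<forall>i\<ge>N. \<forall>j\<ge>N. l2dist m (F i) (F j) < e"
  obtains f where "f \<in> L2 m" "(\<lambda>n. l2dist m (F n) f) \<longlonglongrightarrow> 0"
proof -
  have Cauchy: "\<exists>N. \<forall>i\<ge>N. \<forall>j\<ge>N. l2dist m (F i) (F j) < e" if "0 < e" for e
    using assms(3) that by blast
  note [measurable] = L2_measurable[OF F]
  have "\<exists>N. \<forall>i\<ge>N. \<forall>j\<ge>N. (LINT x|m. norm (F i x - F j x)) < e" if "e > 0" for e :: real
    using Cauchy[OF that] L1_le_l2norm(2)[OF assms(1) L2_diff[OF F F]]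
    by (simp del: l2norm_def) (meson le_less_trans)
  then obtain r where r: "strict_mono r" "AE x in m. Cauchy (\<lambda>i. F (r i) x)"
    using cauchy_L1_AE_cauchy_subseq[of m F, OF L1_le_l2norm(1)[OF assms(1) F]] by metis
  define f where "f x = lim (\<lambda>i. F (r i) x)" for x
  have [measurable]: "f \<in> borel_measurable m" unfolding f_def by measurable
  have lim: "AE x in m. (\<lambda>i. F (r i) x) \<longlonglongrightarrow> f x"
    using r(2) by eventually_elim (simp add: f_def Cauchy_convergent_iff convergent_LIMSEQ_iff)
  have bound: "(\<integral>\<^sup>+x. ennreal ((F n x - f x)\<^sup>2) \<partial>m) \<le> ennreal (e\<^sup>2)"
    if N: "\<forall>i\<ge>N. \<forall>j\<ge>N. l2dist m (F i) (F j) < e" and n: "n \<ge> N" and e: "0 < e" for n N e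
  proof -
    have "(\<integral>\<^sup>+x. ennreal ((F n x - f x)\<^sup>2) \<partial>m) = (\<integral>\<^sup>+x. liminf (\<lambda>i. ennreal ((F n x - F (r i) x)\<^sup>2)) \<partial>m)"
    proof (rule nn_integral_cong_AE)
      show "AE x in m. ennreal ((F n x - f x)\<^sup>2) = liminf (\<lambda>i. ennreal ((F n x - F (r i) x)\<^sup>2))"
        using lim
      proof eventually_elim
        fix x assume "(\<lambda>i. F (r i) x) \<longlonglongrightarrow> f x"
        then have "(\<lambda>i. ennreal ((F n x - F (r i) x)\<^sup>2)) \<longlonglongrightarrow> ennreal ((F n x - f x)\<^sup>2)"
          by (intro tendsto_intros)
        then show "ennreal ((F n x - f x)\<^sup>2) = liminf (\<lambda>i. ennreal ((F n x - F (r i) x)\<^sup>2))"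
          using lim_imp_Liminf[OF trivial_limit_sequentially] by metis
      qed
    qed
    also have "\<dots> \<le> liminf (\<lambda>i. \<integral>\<^sup>+x. ennreal ((F n x - F (r i) x)\<^sup>2) \<partial>m)"
      by (rule nn_integral_liminf) measurable
    also have "\<dots> \<le> liminf (\<lambda>i::nat. ennreal (e\<^sup>2))"
    proof (rule Liminf_mono)
      show "\<forall>\<^sub>F i in sequentially. (\<integral>\<^sup>+x. ennreal ((F n x - F (r i) x)\<^sup>2) \<partial>m) \<le> ennreal (e\<^sup>2)"
      proof (rule eventually_sequentiallyI)
        fix i assume "i \<ge> N"
        then have "r i \<ge> N" using seq_suble[OF r(1), of i] by simp
        then have "l2dist m (F n) (F (r i)) < e" using N n by blast
        then show "(\<integral>\<^sup>+x. ennreal ((F n x - F (r i) x)\<^sup>2) \<partial>m) \<le> ennreal (e\<^sup>2)"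
          using nn_integral_square_L2[OF L2_diff[OF F F]] e by (simp add: power_mono)
      qed
    qed
    also have "\<dots> = ennreal (e\<^sup>2)" by (simp add: Liminf_const)
    finally show ?thesis .
  qed
  have D: "(\<lambda>x. F n x - f x) \<in> L2 m \<and> l2dist m (F n) f \<le> e"
    if N: "\<forall>i\<ge>N. \<forall>j\<ge>N. l2dist m (F i) (F j) < e" and n: "n \<ge> N" and e: "0 < e" for n N e
  proof -
    have L: "(\<lambda>x. F n x - f x) \<in> L2 m"
      by (rule L2_if_nn_integral) (use bound[OF that] in \<open>auto intro: le_less_trans\<close>)
    have "(l2dist m (F n) f)\<^sup>2 \<le> e\<^sup>2"
      using bound[OF that] nn_integral_square_L2[OF L] e by simp
    then show ?thesis using L e power2_le_imp_le[of "l2dist m (F n) f" e] by simp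
  qed
  obtain N where N: "\<forall>i\<ge>N. \<forall>j\<ge>N. l2dist m (F i) (F j) < 1" using Cauchy[of 1] by auto
  have "f \<in> L2 m" using L2_diff[OF F[of N] conjunct1[OF D[OF N]], of N] by simp
  moreover have "(\<lambda>n. l2dist m (F n) f) \<longlonglongrightarrow> 0"
  proof (rule LIMSEQ_I)
    fix e :: real assume e: "0 < e"
    obtain N where N: "\<forall>i\<ge>N. \<forall>j\<ge>N. l2dist m (F i) (F j) < e / 2" using Cauchy[of "e / 2"] e by auto
    then have "l2dist m (F n) f \<le> e / 2" if "n \<ge> N" for n
      using conjunct2[OF D[OF N that]] e by simp
    then show "\<exists>N. \<forall>n\<ge>N. norm (l2dist m (F n) f - 0) < e" using e by fastforce
  qed
  ultimately show thesis by (rule that)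
qed

section \<open>Asymptotic Lipschitz constants\<close>

text \<open>Multiplicative form of a bound on \<open>slope\<close>, free of quotients by 0 or
  \<infinity>; all later work with slopes goes through it.\<close>

definition local_lip :: "'a set \<Rightarrow> ('a \<Rightarrow> 'a \<Rightarrow> ennreal) \<Rightarrow> ('a \<Rightarrow> real) \<Rightarrow> 'a \<Rightarrow> real \<Rightarrow> real \<Rightarrow> bool" where
  "local_lip X d f x c \<rho> \<longleftrightarrow> (\<forall>y\<in>X. \<forall>z\<in>X. d y x < ennreal \<rho> \<longrightarrow> d z x < ennreal \<rho> \<longrightarrow>
     ennreal \<bar>f y - f z\<bar> \<le> ennreal c * d y z)"

lemma local_lip_mono:
  assumes "local_lip X d f x c \<rho>" "c \<le> c'" "\<rho>' \<le> \<rho>"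
  shows "local_lip X d f x c' \<rho>'"
  unfolding local_lip_def
proof (intro ballI impI)
  fix y z assume yz: "y \<in> X" "z \<in> X" "d y x < ennreal \<rho>'" "d z x < ennreal \<rho>'"
  have "ennreal \<rho>' \<le> ennreal \<rho>" using assms by (simp add: ennreal_leI)
  then have "ennreal \<bar>f y - f z\<bar> \<le> ennreal c * d y z"
    using assms(1) yz unfolding local_lip_def by (meson order_less_le_trans)
  also have "\<dots> \<le> ennreal c' * d y z"
    using assms by (intro mult_right_mono ennreal_leI) auto
  finally show "ennreal \<bar>f y - f z\<bar> \<le> ennreal c' * d y z" .
qed

definition slope :: "'a set \<Rightarrow> ('a \<Rightarrow> 'a \<Rightarrow> ennreal) \<Rightarrow> ('a \<Rightarrow> real) \<Rightarrow> 'a \<Rightarrow> real \<Rightarrow> ennreal" where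
  "slope X d f x r = Sup {ennreal \<bar>f y - f z\<bar> / d y z | y z.
     y \<in> X \<and> z \<in> X \<and> max (d y x) (d z x) < ennreal r \<and> 0 < d y z}"

lemma slope_mono: "r \<le> r' \<Longrightarrow> slope X d f x r \<le> slope X d f x r'"
  unfolding slope_def by (intro Sup_subset_mono) (use ennreal_leI order_less_le_trans in blast)

lemma slope_le: assumes "local_lip X d f x c \<rho>" shows "slope X d f x \<rho> \<le> ennreal c"
  unfolding slope_def
proof (rule Sup_least, safe)
  fix y z assume "y \<in> X" "z \<in> X" "max (d y x) (d z x) < ennreal \<rho>" "0 < d y z"
  then show "ennreal \<bar>f y - f z\<bar> / d y z \<le> ennreal c"
    using assms by (intro divide_le_posI_ennreal) (auto simp: local_lip_def mult.commute)
qed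

lemma lipschitz_wrt_zero:
  assumes "lipschitz_wrt X d f" "y \<in> X" "z \<in> X" "d y z = 0"
  shows "f y = f z"
proof -
  obtain L where "L \<ge> 0" "\<forall>x\<in>X. \<forall>y\<in>X. ennreal \<bar>f x - f y\<bar> \<le> ennreal L * d x y"
    using assms(1) unfolding lipschitz_wrt_def by blast
  then have "ennreal \<bar>f y - f z\<bar> \<le> 0" using assms by fastforce
  then show ?thesis by (simp add: ennreal_eq_0_iff)
qed

text \<open>Strictness gives \<open>0 < ennreal c\<close>, which is what pairs at infinite distance
  require, since 0 times \<infinity> is 0. Pairs at distance zero do not enter the supremum and are
  covered by the Lipschitz property.\<close>

lemma slope_less:
  assumes L: "lipschitz_wrt X d f" and less: "slope X d f x \<rho> < ennreal c"
  shows "local_lip X d f x c \<rho>"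
  unfolding local_lip_def
proof (intro ballI impI)
  fix y z assume yz: "y \<in> X" "z \<in> X" "d y x < ennreal \<rho>" "d z x < ennreal \<rho>"
  consider "d y z = 0" | "d y z = top" | "0 < d y z" "d y z < top"
    by (meson not_gr_zero top.not_eq_extremum)
  then show "ennreal \<bar>f y - f z\<bar> \<le> ennreal c * d y z"
  proof cases
    case 1
    then show ?thesis using lipschitz_wrt_zero[OF L yz(1,2)] by simp
  next
    case 2
    have "0 < ennreal c" using order_le_less_trans[OF zero_le less] .
    then show ?thesis using 2 by (simp add: ennreal_mult_top)
  next
    case 3
    have "ennreal \<bar>f y - f z\<bar> / d y z \<le> slope X d f x \<rho>"
      unfolding slope_def by (rule Sup_upper) (use yz 3 in force)
    then have "ennreal \<bar>f y - f z\<bar> / d y z \<le> ennreal c" using less by simp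
    then have "ennreal \<bar>f y - f z\<bar> / d y z * d y z \<le> ennreal c * d y z"
      by (rule mult_right_mono) simp
    then show ?thesis using 3 by (simp add: ennreal_divide_times mult_divide_eq_ennreal)
  qed
qed

text \<open>\<open>slope\<close> is monotone in the radius, so its limit at 0 is an infimum and a
  value below c is witnessed by a single radius.\<close>

lemma lip_a_eq: "lip_a X d f x = enn2real (INF r\<in>{0<..}. slope X d f x r)"
proof -
  have "(slope X d f x \<longlongrightarrow> (INF r\<in>{0<..}. slope X d f x r)) (at_right 0)"
  proof (rule order_tendstoI)
    fix a assume "a < (INF r\<in>{0<..}. slope X d f x r)"
    then have "a < slope X d f x r" if "0 < r" for r
      using that by (meson INF_lower greaterThan_iff order_less_le_trans)
    then show "\<forall>\<^sub>F r in at_right 0. a < slope X d f x r"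
      using eventually_at_right_less by (rule eventually_mono[rotated])
  next
    fix a assume "(INF r\<in>{0<..}. slope X d f x r) < a"
    then obtain r0 where r0: "0 < r0" "slope X d f x r0 < a" by (auto simp: INF_less_iff)
    then have "\<forall>r>0. r < r0 \<longrightarrow> slope X d f x r < a"
      by (meson slope_mono less_imp_le order_le_less_trans)
    then show "\<forall>\<^sub>F r in at_right 0. slope X d f x r < a"
      using r0(1) by (auto simp: eventually_at_right_field)
  qed
  then have "Lim (at_right 0) (slope X d f x) = (INF r\<in>{0<..}. slope X d f x r)"
    by (intro tendsto_Lim) auto
  then show ?thesis by (simp add: lip_a_def slope_def[abs_def])
qed

lemma lip_a_nonneg [simp]: "0 \<le> lip_a X d f x" by (simp add: lip_a_def)

lemma lip_a_leI:
  assumes "\<And>e. 0 < e \<Longrightarrow> \<exists>\<rho>>0. local_lip X d f x (c + e) \<rho>" "0 \<le> c"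
  shows "lip_a X d f x \<le> c"
proof -
  have "(INF r\<in>{0<..}. slope X d f x r) \<le> ennreal c"
  proof (rule ennreal_le_epsilon)
    fix e :: real assume "0 < e"
    then obtain \<rho> where "\<rho> > 0" "local_lip X d f x (c + e) \<rho>" using assms by blast
    then have "(INF r\<in>{0<..}. slope X d f x r) \<le> ennreal (c + e)"
      using slope_le by (intro INF_lower2[of \<rho>]) auto
    then show "(INF r\<in>{0<..}. slope X d f x r) \<le> ennreal c + ennreal e"
      using \<open>0 < e\<close> assms by simp
  qed
  then show ?thesis using assms(2) by (simp add: lip_a_eq enn2real_leI)
qed

lemma lipschitz_wrt_local:
  assumes "\<And>x y. x \<in> X \<Longrightarrow> y \<in> X \<Longrightarrow> ennreal \<bar>f x - f y\<bar> \<le> ennreal L * d x y"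
  shows "local_lip X d f x L \<rho>"
  using assms by (auto simp: local_lip_def)

lemma lip_a_le_const:
  assumes "\<And>x y. x \<in> X \<Longrightarrow> y \<in> X \<Longrightarrow> ennreal \<bar>f x - f y\<bar> \<le> ennreal L * d x y" "0 \<le> L"
  shows "lip_a X d f x \<le> L"
proof (rule lip_a_leI)
  fix e :: real assume "0 < e"
  then show "\<exists>\<rho>>0. local_lip X d f x (L + e) \<rho>"
    using local_lip_mono[OF lipschitz_wrt_local[of X f L d x 1, OF assms(1)], of "L + e" 1] by (intro exI[of _ 1]) auto
qed (use assms in auto)

text \<open>The Lipschitz bound makes the infimum finite, so \<open>enn2real\<close> loses nothing
  and strictness carries over from reals to \<open>ennreal\<close>.\<close>

lemma lip_a_less:
  assumes L: "lipschitz_wrt X d f" and less: "lip_a X d f x < c"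
  shows "\<exists>\<rho>>0. local_lip X d f x c \<rho>"
proof -
  obtain L where L': "L \<ge> 0" "\<And>x y. x \<in> X \<Longrightarrow> y \<in> X \<Longrightarrow> ennreal \<bar>f x - f y\<bar> \<le> ennreal L * d x y"
    using L unfolding lipschitz_wrt_def by blast
  have "(INF r\<in>{0<..}. slope X d f x r) \<le> ennreal L"
    using slope_le[OF lipschitz_wrt_local[OF L'(2)]] by (intro INF_lower2[of 1]) auto
  then have "(INF r\<in>{0<..}. slope X d f x r) < top" using le_less_trans by fastforce
  then have "(INF r\<in>{0<..}. slope X d f x r) = ennreal (lip_a X d f x)" by (simp add: lip_a_eq)
  also have "\<dots> < ennreal c"
    using less lip_a_nonneg[of X d f x] by (intro ennreal_lessI) linarith+
  finally show ?thesis using slope_less[OF L] by (auto simp: INF_less_iff)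
qed

lemma abs_convex_diff_le:
  fixes f g :: "'a \<Rightarrow> real"
  assumes *: "ennreal \<bar>f y - f z\<bar> \<le> ennreal a * D" "ennreal \<bar>g y - g z\<bar> \<le> ennreal b * D"
    and nn: "0 \<le> a" "0 \<le> b" and t: "0 \<le> t" "t \<le> 1"
  shows "ennreal \<bar>((1 - t) * f y + t * g y) - ((1 - t) * f z + t * g z)\<bar> \<le> ennreal ((1 - t) * a + t * b) * D"
proof -
  have "((1 - t) * f y + t * g y) - ((1 - t) * f z + t * g z) = (1 - t) * (f y - f z) + t * (g y - g z)"
    by (simp add: algebra_simps)
  then have "\<bar>((1 - t) * f y + t * g y) - ((1 - t) * f z + t * g z)\<bar> \<le> (1 - t) * \<bar>f y - f z\<bar> + t * \<bar>g y - g z\<bar>"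
    using t abs_triangle_ineq[of "(1 - t) * (f y - f z)" "t * (g y - g z)"] by (simp add: abs_mult)
  then have "ennreal \<bar>((1 - t) * f y + t * g y) - ((1 - t) * f z + t * g z)\<bar>
      \<le> ennreal ((1 - t) * \<bar>f y - f z\<bar> + t * \<bar>g y - g z\<bar>)"
    by (rule ennreal_leI)
  also have "\<dots> = ennreal (1 - t) * ennreal \<bar>f y - f z\<bar> + ennreal t * ennreal \<bar>g y - g z\<bar>"
    using t by (simp add: ennreal_plus ennreal_mult)
  also have "\<dots> \<le> ennreal (1 - t) * (ennreal a * D) + ennreal t * (ennreal b * D)"
    using * by (intro mult_left_mono add_mono) auto
  also have "\<dots> = ennreal ((1 - t) * a + t * b) * D"
    using nn t by (simp add: ennreal_plus ennreal_mult distrib_right mult.assoc)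
  finally show ?thesis .
qed

lemma local_lip_convex:
  assumes "local_lip X d f x a \<rho>" "local_lip X d g x b \<rho>" "0 \<le> a" "0 \<le> b" "0 \<le> t" "t \<le> 1"
  shows "local_lip X d (\<lambda>x. (1 - t) * f x + t * g x) x ((1 - t) * a + t * b) \<rho>"
  using assms unfolding local_lip_def by (intro ballI impI abs_convex_diff_le) blast+

text \<open>On the smaller of two radii both local bounds hold and can be combined. This is the
  source of the convexity of \<open>upper_slopes\<close>.\<close>

lemma lip_a_convex:
  assumes "lipschitz_wrt X d f" "lipschitz_wrt X d g" and t: "0 \<le> t" "t \<le> 1"
  shows "lip_a X d (\<lambda>x. (1 - t) * f x + t * g x) x \<le> (1 - t) * lip_a X d f x + t * lip_a X d g x"
proof (rule lip_a_leI)
  fix e :: real assume e: "0 < e"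
  obtain \<rho>1 where 1: "\<rho>1 > 0" "local_lip X d f x (lip_a X d f x + e) \<rho>1"
    using lip_a_less[OF assms(1)] e by (metis less_add_same_cancel1)
  obtain \<rho>2 where 2: "\<rho>2 > 0" "local_lip X d g x (lip_a X d g x + e) \<rho>2"
    using lip_a_less[OF assms(2)] e by (metis less_add_same_cancel1)
  have "local_lip X d (\<lambda>x. (1 - t) * f x + t * g x) x
      ((1 - t) * (lip_a X d f x + e) + t * (lip_a X d g x + e)) (min \<rho>1 \<rho>2)"
    by (intro local_lip_convex local_lip_mono[OF 1(2)] local_lip_mono[OF 2(2)] t) (use e in auto)
  moreover have "(1 - t) * (lip_a X d f x + e) + t * (lip_a X d g x + e) =
      (1 - t) * lip_a X d f x + t * lip_a X d g x + e" by (simp add: algebra_simps)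
  ultimately show "\<exists>\<rho>>0. local_lip X d (\<lambda>x. (1 - t) * f x + t * g x) x
      ((1 - t) * lip_a X d f x + t * lip_a X d g x + e) \<rho>"
    using 1 2 by (intro exI[of _ "min \<rho>1 \<rho>2"]) auto
qed (use t in simp)

lemma lipschitz_wrt_convex:
  assumes "lipschitz_wrt X d f" "lipschitz_wrt X d g" and t: "0 \<le> t" "t \<le> 1"
  shows "lipschitz_wrt X d (\<lambda>x. (1 - t) * f x + t * g x)"
proof -
  obtain L where L: "L \<ge> 0" "\<forall>x\<in>X. \<forall>y\<in>X. ennreal \<bar>f x - f y\<bar> \<le> ennreal L * d x y"
    using assms(1) unfolding lipschitz_wrt_def by blast
  obtain M where M: "M \<ge> 0" "\<forall>x\<in>X. \<forall>y\<in>X. ennreal \<bar>g x - g y\<bar> \<le> ennreal M * d x y"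
    using assms(2) unfolding lipschitz_wrt_def by blast
  show ?thesis unfolding lipschitz_wrt_def
    using L M t by (intro exI[of _ "(1 - t) * L + t * M"] conjI ballI abs_convex_diff_le) auto
qed

lemma lipschitz_wrtE:
  assumes "lipschitz_wrt X d f"
  obtains L where "0 < L" "\<forall>x\<in>X. \<forall>y\<in>X. ennreal \<bar>f x - f y\<bar> \<le> ennreal L * d x y"
proof -
  obtain L where L: "L \<ge> 0" "\<forall>x\<in>X. \<forall>y\<in>X. ennreal \<bar>f x - f y\<bar> \<le> ennreal L * d x y"
    using assms unfolding lipschitz_wrt_def by blast
  have "ennreal L * d x y \<le> ennreal (L + 1) * d x y" for x y
    by (intro mult_right_mono ennreal_leI) auto
  then show thesis using that[of "L + 1"] L by (meson add_nonneg_pos order_trans zero_less_one)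
qed

lemma lipschitz_wrt_mono_dist:
  assumes "lipschitz_wrt X d f" "\<And>x y. x \<in> X \<Longrightarrow> y \<in> X \<Longrightarrow> d x y \<le> d' x y"
  shows "lipschitz_wrt X d' f"
proof -
  obtain L where L: "L \<ge> 0" "\<forall>x\<in>X. \<forall>y\<in>X. ennreal \<bar>f x - f y\<bar> \<le> ennreal L * d x y"
    using assms(1) unfolding lipschitz_wrt_def by blast
  moreover have "ennreal L * d x y \<le> ennreal L * d' x y" if "x \<in> X" "y \<in> X" for x y
    using assms(2)[OF that] by (rule mult_left_mono) simp
  ultimately show ?thesis unfolding lipschitz_wrt_def by (meson order_trans)
qed

text \<open>A larger distance has smaller balls and larger denominators; both effects lower the
  slope.\<close>

lemma lip_a_mono_dist:
  assumes L: "lipschitz_wrt X d f" and le: "\<And>x y. x \<in> X \<Longrightarrow> y \<in> X \<Longrightarrow> d x y \<le> d' x y" and x: "x \<in> X"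
  shows "lip_a X d' f x \<le> lip_a X d f x"
proof (rule lip_a_leI)
  fix e :: real assume e: "0 < e"
  obtain \<rho> where \<rho>: "\<rho> > 0" "local_lip X d f x (lip_a X d f x + e) \<rho>"
    using lip_a_less[OF L] e by (metis less_add_same_cancel1)
  have "local_lip X d' f x (lip_a X d f x + e) \<rho>"
    unfolding local_lip_def
  proof (intro ballI impI)
    fix y z assume yz: "y \<in> X" "z \<in> X" "d' y x < ennreal \<rho>" "d' z x < ennreal \<rho>"
    then have "ennreal \<bar>f y - f z\<bar> \<le> ennreal (lip_a X d f x + e) * d y z"
      using \<rho>(2) le[OF _ x] unfolding local_lip_def by (meson order_le_less_trans)
    also have "\<dots> \<le> ennreal (lip_a X d f x + e) * d' y z"
      using le yz by (intro mult_left_mono) auto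
    finally show "ennreal \<bar>f y - f z\<bar> \<le> ennreal (lip_a X d f x + e) * d' y z" .
  qed
  then show "\<exists>\<rho>>0. local_lip X d' f x (lip_a X d f x + e) \<rho>" using \<rho> by blast
qed simp

section \<open>Borel measurability of slopes and existence of essential envelopes\<close>

lemma space_borel_of: "sets m = sets (borel_of T) \<Longrightarrow> space m = topspace T"
  using sets_eq_imp_space_eq[of m "borel_of T"] by (simp add: borel_of_def space_measure_of_conv)

lemma openin_borel_of: "openin T U \<Longrightarrow> U \<in> sets (borel_of T)"
  unfolding borel_of_def by (subst sets_measure_of) (auto dest: openin_subset)

lemma closedin_borel_of: "closedin T C \<Longrightarrow> C \<in> sets (borel_of T)"
  using openin_borel_of[of T "topspace T - C"] space_borel_of[of "borel_of T" T]
  by (metis Diff_Diff_Int closedin_def inf.absorb_iff2 sets.compl_sets)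

lemma borel_measurable_continuous_map:
  assumes "sets m = sets (borel_of T)" "continuous_map T euclideanreal f"
  shows "f \<in> borel_measurable m"
proof (rule borel_measurableI)
  fix S :: "real set" assume "open S"
  then have "openin T {x \<in> topspace T. f x \<in> S}"
    using assms(2) openin_continuous_map_preimage by force
  moreover have "f -` S \<inter> space m = {x \<in> topspace T. f x \<in> S}"
    using space_borel_of[OF assms(1)] by auto
  ultimately show "f -` S \<inter> space m \<in> sets m" using openin_borel_of assms(1) by auto
qed

lemma continuous_map_lipschitz:
  assumes lip: "lipschitz_wrt (topspace T) d f"
    and refl: "\<And>x. x \<in> topspace T \<Longrightarrow> d x x = 0"
    and ball: "\<And>x \<rho>. \<lbrakk>x \<in> topspace T; 0 < \<rho>\<rbrakk> \<Longrightarrow> openin T {y \<in> topspace T. d y x < ennreal \<rho>}"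
  shows "continuous_map T euclideanreal f"
  unfolding continuous_map_def
proof (intro conjI allI impI)
  obtain L where L: "0 < L" "\<forall>x\<in>topspace T. \<forall>y\<in>topspace T. ennreal \<bar>f x - f y\<bar> \<le> ennreal L * d x y"
    using lipschitz_wrtE[OF lip] by blast
  fix U assume U: "openin euclideanreal U"
  show "openin T {x \<in> topspace T. f x \<in> U}"
  proof (subst openin_subopen, intro ballI)
    fix x assume x: "x \<in> {x \<in> topspace T. f x \<in> U}"
    then obtain e where e: "0 < e" "ball (f x) e \<subseteq> U" using U by (auto simp: open_contains_ball)
    let ?B = "{y \<in> topspace T. d y x < ennreal (e / (2 * L))}"
    have "?B \<subseteq> {x \<in> topspace T. f x \<in> U}"
    proof safe
      fix y assume y: "y \<in> topspace T" "d y x < ennreal (e / (2 * L))"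
      have "ennreal \<bar>f y - f x\<bar> \<le> ennreal L * d y x" using L(2) x y by blast
      also have "\<dots> \<le> ennreal L * ennreal (e / (2 * L))" using y(2) by (intro mult_left_mono) auto
      also have "\<dots> = ennreal (e / 2)" using L(1) e(1) by (simp flip: ennreal_mult)
      finally have "\<bar>f y - f x\<bar> \<le> e / 2" using e(1) by (simp add: ennreal_le_iff)
      then show "f y \<in> U" using e by (auto simp: dist_real_def abs_minus_commute intro!: subsetD[OF e(2)])
    qed
    moreover have "x \<in> ?B" using x e L refl by simp
    ultimately show "\<exists>S. openin T S \<and> x \<in> S \<and> S \<subseteq> {x \<in> topspace T. f x \<in> U}"
      using ball[of x "e / (2 * L)"] x e L by auto
  qed
qed auto

text \<open>When balls are open the slope is upper semicontinuous: a bound on the ball of radius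
  \<rho> around x holds on the balls of radius \<rho>/2 around all points within \<rho>/2 of x. This
  serves the semidistances and their quotients; balls of \<open>d\<close> need not be open.\<close>

lemma borel_measurable_lip_a:
  assumes sets: "sets m = sets (borel_of T)"
    and tri: "\<And>x y z. \<lbrakk>x \<in> topspace T; y \<in> topspace T; z \<in> topspace T\<rbrakk> \<Longrightarrow> d x z \<le> d x y + d y z"
    and sym: "\<And>x y. \<lbrakk>x \<in> topspace T; y \<in> topspace T\<rbrakk> \<Longrightarrow> d x y = d y x"
    and refl: "\<And>x. x \<in> topspace T \<Longrightarrow> d x x = 0"
    and ball: "\<And>x \<rho>. \<lbrakk>x \<in> topspace T; 0 < \<rho>\<rbrakk> \<Longrightarrow> openin T {y \<in> topspace T. d y x < ennreal \<rho>}"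
    and L: "lipschitz_wrt (topspace T) d f"
  shows "lip_a (topspace T) d f \<in> borel_measurable m"
  unfolding borel_measurable_iff_less
proof
  fix c :: real
  let ?A = "{w \<in> space m. lip_a (topspace T) d f w < c}"
  have "openin T ?A"
  proof (subst openin_subopen, intro ballI)
    fix x assume "x \<in> ?A"
    then have x: "x \<in> topspace T" "lip_a (topspace T) d f x < c" by (auto simp: space_borel_of[OF sets])
    \<comment> \<open>An intermediate level, so that the non-strict bound at nearby points still
      lies below c.\<close>
    define c' where "c' = (lip_a (topspace T) d f x + c) / 2"
    have c': "lip_a (topspace T) d f x < c'" "c' < c" using x by (auto simp: c'_def)
    then have c'0: "0 \<le> c'" using lip_a_nonneg[of "topspace T" d f x] by linarith
    obtain \<rho> where \<rho>: "\<rho> > 0" "local_lip (topspace T) d f x c' \<rho>" using lip_a_less[OF L c'(1)] by blast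
    let ?B = "{y \<in> topspace T. d y x < ennreal (\<rho> / 2)}"
    have "lip_a (topspace T) d f y \<le> c'" if y: "y \<in> ?B" for y
    proof (rule lip_a_leI[OF _ c'0])
      fix e :: real assume "0 < e"
      have near: "d w x < ennreal \<rho>" if "w \<in> topspace T" "d w y < ennreal (\<rho> / 2)" for w
      proof -
        have "d w x \<le> d w y + d y x" using tri that y x by auto
        also have "\<dots> < ennreal (\<rho> / 2) + ennreal (\<rho> / 2)"
          using that y by (intro add_strict_mono) auto
        finally show ?thesis using \<rho> by (simp flip: ennreal_plus)
      qed
      have "local_lip (topspace T) d f y c' (\<rho> / 2)"
        using \<rho>(2) near unfolding local_lip_def by blast
      then show "\<exists>\<rho>>0. local_lip (topspace T) d f y (c' + e) \<rho>"
        using \<rho>(1) \<open>0 < e\<close> local_lip_mono[of "topspace T" d f y c' "\<rho> / 2" "c' + e" "\<rho> / 2"]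
        by (intro exI[of _ "\<rho> / 2"]) auto
    qed
    then have "?B \<subseteq> ?A" using c' by (fastforce simp: space_borel_of[OF sets])
    moreover have "x \<in> ?B" using x refl \<rho> by simp
    ultimately show "\<exists>S. openin T S \<and> x \<in> S \<and> S \<subseteq> ?A" using ball[of x "\<rho> / 2"] x \<rho> by auto
  qed
  then show "?A \<in> sets m" using openin_borel_of sets by auto
qed

text \<open>The function g need not be measurable. Among its bounded measurable majorants the
  integral is minimised, and the infimum of a minimising sequence is the envelope: a majorant k
  lying below it on a set of positive measure would allow the minimum with k to have a smaller
  integral.\<close>

lemma ess_envelope_exists:
  assumes "prob_space m" and g: "\<And>x. x \<in> space m \<Longrightarrow> 0 \<le> g x" "\<And>x. x \<in> space m \<Longrightarrow> g x \<le> L"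
  shows "\<exists>h. is_ess_envelope m g h"
proof -
  interpret prob_space m by fact
  define S where "S = {k \<in> borel_measurable m. (AE x in m. g x \<le> k x) \<and> (\<forall>x. 0 \<le> k x) \<and> (\<forall>x. k x \<le> max 0 L)}"
  have int: "integrable m k" if "k \<in> S" for k
    using that by (intro integrable_const_bound[of _ "max 0 L"]) (auto simp: S_def)
  define \<alpha> where "\<alpha> = (INF k\<in>S. \<integral>x. k x \<partial>m)"
  have ne: "S \<noteq> {}"
    using g by (intro ex_in_conv[THEN iffD1] exI[of _ "\<lambda>_. max 0 L"]) (auto simp: S_def intro!: AE_I2 max.coboundedI2)
  have bdd: "bdd_below ((\<lambda>k. \<integral>x. k x \<partial>m) ` S)"
    by (rule bdd_belowI2[of _ 0]) (auto simp: S_def)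
  have "\<exists>k\<in>S. (\<integral>x. k x \<partial>m) < \<alpha> + 1 / Suc n" for n
    using cINF_less_iff[OF ne bdd, of "\<alpha> + 1 / Suc n"] by (simp add: \<alpha>_def)
  then obtain k where k: "\<And>n. k n \<in> S" "\<And>n. (\<integral>x. k n x \<partial>m) < \<alpha> + 1 / Suc n" by metis
  have bk: "bdd_below (range (\<lambda>n. k n x))" for x using k(1) by (auto simp: S_def intro!: bdd_belowI2[of _ 0])
  define h where "h x = (INF n. k n x)" for x
  have h_le: "h x \<le> k n x" for x n unfolding h_def by (rule cINF_lower[OF bk]) simp
  have [measurable]: "h \<in> borel_measurable m"
    unfolding h_def using k(1) bk by (intro borel_measurable_cINF) (auto simp: S_def)
  have "AE x in m. \<forall>n. g x \<le> k n x" using k(1) by (auto simp: S_def AE_all_countable)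
  then have gh: "AE x in m. g x \<le> h x"
    by eventually_elim (auto simp: h_def intro!: cINF_greatest)
  have h0: "0 \<le> h x" for x unfolding h_def using k(1) by (auto simp: S_def intro!: cINF_greatest)
  have hL: "h x \<le> max 0 L" for x
  proof -
    have "k 0 x \<le> max 0 L" using k(1)[of 0] by (simp add: S_def)
    then show ?thesis using h_le[of x 0] by linarith
  qed
  have hS: "h \<in> S" using gh h0 hL by (simp add: S_def)
  have "(\<integral>x. h x \<partial>m) \<le> \<alpha> + 1 / Suc n" for n
    using integral_mono[OF int[OF hS] int[OF k(1)[of n]] h_le] k(2)[of n] by simp
  then have "\<forall>\<^sub>F n in sequentially. (\<integral>x. h x \<partial>m) \<le> \<alpha> + 1 / Suc n" by simp
  moreover have "(\<lambda>n. \<alpha> + 1 / Suc n) \<longlonglongrightarrow> \<alpha> + 0"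
    by (intro tendsto_intros LIMSEQ_Suc[OF lim_1_over_n])
  ultimately have h\<alpha>: "(\<integral>x. h x \<partial>m) \<le> \<alpha>"
    by (intro tendsto_lowerbound[where F=sequentially]) auto
  have "AE x in m. h x \<le> k x" if [measurable]: "k \<in> borel_measurable m" and gk: "AE x in m. g x \<le> k x" for k
  proof -
    \<comment> \<open>Truncation at 0 puts this function into S, whose members are nonnegative
      everywhere; it changes nothing almost everywhere because k dominates g, which is
      nonnegative.\<close>
    define k' where "k' x = max 0 (min (h x) (k x))" for x
    have [measurable]: "k' \<in> borel_measurable m" unfolding k'_def by measurable
    have "AE x in m. g x \<le> k' x" using gk gh by eventually_elim (auto simp: k'_def)
    then have S: "k' \<in> S" using h0 hL by (auto simp: S_def k'_def min.coboundedI1)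
    have le: "k' x \<le> h x" for x using h0 by (simp add: k'_def)
    have "\<alpha> \<le> (\<integral>x. k' x \<partial>m)" unfolding \<alpha>_def by (rule cINF_lower[OF bdd S])
    then have "(\<integral>x. h x - k' x \<partial>m) \<le> 0" using h\<alpha> int[OF hS] int[OF S] by simp
    moreover have "0 \<le> (\<integral>x. h x - k' x \<partial>m)" using le by (intro integral_nonneg_AE) auto
    ultimately have "AE x in m. h x - k' x = 0"
      using integral_nonneg_eq_0_iff_AE[of m "\<lambda>x. h x - k' x"] int[OF hS] int[OF S] le by auto
    moreover have "AE x in m. 0 \<le> k x" using gk AE_space by eventually_elim (use g(1) in force)
    ultimately show ?thesis by eventually_elim (auto simp: k'_def split: if_splits)
  qed
  then show ?thesis using gh by (intro exI[of _ h]) (auto simp: is_ess_envelope_def)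
qed

lemma lip_bD:
  assumes "f \<in> lip_b T d"
  shows "lipschitz_wrt (topspace T) d f" "continuous_map T euclideanreal f" "bounded (f ` topspace T)"
  using assms by (auto simp: lip_b_def)

lemma lip_b_convex:
  assumes "f \<in> lip_b T d" "g \<in> lip_b T d" and t: "0 \<le> t" "t \<le> 1"
  shows "(\<lambda>x. (1 - t) * f x + t * g x) \<in> lip_b T d"
proof -
  obtain a where a: "\<forall>x\<in>topspace T. \<bar>f x\<bar> \<le> a" using lip_bD(3)[OF assms(1)] by (auto simp: bounded_iff)
  obtain b where b: "\<forall>x\<in>topspace T. \<bar>g x\<bar> \<le> b" using lip_bD(3)[OF assms(2)] by (auto simp: bounded_iff)
  have "\<bar>(1 - t) * f x + t * g x\<bar> \<le> (1 - t) * a + t * b" if "x \<in> topspace T" for x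
  proof -
    have "\<bar>(1 - t) * f x + t * g x\<bar> \<le> (1 - t) * \<bar>f x\<bar> + t * \<bar>g x\<bar>"
      using t abs_triangle_ineq[of "(1 - t) * f x" "t * g x"] by (simp add: abs_mult)
    also have "\<dots> \<le> (1 - t) * a + t * b" using a b t that by (intro add_mono mult_left_mono) auto
    finally show ?thesis .
  qed
  then have "bounded ((\<lambda>x. (1 - t) * f x + t * g x) ` topspace T)"
    unfolding bounded_iff by (intro exI[of _ "(1 - t) * a + t * b"]) (simp add: image_iff ball_simps)
  then show ?thesis using lip_bD[OF assms(1)] lip_bD[OF assms(2)] t
    by (auto simp: lip_b_def lipschitz_wrt_convex intro!: continuous_intros)
qed

lemma lip_b_L2:
  assumes "prob_space m" "sets m = sets (borel_of T)" "f \<in> lip_b T d" shows "f \<in> L2 m"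
proof -
  obtain a where a: "\<forall>x\<in>topspace T. \<bar>f x\<bar> \<le> a" using lip_bD(3)[OF assms(3)] by (auto simp: bounded_iff)
  show ?thesis
    by (rule L2_bounded[of m f a])
       (use assms a borel_measurable_continuous_map[OF assms(2) lip_bD(2)[OF assms(3)]]
        in \<open>auto simp: prob_space_def space_borel_of[OF assms(2)]\<close>)
qed

lemma lip_a_star_envelope:
  assumes "prob_space m" "sets m = sets (borel_of T)" "lipschitz_wrt (topspace T) d f"
  shows "is_ess_envelope m (lip_a (topspace T) d f) (lip_a_star T d m f)"
proof -
  obtain L where L: "0 < L" "\<forall>x\<in>topspace T. \<forall>y\<in>topspace T. ennreal \<bar>f x - f y\<bar> \<le> ennreal L * d x y"
    using lipschitz_wrtE[OF assms(3)] by blast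
  have "lip_a (topspace T) d f x \<le> L" for x using lip_a_le_const[of "topspace T" f L d] L by simp
  then have "\<exists>h. is_ess_envelope m (lip_a (topspace T) d f) h"
    using ess_envelope_exists[OF assms(1), of "lip_a (topspace T) d f" L] by simp
  then show ?thesis unfolding lip_a_star_def by (rule someI_ex)
qed

lemma lip_a_star_AE_eq:
  assumes "prob_space m" "sets m = sets (borel_of T)" "lipschitz_wrt (topspace T) d f"
    "lip_a (topspace T) d f \<in> borel_measurable m"
  shows "AE x in m. lip_a_star T d m f x = lip_a (topspace T) d f x"
proof -
  have "AE x in m. lip_a (topspace T) d f x \<le> lip_a_star T d m f x"
    "AE x in m. lip_a_star T d m f x \<le> lip_a (topspace T) d f x"
    using lip_a_star_envelope[OF assms(1-3)] assms(4) by (auto simp: is_ess_envelope_def)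
  then show ?thesis by eventually_elim simp
qed

lemma lip_a_star_bounds:
  assumes "prob_space m" "sets m = sets (borel_of T)"
    and L: "\<forall>x\<in>topspace T. \<forall>y\<in>topspace T. ennreal \<bar>f x - f y\<bar> \<le> ennreal L * d x y" "0 \<le> L"
  shows "lip_a_star T d m f \<in> borel_measurable m" "AE x in m. lip_a (topspace T) d f x \<le> lip_a_star T d m f x"
    "AE x in m. 0 \<le> lip_a_star T d m f x" "AE x in m. lip_a_star T d m f x \<le> L"
    "lip_a_star T d m f \<in> L2 m"
proof -
  have E: "is_ess_envelope m (lip_a (topspace T) d f) (lip_a_star T d m f)"
    using L by (intro lip_a_star_envelope assms) (auto simp: lipschitz_wrt_def)
  show 1: "lip_a_star T d m f \<in> borel_measurable m" and 2: "AE x in m. lip_a (topspace T) d f x \<le> lip_a_star T d m f x"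
    using E by (auto simp: is_ess_envelope_def)
  show 3: "AE x in m. 0 \<le> lip_a_star T d m f x"
    using 2 by eventually_elim (meson lip_a_nonneg order_trans)
  have "AE x in m. lip_a (topspace T) d f x \<le> L" using lip_a_le_const[of "topspace T" f L d] L by simp
  then show 4: "AE x in m. lip_a_star T d m f x \<le> L"
    using E unfolding is_ess_envelope_def by (auto dest!: bspec[of _ _ "\<lambda>_. L"])
  have "AE x in m. \<bar>lip_a_star T d m f x\<bar> \<le> L" using 3 4 by eventually_elim simp
  then show "lip_a_star T d m f \<in> L2 m"
    by (rule L2_bounded[OF _ 1, rotated]) (use assms in \<open>simp add: prob_space_def\<close>)
qed

section \<open>Gluing local slope bounds along chains\<close>

text \<open>Measure-free setting: of the function only the error-afflicted bounds
  \<open>triple\<close> and \<open>pair\<close> on K remain. The condition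
  \<open>4 * \<theta> \<le> r\<close> keeps a configuration of radius r/2 within radius r after its
  points are moved into K, and \<open>err_small\<close> lets the surcharge \<kappa> over a length
  r/2 pay for two errors.\<close>

locale slope_chain =
  fixes X :: "'a set" and \<delta> :: "'a \<Rightarrow> 'a \<Rightarrow> real" and K :: "'a set"
    and u s :: "'a \<Rightarrow> real" and \<Lambda> r \<theta> \<kappa> B :: real
  assumes semi: "semidistance_on X \<delta>"
    and K: "K \<subseteq> X" "K \<noteq> {}"
    and u_bound: "\<And>x. x \<in> K \<Longrightarrow> \<bar>u x\<bar> \<le> B"
    and s_bound: "\<And>x. x \<in> K \<Longrightarrow> 0 \<le> s x" "\<And>x. x \<in> K \<Longrightarrow> s x \<le> \<Lambda>"
    and pos: "0 < \<Lambda>" "0 < \<theta>" "0 < r" "0 < \<kappa>" "4 * \<theta> \<le> r"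
    and triple: "\<And>x y z. \<lbrakk>x \<in> K; y \<in> K; z \<in> K; \<delta> x y \<le> r; \<delta> x z \<le> r\<rbrakk>
        \<Longrightarrow> \<bar>u y - u z\<bar> \<le> s x * \<delta> y z + \<theta>"
    and pair: "\<And>y z. \<lbrakk>y \<in> K; z \<in> K\<rbrakk> \<Longrightarrow> \<bar>u y - u z\<bar> \<le> \<Lambda> * \<delta> y z + \<theta>"
    and err_small: "4 * (4 * \<Lambda> * \<theta> + \<theta> * (r + 2 * \<theta> + 2)) \<le> \<kappa> * r"
begin

text \<open>The loss in \<open>U_triple\<close>: 2\<Lambda>\<theta> for moving two endpoints into K,
  2\<Lambda>\<theta> for the distance gained by that, \<theta>(r + 2\<theta>) for the error in the
  weight, and one \<theta> each from \<open>triple\<close> and from \<open>u_le_U\<close>.\<close>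

definition err :: real where "err = 4 * \<Lambda> * \<theta> + \<theta> * (r + 2 * \<theta> + 2)"
text \<open>Both \<sigma> and U are McShane extensions from K. The steep rate \<Lambda>/\<theta> in
  \<sigma> makes it reach the cap \<Lambda> outside the \<theta>-neighbourhood A of K, while it
  stays continuous for \<delta>.\<close>

definition \<sigma> :: "'a \<Rightarrow> real" where "\<sigma> x = min \<Lambda> (INF y\<in>K. s y + \<Lambda> / \<theta> * \<delta> x y)"
definition U :: "'a \<Rightarrow> real" where "U x = (INF y\<in>K. u y + \<Lambda> * \<delta> x y)"
definition A :: "'a set" where "A = {x\<in>X. \<exists>x'\<in>K. \<delta> x x' \<le> \<theta>}"
text \<open>The maximum makes the cost symmetric, so that a one-sided estimate of the envelope
  becomes a Lipschitz estimate. Steps longer than r/2, where no local information is available, pay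
  the global constant.\<close>

definition cost :: "'a \<Rightarrow> 'a \<Rightarrow> real" where
  "cost x y = (if \<delta> x y \<le> r / 2 then max (\<sigma> x) (\<sigma> y) * \<delta> x y else \<Lambda> * \<delta> x y) + \<kappa> * \<delta> x y"

inductive chain :: "'a \<Rightarrow> real \<Rightarrow> bool" where
  start: "x \<in> K \<Longrightarrow> chain x (u x)"
| step: "\<lbrakk>chain y t; x \<in> X; y \<in> X\<rbrakk> \<Longrightarrow> chain x (cost x y + t)"

text \<open>Invariant for a chain read from its end in K to its head x. The open block began at a,
  has length at most l, and p is the point of it with the smallest weight seen. The condition
  \<open>U a \<le> v\<close> says that all earlier blocks are settled without remaining
  error.\<close>

definition grouped :: "'a \<Rightarrow> real \<Rightarrow> bool" where
  "grouped x t \<longleftrightarrow> (\<exists>a p v l. a \<in> A \<and> p \<in> X \<and> \<delta> p x \<le> l \<and> \<delta> p a \<le> l \<and> \<delta> x a \<le> l \<and>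
     0 \<le> l \<and> l \<le> r / 2 \<and> U a \<le> v \<and> v + (\<sigma> p + \<kappa>) * l \<le> t)"

text \<open>The cap B keeps the function bounded at points far from K; on K it is harmless because u
  is at most B there.\<close>

definition envelope :: "'a \<Rightarrow> real" where "envelope x = min B (Inf {t. chain x t})"

lemma dist: "x \<in> X \<Longrightarrow> y \<in> X \<Longrightarrow> 0 \<le> \<delta> x y" "x \<in> X \<Longrightarrow> \<delta> x x = 0"
  "x \<in> X \<Longrightarrow> y \<in> X \<Longrightarrow> \<delta> x y = \<delta> y x"
  "x \<in> X \<Longrightarrow> y \<in> X \<Longrightarrow> z \<in> X \<Longrightarrow> \<delta> x z \<le> \<delta> x y + \<delta> y z"
  using semi unfolding semidistance_on_def by blast+

lemma KX: "x \<in> K \<Longrightarrow> x \<in> X" using K by blast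
lemma AX: "x \<in> A \<Longrightarrow> x \<in> X" by (simp add: A_def)
lemma KA: "x \<in> K \<Longrightarrow> x \<in> A" using KX dist(2) pos by (force simp: A_def)

section \<open>Extending the weight and the function from K\<close>

lemma slope_const_pos: "0 < \<Lambda> / \<theta>" using pos by simp

lemma scaled_nonneg: "x \<in> X \<Longrightarrow> y \<in> X \<Longrightarrow> 0 \<le> \<Lambda> / \<theta> * \<delta> x y"
  by (rule mult_nonneg_nonneg) (use slope_const_pos dist(1) in auto)

lemma penalised_nonneg: "x \<in> X \<Longrightarrow> y \<in> K \<Longrightarrow> 0 \<le> s y + \<Lambda> / \<theta> * \<delta> x y"
  using s_bound(1) scaled_nonneg KX by (meson add_nonneg_nonneg)

lemma bdd_s: assumes "x \<in> X" shows "bdd_below ((\<lambda>y. s y + \<Lambda> / \<theta> * \<delta> x y) ` K)"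
  by (rule bdd_belowI2[of _ 0]) (rule penalised_nonneg[OF assms])

lemma bdd_U: "x \<in> X \<Longrightarrow> bdd_below ((\<lambda>y. u y + \<Lambda> * \<delta> x y) ` K)"
proof (rule bdd_belowI2[of _ "-B"])
  fix y assume "x \<in> X" "y \<in> K"
  then have "0 \<le> \<Lambda> * \<delta> x y" "\<bar>u y\<bar> \<le> B"
    using dist(1) KX pos u_bound by auto
  then show "- B \<le> u y + \<Lambda> * \<delta> x y" by linarith
qed

lemma \<sigma>_le: "\<sigma> x \<le> \<Lambda>" by (simp add: \<sigma>_def)

lemma \<sigma>_nonneg: assumes "x \<in> X" shows "0 \<le> \<sigma> x"
proof -
  have "0 \<le> (INF y\<in>K. s y + \<Lambda> / \<theta> * \<delta> x y)"
    by (rule cINF_greatest[OF K(2)]) (rule penalised_nonneg[OF assms])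
  then show ?thesis using pos by (simp add: \<sigma>_def)
qed

lemma \<sigma>_le_s: assumes "x \<in> K" shows "\<sigma> x \<le> s x"
proof -
  have "(INF y\<in>K. s y + \<Lambda> / \<theta> * \<delta> x y) \<le> s x + \<Lambda> / \<theta> * \<delta> x x"
    by (rule cINF_lower[OF bdd_s]) (use assms KX in auto)
  then show ?thesis using dist(2)[of x] assms KX by (auto simp: \<sigma>_def)
qed

lemma \<sigma>_lip: assumes "x \<in> X" "y \<in> X" shows "\<sigma> x \<le> \<sigma> y + \<Lambda> / \<theta> * \<delta> x y"
proof -
  have "(INF z\<in>K. s z + \<Lambda> / \<theta> * \<delta> x z) - \<Lambda> / \<theta> * \<delta> x y \<le> (INF z\<in>K. s z + \<Lambda> / \<theta> * \<delta> y z)"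
  proof (rule cINF_greatest[OF K(2)])
    fix z assume z: "z \<in> K"
    have "(INF z\<in>K. s z + \<Lambda> / \<theta> * \<delta> x z) \<le> s z + \<Lambda> / \<theta> * \<delta> x z"
      by (rule cINF_lower[OF bdd_s[OF assms(1)] z])
    moreover have "\<Lambda> / \<theta> * \<delta> x z \<le> \<Lambda> / \<theta> * (\<delta> x y + \<delta> y z)"
      by (rule mult_left_mono[OF dist(4)]) (use assms z KX slope_const_pos in auto)
    ultimately show "(INF z\<in>K. s z + \<Lambda> / \<theta> * \<delta> x z) - \<Lambda> / \<theta> * \<delta> x y \<le> s z + \<Lambda> / \<theta> * \<delta> y z"
      by (simp add: distrib_left)
  qed
  moreover have "0 \<le> \<Lambda> / \<theta> * \<delta> x y" using scaled_nonneg assms by blast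
  ultimately show ?thesis unfolding \<sigma>_def by linarith
qed

text \<open>If \<sigma> is below its cap, some y in K nearly attains the infimum with penalty
  \<Lambda>/\<theta> times the distance below \<Lambda>, so y is within \<theta>.\<close>

lemma \<sigma>_near: assumes "x \<in> X" "\<sigma> x < \<Lambda>"
  obtains x' where "x' \<in> K" "\<delta> x x' \<le> \<theta>" "s x' \<le> \<sigma> x + \<theta>"
proof -
  have "(INF y\<in>K. s y + \<Lambda> / \<theta> * \<delta> x y) < min \<Lambda> (\<sigma> x + \<theta>)"
    using assms pos unfolding \<sigma>_def by linarith
  then obtain y where y: "y \<in> K" "s y + \<Lambda> / \<theta> * \<delta> x y < min \<Lambda> (\<sigma> x + \<theta>)"
    using cINF_less_iff[OF K(2) bdd_s[OF assms(1)]] by blast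
  have nn: "0 \<le> \<Lambda> / \<theta> * \<delta> x y" using scaled_nonneg KX y assms by blast
  have "\<Lambda> / \<theta> * \<delta> x y \<le> \<Lambda>" using y s_bound(1)[of y] by linarith
  then have "\<delta> x y \<le> \<theta>" using pos by (simp add: field_simps)
  moreover have "s y \<le> \<sigma> x + \<theta>" using nn y(2) by linarith
  ultimately show thesis using that y by blast
qed

lemma A_if: assumes "x \<in> X" "\<sigma> x < \<Lambda>" shows "x \<in> A"
  using \<sigma>_near[OF assms] assms(1) unfolding A_def by blast

lemma U_lip: assumes "x \<in> X" "y \<in> X" shows "U x \<le> U y + \<Lambda> * \<delta> x y"
proof -
  have "U x - \<Lambda> * \<delta> x y \<le> (INF z\<in>K. u z + \<Lambda> * \<delta> y z)"
  proof (rule cINF_greatest[OF K(2)])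
    fix z assume z: "z \<in> K"
    have "U x \<le> u z + \<Lambda> * \<delta> x z"
      unfolding U_def by (rule cINF_lower[OF bdd_U[OF assms(1)] z])
    moreover have "\<Lambda> * \<delta> x z \<le> \<Lambda> * (\<delta> x y + \<delta> y z)"
      by (rule mult_left_mono[OF dist(4)]) (use assms z KX pos in auto)
    ultimately show "U x - \<Lambda> * \<delta> x y \<le> u z + \<Lambda> * \<delta> y z" by (simp add: distrib_left)
  qed
  then show ?thesis by (simp add: U_def)
qed

lemma U_le_u: assumes "x \<in> K" shows "U x \<le> u x"
proof -
  have "U x \<le> u x + \<Lambda> * \<delta> x x"
    unfolding U_def by (rule cINF_lower[OF bdd_U]) (use assms KX in auto)
  then show ?thesis using dist(2) KX assms by auto
qed

text \<open>The bound \<open>pair\<close> carries an additive error, so U extends u only up to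
  \<theta>.\<close>

lemma u_le_U: assumes "x \<in> K" shows "u x \<le> U x + \<theta>"
proof -
  have "u x - \<theta> \<le> U x" unfolding U_def
    by (rule cINF_greatest[OF K(2)]) (use pair[OF assms] in \<open>smt (verit)\<close>)
  then show ?thesis by simp
qed

text \<open>Carries \<open>triple\<close> over to the \<theta>-neighbourhood of K and to an
  arbitrary centre p of the space. If \<sigma> is at its cap at p the global Lipschitz bound
  suffices; otherwise p also has a point of K nearby.\<close>

lemma U_triple:
  assumes "p \<in> X" "y \<in> A" "z \<in> A" "\<delta> p y \<le> r / 2" "\<delta> p z \<le> r / 2"
  shows "U y \<le> U z + \<sigma> p * \<delta> y z + err"
proof (cases "\<sigma> p < \<Lambda>")
  case False
  then have "\<sigma> p = \<Lambda>" using \<sigma>_le[of p] by simp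
  moreover have "0 \<le> err" using pos by (simp add: err_def)
  ultimately show ?thesis using U_lip[of y z] assms AX by auto
next
  case True
  then obtain p' where p': "p' \<in> K" "\<delta> p p' \<le> \<theta>" "s p' \<le> \<sigma> p + \<theta>"
    using \<sigma>_near assms(1) by blast
  obtain y' where y': "y' \<in> K" "\<delta> y y' \<le> \<theta>" using assms A_def by auto
  obtain z' where z': "z' \<in> K" "\<delta> z z' \<le> \<theta>" using assms A_def by auto
  have X: "p \<in> X" "y \<in> X" "z \<in> X" "p' \<in> X" "y' \<in> X" "z' \<in> X"
    using assms AX KX p' y' z' by auto
  note sym = dist(3)[OF X(1) X(4)] dist(3)[OF X(2) X(5)] dist(3)[OF X(3) X(6)] dist(3)[OF X(1) X(2)]
  \<comment> \<open>Two displacements by \<theta> are added to the radius r/2; here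
    \<open>4 * \<theta> \<le> r\<close> enters.\<close>
  have "\<delta> p' y' \<le> r"
    using dist(4)[OF X(4,1,5)] dist(4)[OF X(1,2,5)] sym p' y' assms pos by linarith
  moreover have "\<delta> p' z' \<le> r"
    using dist(4)[OF X(4,1,6)] dist(4)[OF X(1,3,6)] sym p' z' assms pos by linarith
  ultimately have 1: "u y' - u z' \<le> s p' * \<delta> y' z' + \<theta>"
    using triple[OF p'(1) y'(1) z'(1)] by linarith
  have d: "\<delta> y' z' \<le> \<delta> y z + 2 * \<theta>"
    using dist(4)[OF X(5,2,6)] dist(4)[OF X(2,3,6)] sym y' z' by linarith
  have dyz: "\<delta> y z \<le> r" using dist(4)[OF X(2,1,3)] sym assms by linarith
  have "s p' * \<delta> y' z' \<le> (\<sigma> p + \<theta>) * (\<delta> y z + 2 * \<theta>)"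
    by (rule mult_mono) (use p' d \<sigma>_nonneg[OF X(1)] pos dist(1)[OF X(5,6)] in auto)
  also have "\<dots> \<le> \<sigma> p * \<delta> y z + 2 * \<Lambda> * \<theta> + \<theta> * (r + 2 * \<theta>)"
  proof -
    have "\<sigma> p * \<theta> \<le> \<Lambda> * \<theta>" "\<theta> * \<delta> y z \<le> \<theta> * r"
      using \<sigma>_le[of p] dyz pos by auto
    then show ?thesis by (simp add: algebra_simps)
  qed
  finally have 2: "u y' - u z' \<le> \<sigma> p * \<delta> y z + 2 * \<Lambda> * \<theta> + \<theta> * (r + 2 * \<theta>) + \<theta>"
    using 1 by linarith
  have "\<Lambda> * \<delta> y y' \<le> \<Lambda> * \<theta>" "\<Lambda> * \<delta> z' z \<le> \<Lambda> * \<theta>" using y' z' sym pos by auto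
  then have "U y \<le> u y' + \<Lambda> * \<theta>" "u z' \<le> U z + \<Lambda> * \<theta> + \<theta>"
    using U_lip[OF X(2,5)] U_le_u[OF y'(1)] U_lip[OF X(6,3)] u_le_U[OF z'(1)] by linarith+
  then show ?thesis using 2 by (simp add: err_def algebra_simps)
qed

section \<open>Lower bound for the cost of a chain\<close>

lemma cost_outside: assumes "x \<in> X" "y \<in> X" "x \<notin> A \<or> y \<notin> A"
  shows "cost x y = (\<Lambda> + \<kappa>) * \<delta> x y"
proof -
  have "\<sigma> x = \<Lambda> \<or> \<sigma> y = \<Lambda>" using assms A_if \<sigma>_le by (metis linorder_not_less order_antisym)
  then have "max (\<sigma> x) (\<sigma> y) = \<Lambda>" using \<sigma>_le[of x] \<sigma>_le[of y] by auto
  then show ?thesis by (simp add: cost_def distrib_right)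
qed

lemma cost_le: assumes "x \<in> X" "y \<in> X" shows "cost x y \<le> (\<Lambda> + \<kappa>) * \<delta> x y"
proof -
  have "max (\<sigma> x) (\<sigma> y) * \<delta> x y \<le> \<Lambda> * \<delta> x y"
    by (rule mult_right_mono) (use \<sigma>_le dist assms in auto)
  then show ?thesis by (simp add: cost_def distrib_right)
qed

lemma cost_nonneg: assumes "x \<in> X" "y \<in> X" shows "0 \<le> cost x y"
  using dist(1)[OF assms] \<sigma>_nonneg[OF assms(1)] pos by (auto simp: cost_def)

lemma cost_sym: assumes "x \<in> X" "y \<in> X" shows "cost x y = cost y x"
  using dist(3)[OF assms] by (simp add: cost_def max.commute)

text \<open>Settling the open block at its head costs one error, whatever the number of steps in
  it.\<close>

lemma grouped_imp: assumes "grouped x t" "x \<in> A" shows "U x \<le> t + err"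
proof -
  obtain a p v l where *: "a \<in> A" "p \<in> X" "\<delta> p x \<le> l" "\<delta> p a \<le> l" "\<delta> x a \<le> l"
     "0 \<le> l" "l \<le> r / 2" "U a \<le> v" "v + (\<sigma> p + \<kappa>) * l \<le> t"
    using assms unfolding grouped_def by blast
  have "U x \<le> U a + \<sigma> p * \<delta> x a + err"
    by (rule U_triple) (use * assms in auto)
  moreover have "\<sigma> p * \<delta> x a \<le> \<sigma> p * l" using * \<sigma>_nonneg by (intro mult_left_mono) auto
  moreover have "0 \<le> \<kappa> * l" using * pos by simp
  ultimately show ?thesis using * by (simp add: distrib_right)
qed

text \<open>Consecutive steps are merged into one group as long as the total length stays below \<open>r / 2\<close>;
  closing a group costs an error \<open>2 * err\<close>, which the surcharge \<open>\<kappa> * \<delta>\<close> over a length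
  exceeding \<open>r / 2\<close> pays for.\<close>

lemma grouped_step:
  assumes g: "grouped x t" and x: "x \<in> A" and y: "y \<in> A" and t': "cost y x + t \<le> t'"
  shows "grouped y t'"
proof -
  obtain a p v l where *: "a \<in> A" "p \<in> X" "\<delta> p x \<le> l" "\<delta> p a \<le> l" "\<delta> x a \<le> l"
     "0 \<le> l" "l \<le> r / 2" "U a \<le> v" "v + (\<sigma> p + \<kappa>) * l \<le> t"
    using g unfolding grouped_def by blast
  have X: "a \<in> X" "p \<in> X" "x \<in> X" "y \<in> X" using * AX x y by auto
  define m where "m = \<delta> y x"
  have m0: "0 \<le> m" using dist X by (simp add: m_def)
  have sym: "\<delta> x y = m" "\<delta> x p = \<delta> p x" using dist(3) X by (auto simp: m_def)
  show ?thesis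
  proof (cases "l + m \<le> r / 2")
    case True
    then have c: "cost y x = max (\<sigma> y) (\<sigma> x) * m + \<kappa> * m" using * by (simp add: cost_def m_def)
    have "\<delta> p y \<le> l + m" "\<delta> y a \<le> l + m"
      using dist(4)[OF X(2,3,4)] dist(4)[OF X(4,3,1)] * sym m_def by linarith+
    \<comment> \<open>The centre moves to the new head only if that is lighter. Then its weight
      times the whole length stays below the cost, and all distances from it are at most the new
      length.\<close>
    moreover define p' where "p' = (if \<sigma> p \<le> \<sigma> y then p else y)"
    moreover have "\<delta> y y \<le> l + m" using dist(2)[OF X(4)] m0 * by simp
    ultimately have p': "p' \<in> X" "\<delta> p' y \<le> l + m" "\<delta> p' a \<le> l + m"
      using X * m0 by auto
    have "\<sigma> p' * l \<le> \<sigma> p * l" "\<sigma> p' * m \<le> max (\<sigma> y) (\<sigma> x) * m"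
      using * m0 by (auto simp: p'_def intro!: mult_right_mono)
    then have "v + (\<sigma> p' + \<kappa>) * (l + m) \<le> t'"
      using t' * c by (simp add: distrib_right distrib_left)
    then show ?thesis unfolding grouped_def
      using p' * True m0 \<open>\<delta> y a \<le> l + m\<close> by (intro exI[of _ a] exI[of _ p'] exI[of _ v] exI[of _ "l + m"]) auto
  next
    case False
    \<comment> \<open>The extended block exceeds r/2, and \<open>err_small\<close> bounds four
      errors by \<open>\<kappa> * r\<close>.\<close>
    have err2: "2 * err \<le> \<kappa> * (l + m)"
    proof -
      have "2 * err \<le> \<kappa> * (r / 2)" using err_small by (simp add: err_def)
      also have "\<dots> \<le> \<kappa> * (l + m)" using False pos by (intro mult_left_mono) auto
      finally show ?thesis .
    qed
    have "U x \<le> U a + \<sigma> p * \<delta> x a + err"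
      by (rule U_triple) (use * x in auto)
    moreover have "\<sigma> p * \<delta> x a \<le> \<sigma> p * l" using * \<sigma>_nonneg by (intro mult_left_mono) auto
    \<comment> \<open>The step that overfills the block is charged by itself, with its starting
      point as centre; this is the second of the two errors.\<close>
    moreover have "U y + \<kappa> * m \<le> U x + cost y x + err"
    proof (cases "m \<le> r / 2")
      case True
      have "U y \<le> U x + \<sigma> x * m + err"
        using U_triple[of x y x] x y X True sym dist(2) pos by (auto simp: m_def)
      moreover have "\<sigma> x * m \<le> max (\<sigma> y) (\<sigma> x) * m" using m0 by (intro mult_right_mono) auto
      ultimately show ?thesis using True by (simp add: cost_def m_def)
    next
      case False
      have "0 \<le> err" using pos by (simp add: err_def)
      then show ?thesis using U_lip[OF X(4,3)] False by (simp add: cost_def m_def)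
    qed
    ultimately have "U y \<le> t'" using * t' err2 by (simp add: distrib_right distrib_left)
    \<comment> \<open>A fresh block of length 0 is opened at y; the surcharge has absorbed both
      errors.\<close>
    then show ?thesis unfolding grouped_def
      using y X dist(2)[OF X(4)] pos by (intro exI[of _ y] exI[of _ y] exI[of _ t'] exI[of _ 0]) auto
  qed
qed

text \<open>Errors can be controlled only in A. A step touching the complement of A costs the full
  rate \<Lambda> + \<kappa>, so by the triangle inequality an excursion costs at least as much as
  one direct step from z, the last point of A before it.\<close>

lemma chain_grouped:
  assumes "chain x t"
  shows "\<exists>z\<in>A. \<exists>t2. grouped z t2 \<and> (if x \<in> A then z = x \<and> t2 = t else t2 + (\<Lambda> + \<kappa>) * \<delta> x z \<le> t)"
  using assms
proof induction
  case (start x)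
  have "grouped x (u x)"
    unfolding grouped_def using start KA KX dist(2) U_le_u pos
    by (intro exI[of _ x] exI[of _ x] exI[of _ "u x"] exI[of _ 0]) auto
  then show ?case using KA start by auto
next
  case (step y t x)
  then obtain z t2 where z: "z \<in> A" "grouped z t2"
    "if y \<in> A then z = y \<and> t2 = t else t2 + (\<Lambda> + \<kappa>) * \<delta> y z \<le> t" by blast
  have X: "x \<in> X" "y \<in> X" "z \<in> X" using step z AX by auto
  show ?case
  proof (cases "x \<in> A \<and> y \<in> A")
    case True
    then show ?thesis using z grouped_step[of y t x] by auto
  next
    case False
    then have c: "cost x y = (\<Lambda> + \<kappa>) * \<delta> x y" using cost_outside X by blast
    have "t2 + (\<Lambda> + \<kappa>) * \<delta> y z \<le> t" using z(3) dist(2) X by (auto split: if_splits)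
    moreover have "(\<Lambda> + \<kappa>) * \<delta> x z \<le> (\<Lambda> + \<kappa>) * (\<delta> x y + \<delta> y z)"
      by (rule mult_left_mono[OF dist(4)]) (use X pos in auto)
    ultimately have *: "t2 + (\<Lambda> + \<kappa>) * \<delta> x z \<le> cost x y + t" using c by (simp add: distrib_left)
    show ?thesis
    proof (cases "x \<in> A")
      case True
      \<comment> \<open>On return to A the excursion is replaced by the direct step from z, whose
        cost is at most the full rate.\<close>
      then have "grouped x (cost x y + t)"
        using grouped_step[OF z(2,1) True] cost_le[OF X(1,3)] * by force
      then show ?thesis using True by auto
    next
      case False
      then show ?thesis using z * by auto
    qed
  qed
qed

lemma chain_lower: assumes "chain x t" "x \<in> K" shows "u x \<le> t + err + \<theta>"
  using chain_grouped[OF assms(1)] KA[OF assms(2)] grouped_imp[of x t] u_le_U[OF assms(2)] by auto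

lemma chain_ge: assumes "chain x t" shows "- B \<le> t"
  using assms
proof induction
  case (start x) then show ?case using u_bound[of x] by auto
next
  case (step y t x) then show ?case using cost_nonneg[of x y] by auto
qed

section \<open>Regularity of the infimum over chains\<close>

lemma chain_ex: assumes "x \<in> X" shows "\<exists>t. chain x t"
  using K chain.intros assms by (metis KX ex_in_conv)

lemma bdd_chain: "bdd_below {t. chain x t}"
  using chain_ge by (auto intro!: bdd_belowI[of _ "-B"])

lemma envelope_step: assumes "x \<in> X" "y \<in> X" shows "envelope x \<le> envelope y + cost x y"
proof -
  have "Inf {t. chain x t} - cost x y \<le> Inf {t. chain y t}"
  proof (rule cInf_greatest)
    show "{t. chain y t} \<noteq> {}" using chain_ex[OF assms(2)] by simp
    fix t assume "t \<in> {t. chain y t}"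
    then have "chain x (cost x y + t)" using chain.step assms by simp
    then have "Inf {t. chain x t} \<le> cost x y + t" using bdd_chain by (intro cInf_lower) auto
    then show "Inf {t. chain x t} - cost x y \<le> t" by simp
  qed
  then show ?thesis using cost_nonneg[OF assms] unfolding envelope_def by linarith
qed

lemma envelope_diff: assumes "x \<in> X" "y \<in> X" shows "\<bar>envelope x - envelope y\<bar> \<le> cost x y"
  using envelope_step[OF assms] envelope_step[OF assms(2,1)] cost_sym[OF assms] by linarith

lemma envelope_bound: assumes "x \<in> X" shows "\<bar>envelope x\<bar> \<le> B"
proof -
  have "- B \<le> Inf {t. chain x t}"
    by (rule cInf_greatest) (use chain_ge chain_ex[OF assms] in auto)
  moreover have "0 \<le> B" using K u_bound by (metis abs_ge_zero order_trans ex_in_conv)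
  ultimately show ?thesis unfolding envelope_def by linarith
qed

lemma envelope_le: assumes "x \<in> K" shows "envelope x \<le> u x"
proof -
  have "Inf {t. chain x t} \<le> u x" using bdd_chain chain.start[OF assms] by (intro cInf_lower) auto
  then show ?thesis by (simp add: envelope_def)
qed

lemma envelope_ge: assumes "x \<in> K" shows "u x \<le> envelope x + err + \<theta>"
proof -
  have "u x - err - \<theta> \<le> Inf {t. chain x t}"
    by (rule cInf_greatest) (use chain_lower[OF _ assms] chain_ex KX assms in force)+
  moreover have "0 \<le> err + \<theta>" using pos by (simp add: err_def)
  ultimately show ?thesis using u_bound[OF assms] unfolding envelope_def by linarith
qed

lemma envelope_local:
  assumes "x \<in> K" "0 < e"
  shows "\<exists>\<rho>>0. \<forall>y\<in>X. \<forall>z\<in>X. \<delta> y x < \<rho> \<longrightarrow> \<delta> z x < \<rho> \<longrightarrow>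
    \<bar>envelope y - envelope z\<bar> \<le> (s x + \<kappa> + e) * \<delta> y z"
proof -
  \<comment> \<open>With r/4 all pairs in the ball are short steps; with e\<theta>/\<Lambda> the
    weight, which is Lipschitz with constant \<Lambda>/\<theta>, grows by at most e.\<close>
  define \<rho> where "\<rho> = min (r / 4) (e * \<theta> / \<Lambda>)"
  have "0 < \<rho>" using pos assms by (simp add: \<rho>_def)
  moreover have "\<bar>envelope y - envelope z\<bar> \<le> (s x + \<kappa> + e) * \<delta> y z"
    if yz: "y \<in> X" "z \<in> X" "\<delta> y x < \<rho>" "\<delta> z x < \<rho>" for y z
  proof -
    have x: "x \<in> X" using KX assms by simp
    have near: "\<sigma> w \<le> s x + e" if "w \<in> X" "\<delta> w x < \<rho>" for w
    proof -
      have "\<Lambda> / \<theta> * \<delta> w x \<le> \<Lambda> / \<theta> * (e * \<theta> / \<Lambda>)"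
        by (rule mult_left_mono) (use that pos in \<open>auto simp: \<rho>_def\<close>)
      then show ?thesis using \<sigma>_lip[OF that(1) x] \<sigma>_le_s[OF assms(1)] pos by simp
    qed
    have "\<delta> y z \<le> r / 2"
      using dist(4)[OF yz(1) x yz(2)] dist(3)[OF yz(2) x] yz by (simp add: \<rho>_def)
    then have "cost y z = max (\<sigma> y) (\<sigma> z) * \<delta> y z + \<kappa> * \<delta> y z" by (simp add: cost_def)
    also have "\<dots> \<le> (s x + e) * \<delta> y z + \<kappa> * \<delta> y z"
      using near yz dist(1) by (intro add_right_mono mult_right_mono) auto
    finally show ?thesis using envelope_diff[OF yz(1,2)] by (simp add: algebra_simps)
  qed
  ultimately show ?thesis by blast
qed

lemma envelope_lip: assumes "x \<in> X" "y \<in> X" shows "\<bar>envelope x - envelope y\<bar> \<le> (\<Lambda> + \<kappa>) * \<delta> x y"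
  using envelope_diff[OF assms] cost_le[OF assms] by linarith

end

section \<open>Recovery sequences\<close>

lemma directed_upper_bound:
  assumes "directed_set I le" "finite F" "F \<subseteq> I"
  shows "\<exists>k\<in>I. \<forall>i\<in>F. le i k"
  using assms(2,3)
proof induction
  case empty
  have "I \<noteq> {}" using assms(1) unfolding directed_set_def by (rule conjunct1)
  then show ?case by blast
next
  case (insert a F)
  then obtain k where k: "k \<in> I" "\<forall>i\<in>F. le i k" by auto
  obtain l where l: "l \<in> I" "le a l" "le k l"
    using assms(1) insert.prems k(1) unfolding directed_set_def by (meson insert_subset)
  have "le i l" if "i \<in> F" for i
    using assms(1) k l that insert.prems unfolding directed_set_def by (meson insert_subset subsetD)
  then show ?case using l by auto
qed

text \<open>A Dini-type principle: the closed sets are where a bound fails for the index i, and they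
  shrink as i grows. If no point fails for all indices, one index works everywhere.\<close>

lemma compact_space_directed_empty:
  assumes "compact_space W" "directed_set I le"
    and closed: "\<And>i. i \<in> I \<Longrightarrow> closedin W (D i)"
    and anti: "\<And>i j. \<lbrakk>i \<in> I; j \<in> I; le i j\<rbrakk> \<Longrightarrow> D j \<subseteq> D i"
    and empty: "(\<Inter>i\<in>I. D i) = {}"
  shows "\<exists>i\<in>I. D i = {}"
proof (rule ccontr)
  assume ne: "\<not> (\<exists>i\<in>I. D i = {})"
  have "\<Inter>(D ` I) \<noteq> {}"
  proof (rule assms(1)[unfolded compact_space_fip, rule_format, of "D ` I"])
    have "\<Inter>\<F> \<noteq> {}" if F: "finite \<F>" "\<F> \<subseteq> D ` I" for \<F>
    proof -
      obtain F where "finite F" "F \<subseteq> I" "\<F> = D ` F" using F by (meson finite_subset_image)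
      then obtain k where "k \<in> I" "\<forall>i\<in>F. le i k" using directed_upper_bound[OF assms(2)] by blast
      then have "D k \<subseteq> \<Inter>\<F>" using anti \<open>F \<subseteq> I\<close> \<open>\<F> = D ` F\<close> by blast
      then show ?thesis using ne \<open>k \<in> I\<close> by blast
    qed
    then show "(\<forall>C\<in>D ` I. closedin W C) \<and> (\<forall>\<F>. finite \<F> \<and> \<F> \<subseteq> D ` I \<longrightarrow> \<Inter> \<F> \<noteq> {})"
      using closed by blast
  qed
  then show False using empty by simp
qed

lemma closedin_Collect_le_real:
  assumes "continuous_map W euclideanreal a" "continuous_map W euclideanreal b"
  shows "closedin W {p \<in> topspace W. a p \<le> (b p :: real)}"
proof -
  have "closedin W {p \<in> topspace W. b p - a p \<in> {0..}}"
    by (rule closedin_continuous_map_preimage[of W euclideanreal])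
       (use assms in \<open>auto intro!: continuous_intros\<close>)
  then show ?thesis by simp
qed

lemma closedin_Collect_conj:
  "closedin W {p \<in> topspace W. P p} \<Longrightarrow> closedin W {p \<in> topspace W. Q p} \<Longrightarrow>
    closedin W {p \<in> topspace W. P p \<and> Q p}"
  using closedin_Int[of W "{p \<in> topspace W. P p}" "{p \<in> topspace W. Q p}"]
  by (simp add: Int_def conj_ac)

lemma closedin_Collect_Ball:
  assumes "I \<noteq> {}" "\<And>i. i \<in> I \<Longrightarrow> closedin W {p \<in> topspace W. P i p}"
  shows "closedin W {p \<in> topspace W. \<forall>i\<in>I. P i p}"
proof -
  have "{p \<in> topspace W. \<forall>i\<in>I. P i p} = (\<Inter>i\<in>I. {p \<in> topspace W. P i p})" using assms(1) by auto
  then show ?thesis using assms by (auto intro!: closedin_INT)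
qed

lemma radon_inner_compact:
  assumes "radon_prob T m" "B \<in> sets m" "0 < \<eta>"
  shows "\<exists>K. compactin T K \<and> K \<subseteq> B \<and> K \<in> sets m \<and> measure m (B - K) < \<eta>"
proof -
  interpret prob_space m using assms by (simp add: radon_prob_def)
  have sup: "emeasure m B = (SUP K\<in>{K. compactin T K \<and> K \<subseteq> B}. emeasure m K)"
    using assms by (simp add: radon_prob_def)
  obtain K where K: "compactin T K" "K \<subseteq> B" "measure m B < measure m K + \<eta>"
  proof (cases "measure m B < \<eta>")
    case True
    then show ?thesis using that[of "{}"] by simp
  next
    case False
    then have "ennreal (measure m B - \<eta>) < ennreal (measure m B)"
      using assms(3) by (intro ennreal_lessI) auto
    then have "ennreal (measure m B - \<eta>) < (SUP K\<in>{K. compactin T K \<and> K \<subseteq> B}. emeasure m K)"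
      using sup by (simp add: emeasure_eq_measure)
    then obtain K where K: "compactin T K" "K \<subseteq> B" "ennreal (measure m B - \<eta>) < emeasure m K"
      by (auto simp: less_SUP_iff)
    then have "measure m B - \<eta> < measure m K"
      using False assms(3) by (simp add: emeasure_eq_measure ennreal_less_iff)
    then show ?thesis using that[of K] K by simp
  qed
  \<comment> \<open>The supremum ranges over all compact sets. A set outside \<open>sets m\<close>
    has measure 0 by default, so then B itself has measure below \<eta> and the empty set will
    do.\<close>
  show ?thesis
  proof (cases "K \<in> sets m")
    case True
    then show ?thesis using K assms(2) finite_measure_Diff[of B K] by auto
  next
    case False
    then have "measure m K = 0" by (simp add: measure_notin_sets)
    then show ?thesis using K(3) by (intro exI[of _ "{}"]) auto
  qed
qed

lemma l2norm_indicator: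
  assumes "A \<in> sets m"
  shows "l2norm m (\<lambda>x. c * indicator A x) = \<bar>c\<bar> * sqrt (measure m A)"
proof -
  have "l2norm m (indicator A) = sqrt (measure m A)"
    using assms sets.sets_into_space[OF assms]
    by (simp add: l2norm_def power2_eq_square flip: indicator_inter_arith)
  then show ?thesis by (simp add: l2norm_scale)
qed

lemma L2_indicator: "finite_measure m \<Longrightarrow> A \<in> sets m \<Longrightarrow> (\<lambda>x. c * indicator A x) \<in> L2 m"
  by (rule L2_bounded[of m _ "\<bar>c\<bar>"]) (auto simp: indicator_def)

lemma compact_triples:
  assumes K: "compactin T K"
  defines "W \<equiv> prod_topology (subtopology T K) (prod_topology (subtopology T K) (subtopology T K))"
  shows "topspace W = K \<times> K \<times> K" "compact_space W" "continuous_map W (subtopology T K) fst"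
    "continuous_map W T fst" "continuous_map W T (\<lambda>p. fst (snd p))" "continuous_map W T (\<lambda>p. snd (snd p))"
proof -
  let ?TK = "subtopology T K"
  show "topspace W = K \<times> K \<times> K"
    using compactin_subset_topspace[OF K] by (simp add: W_def Int_absorb1)
  show "compact_space W" using K by (simp add: W_def compact_space_prod_topology compact_space_subtopology)
  show 1: "continuous_map W ?TK fst" unfolding W_def by (rule continuous_map_fst)
  have 2: "continuous_map W ?TK (\<lambda>p. fst (snd p))" "continuous_map W ?TK (\<lambda>p. snd (snd p))"
    using continuous_map_compose[OF continuous_map_snd continuous_map_fst, of ?TK ?TK ?TK]
      continuous_map_compose[OF continuous_map_snd continuous_map_snd, of ?TK ?TK ?TK]
    by (simp_all add: W_def o_def)
  show "continuous_map W T fst" "continuous_map W T (\<lambda>p. fst (snd p))" "continuous_map W T (\<lambda>p. snd (snd p))"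
    using 1 2 by (simp_all add: continuous_map_in_subtopology)
qed

locale monotone_approximation =
  fixes T :: "'a topology" and d :: "'a \<Rightarrow> 'a \<Rightarrow> ennreal" and m :: "'a measure"
    and I :: "'i set" and le :: "'i \<Rightarrow> 'i \<Rightarrow> bool" and di :: "'i \<Rightarrow> 'a \<Rightarrow> 'a \<Rightarrow> real"
  assumes Hausdorff: "Hausdorff_space T"
    and radon: "radon_prob T m"
    and directed: "directed_set I le"
    and di_semi: "\<And>i. i \<in> I \<Longrightarrow> bounded_continuous_semidistance T (di i)"
    and di_mono: "\<And>i j x y. \<lbrakk>i \<in> I; j \<in> I; le i j; x \<in> topspace T; y \<in> topspace T\<rbrakk> \<Longrightarrow> di i x y \<le> di j x y"
    and d_eq: "\<And>x y. \<lbrakk>x \<in> topspace T; y \<in> topspace T\<rbrakk> \<Longrightarrow> d x y = (SUP i\<in>I. ennreal (di i x y))"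
begin

lemma prob: "prob_space m" and sets_m: "sets m = sets (borel_of T)"
  using radon by (auto simp: radon_prob_def)

lemma space_m: "space m = topspace T" using space_borel_of[OF sets_m] .

sublocale prob_space m by (rule prob)

lemma semi: "i \<in> I \<Longrightarrow> semidistance_on (topspace T) (di i)"
  using di_semi by (simp add: bounded_continuous_semidistance_def)

lemma di_dist:
  assumes "i \<in> I" "x \<in> topspace T"
  shows "di i x x = 0" "y \<in> topspace T \<Longrightarrow> 0 \<le> di i x y" "y \<in> topspace T \<Longrightarrow> di i x y = di i y x"
    "y \<in> topspace T \<Longrightarrow> z \<in> topspace T \<Longrightarrow> di i x z \<le> di i x y + di i y z"
  using semi[OF assms(1)] assms(2) by (auto simp: semidistance_on_def)

lemma di_le_d: "i \<in> I \<Longrightarrow> x \<in> topspace T \<Longrightarrow> y \<in> topspace T \<Longrightarrow> ennreal (di i x y) \<le> d x y"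
  by (auto simp: d_eq intro: SUP_upper)

lemma continuous_di:
  assumes "i \<in> I" "continuous_map W T g" "continuous_map W T h"
  shows "continuous_map W euclideanreal (\<lambda>p. di i (g p) (h p))"
proof -
  have "continuous_map (prod_topology T T) euclideanreal (\<lambda>(x, y). di i x y)"
    using di_semi[OF assms(1)] by (simp add: bounded_continuous_semidistance_def)
  then have "continuous_map W euclideanreal ((\<lambda>(x, y). di i x y) \<circ> (\<lambda>p. (g p, h p)))"
    by (rule continuous_map_compose[rotated]) (use assms in \<open>simp add: continuous_map_pairedI\<close>)
  then show ?thesis by (simp add: o_def)
qed

text \<open>Lusin and Egorov by hand. Rounding h up gives a bound with finitely many values,
  continuous on a finite union of compact pieces of its level sets. The points where the bound fails
  at scale 1/(n+1) form decreasing Borel sets with empty intersection, so removing one of them costs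
  little measure.\<close>

lemma compact_core:
  assumes f: "f \<in> lip_b T d" and h: "h \<in> borel_measurable m"
    and lip: "AE x in m. lip_a (topspace T) d f x \<le> h x" "AE x in m. 0 \<le> h x" "AE x in m. h x \<le> L"
    and pos: "0 < \<epsilon>" "0 < \<eta>"
  obtains s K r where "compactin T K" "K \<in> sets m" "measure m (space m - K) < \<eta>" "0 < r"
    "continuous_map (subtopology T K) euclideanreal s"
    "\<forall>x\<in>K. 0 \<le> s x \<and> s x \<le> h x + \<epsilon> \<and> s x \<le> L + \<epsilon>"
    "\<forall>x\<in>K. \<forall>y\<in>K. \<forall>z\<in>K. (\<forall>i\<in>I. di i x y \<le> r) \<longrightarrow> (\<forall>i\<in>I. di i x z \<le> r) \<longrightarrow>
       (\<forall>e>0. \<exists>i\<in>I. \<bar>f y - f z\<bar> < s x * di i y z + e)"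
proof -
  have "AE x in m. lip_a (topspace T) d f x \<le> h x \<and> 0 \<le> h x \<and> h x \<le> L"
    using lip by eventually_elim simp
  then obtain N where N: "N \<in> null_sets m" "{x \<in> space m. \<not> (lip_a (topspace T) d f x \<le> h x \<and> 0 \<le> h x \<and> h x \<le> L)} \<subseteq> N"
    unfolding eventually_ae_filter by blast
  define E where "E = space m - N"
  have Em [measurable]: "E \<in> sets m" using N by (auto simp: E_def)
  have E: "lip_a (topspace T) d f x \<le> h x" "0 \<le> h x" "h x \<le> L" "x \<in> topspace T" if "x \<in> E" for x
    using that N(2) by (auto simp: E_def space_m)
  \<comment> \<open>The next multiple of \<epsilon> strictly above h: strictness produces a radius
    at which the slope bound holds, and on E only finitely many values occur.\<close>
  define s where "s x = \<epsilon> * (real_of_int \<lfloor>h x / \<epsilon>\<rfloor> + 1)" for x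
  note [measurable] = h
  have [measurable]: "s \<in> borel_measurable m" unfolding s_def by measurable
  have s1: "h x < s x" for x
  proof -
    have "h x / \<epsilon> < real_of_int \<lfloor>h x / \<epsilon>\<rfloor> + 1" by linarith
    then show ?thesis using pos by (simp add: s_def field_simps)
  qed
  have s2: "s x \<le> h x + \<epsilon>" for x
  proof -
    have "real_of_int \<lfloor>h x / \<epsilon>\<rfloor> + 1 \<le> h x / \<epsilon> + 1" by linarith
    then show ?thesis using pos by (simp add: s_def field_simps)
  qed
  have "s ` E \<subseteq> (\<lambda>k. \<epsilon> * (real_of_int k + 1)) ` {0..\<lfloor>L / \<epsilon>\<rfloor>}"
  proof (rule image_subsetI)
    fix x assume "x \<in> E"
    then have "0 \<le> h x / \<epsilon>" "h x / \<epsilon> \<le> L / \<epsilon>" using E pos by (auto simp: divide_right_mono)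
    then have "\<lfloor>h x / \<epsilon>\<rfloor> \<in> {0..\<lfloor>L / \<epsilon>\<rfloor>}" by (simp add: floor_mono)
    then show "s x \<in> (\<lambda>k. \<epsilon> * (real_of_int k + 1)) ` {0..\<lfloor>L / \<epsilon>\<rfloor>}" unfolding s_def by blast
  qed
  then have fin: "finite (s ` E)" by (rule finite_subset) simp
  define V where "V = s ` E"
  have finV: "finite V" using fin by (simp add: V_def)
  \<comment> \<open>A third of \<eta> is spent on the level sets together, a third on the bad set,
    and a third on the final compact subset.\<close>
  define \<eta>' where "\<eta>' = \<eta> / (3 * (card V + 1))"
  have \<eta>': "0 < \<eta>'" using pos by (simp add: \<eta>'_def)
  have "\<exists>C. compactin T C \<and> C \<subseteq> {x \<in> E. s x = v} \<and> C \<in> sets m \<and> measure m ({x \<in> E. s x = v} - C) < \<eta>'" for v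
  proof (rule radon_inner_compact[OF radon _ \<eta>'])
    have "{x \<in> E. s x = v} = E \<inter> {x \<in> space m. s x = v}" by (auto simp: E_def)
    then show "{x \<in> E. s x = v} \<in> sets m" by simp
  qed
  then have "\<exists>C. \<forall>v. compactin T (C v) \<and> C v \<subseteq> {x \<in> E. s x = v} \<and> C v \<in> sets m \<and>
      measure m ({x \<in> E. s x = v} - C v) < \<eta>'" by (intro choice allI)
  then obtain C where "\<forall>v. compactin T (C v) \<and> C v \<subseteq> {x \<in> E. s x = v} \<and> C v \<in> sets m \<and>
      measure m ({x \<in> E. s x = v} - C v) < \<eta>'" by (rule exE)
  then have C: "\<And>v. compactin T (C v)" "\<And>v. C v \<subseteq> {x \<in> E. s x = v}" "\<And>v. C v \<in> sets m"
    "\<And>v. measure m ({x \<in> E. s x = v} - C v) < \<eta>'" by simp_all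
  define K0 where "K0 = (\<Union>v\<in>V. C v)"
  have K0E: "K0 \<subseteq> E" using C(2) by (auto simp: K0_def)
  then have K0X: "K0 \<subseteq> topspace T" using E by auto
  have K0m [measurable]: "K0 \<in> sets m" unfolding K0_def
    using C(3) finV by (intro sets.finite_UN) auto
  have K0c: "compactin T K0" unfolding K0_def using C(1) finV by (auto intro!: compactin_Union)
  have "space m - K0 \<subseteq> N \<union> (\<Union>v\<in>V. {x \<in> E. s x = v} - C v)"
    by (auto simp: K0_def V_def E_def)
  moreover have lev: "{x \<in> E. s x = v} - C v \<in> sets m" for v
  proof -
    have "{x \<in> E. s x = v} - C v = E \<inter> {x \<in> space m. s x = v} - C v" by (auto simp: E_def)
    then show ?thesis using C(3)[of v] by simp
  qed
  ultimately have "measure m (space m - K0) \<le> measure m (N \<union> (\<Union>v\<in>V. {x \<in> E. s x = v} - C v))"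
    using N finV by (intro finite_measure_mono) (auto simp: null_sets_def)
  also have "\<dots> \<le> measure m N + measure m (\<Union>v\<in>V. {x \<in> E. s x = v} - C v)"
    by (intro measure_Un_le sets.finite_UN finV lev null_setsD2[OF N(1)])
  also have "\<dots> \<le> 0 + (\<Sum>v\<in>V. measure m ({x \<in> E. s x = v} - C v))"
  proof (rule add_mono)
    show "measure m N \<le> 0" using N by (simp add: null_sets_def measure_def)
    show "measure m (\<Union>v\<in>V. {x \<in> E. s x = v} - C v) \<le> (\<Sum>v\<in>V. measure m ({x \<in> E. s x = v} - C v))"
      using lev finV by (intro finite_measure_subadditive_finite) auto
  qed
  also have "\<dots> \<le> card V * \<eta>'" using C(4) sum_bounded_above[of V "\<lambda>v. measure m ({x \<in> E. s x = v} - C v)" \<eta>'] by (simp add: less_imp_le)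
  also have "\<dots> < \<eta> / 3" using pos by (simp add: \<eta>'_def field_simps)
  finally have mK0: "measure m (space m - K0) < \<eta> / 3" .
  define TK where "TK = subtopology T K0"
  have topK: "topspace TK = K0" using K0X by (simp add: TK_def Int_absorb1)
  have closedC: "closedin T (C v)" for v using C(1) compactin_imp_closedin[OF Hausdorff] by blast
  \<comment> \<open>On the piece \<open>C v\<close> the function equals v, so the preimage of any
    set is a finite union of closed pieces.\<close>
  have conts: "continuous_map TK euclideanreal s"
    unfolding continuous_map_closedin
  proof (intro conjI allI impI)
    fix A :: "real set"
    have "s x = v" if "x \<in> C v" for x v using C(2) that by blast
    then have "{x \<in> topspace TK. s x \<in> A} = K0 \<inter> (\<Union>v\<in>V \<inter> A. C v)"
      by (auto simp: topK K0_def)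
    moreover have "closedin T (\<Union>v\<in>V \<inter> A. C v)" using closedC finV by (intro closedin_Union) auto
    ultimately show "closedin TK {x \<in> topspace TK. s x \<in> A}"
      unfolding TK_def by (simp add: closedin_subtopology_Int_closed)
  qed auto
  define W where "W = prod_topology TK (prod_topology TK TK)"
  note W = compact_triples[OF K0c, folded TK_def, folded W_def]
  note topW = W(1) and compW = W(2) and p1 = W(3) and pT = W(4-6)
  note fc = pT(2,3)[THEN continuous_map_compose[OF _ lip_bD(2)[OF f]], unfolded o_def]
  note sc = continuous_map_compose[OF p1 conts, unfolded o_def]
  \<comment> \<open>Failure at scale 1/(n+1) by a margin 1/(q+1) for all indices at once. The margin
    makes all conditions closed, so the projection to the first coordinate is compact and therefore
    Borel.\<close>
  define D where "D n q = {p \<in> topspace W. (\<forall>i\<in>I. di i (fst p) (fst (snd p)) \<le> 1 / Suc n) \<and>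
     (\<forall>i\<in>I. di i (fst p) (snd (snd p)) \<le> 1 / Suc n) \<and>
     (\<forall>i\<in>I. s (fst p) * di i (fst (snd p)) (snd (snd p)) + 1 / Suc q \<le> \<bar>f (fst (snd p)) - f (snd (snd p))\<bar>)}" for n q :: nat
  have Ine: "I \<noteq> {}" using directed by (simp add: directed_set_def)
  have closedD: "closedin W (D n q)" for n q
    unfolding D_def
    by (intro closedin_Collect_conj closedin_Collect_Ball closedin_Collect_le_real Ine continuous_di pT continuous_intros sc
        continuous_map_real_abs continuous_map_diff fc) auto
  define Bad where "Bad n = (\<Union>q. fst ` D n q)" for n
  have "fst ` D n q \<in> sets m" for n q
  proof -
    have "compactin W (D n q)" using closedD compW by (simp add: closedin_compact_space)
    then have "compactin TK (fst ` D n q)" using image_compactin p1 by blast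
    then have "compactin T (fst ` D n q)" by (simp add: TK_def compactin_subtopology)
    then show ?thesis using compactin_imp_closedin[OF Hausdorff] closedin_borel_of sets_m by blast
  qed
  then have Badm [measurable]: "Bad n \<in> sets m" for n by (auto simp: Bad_def)
  have "decseq Bad"
  proof (rule decseq_SucI)
    fix n
    have "1 / real (Suc (Suc n)) \<le> 1 / real (Suc n)" by (simp add: frac_le)
    then have "D (Suc n) q \<subseteq> D n q" for q unfolding D_def by (auto intro: order_trans)
    then show "Bad (Suc n) \<le> Bad n" unfolding Bad_def by blast
  qed
  \<comment> \<open>Each point of \<open>K0\<close> has a radius at which the bound
    \<open>s x\<close> holds; once 1/(n+1) is smaller the point is no longer bad.\<close>
  moreover have "(\<Inter>n. Bad n) = {}"
  proof (rule ccontr)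
    assume "(\<Inter>n. Bad n) \<noteq> {}"
    then obtain x where x: "\<And>n. x \<in> Bad n" by blast
    have xE: "x \<in> E" using x[of 0] K0E by (auto simp: Bad_def D_def topW)
    have sx: "0 < s x" using s1[of x] E(2)[OF xE] by simp
    have "lip_a (topspace T) d f x < s x" using E(1)[OF xE] s1[of x] by simp
    then obtain \<rho> where \<rho>: "0 < \<rho>" "local_lip (topspace T) d f x (s x) \<rho>"
      using lip_a_less[OF lip_bD(1)[OF f]] by blast
    obtain n where n: "1 / real (Suc n) < \<rho>" using \<rho>(1) nat_approx_posE by metis
    obtain q y z where D: "(x, y, z) \<in> D n q" using x[of n] by (auto simp: Bad_def)
    then have yz: "y \<in> topspace T" "z \<in> topspace T" using K0X by (auto simp: D_def topW)
    have xT: "x \<in> topspace T" using E xE by blast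
    have "d w x < ennreal \<rho>" if w: "w \<in> topspace T" "\<forall>i\<in>I. di i x w \<le> 1 / Suc n" for w
    proof -
      have "d w x \<le> ennreal (1 / Suc n)"
        unfolding d_eq[OF w(1) xT] using w di_dist(3)[OF _ xT w(1)]
        by (intro SUP_least ennreal_leI) auto
      also have "\<dots> < ennreal \<rho>" using n \<rho> by (intro ennreal_lessI) auto
      finally show ?thesis .
    qed
    then have *: "ennreal \<bar>f y - f z\<bar> \<le> ennreal (s x) * d y z"
      using \<rho>(2) D yz unfolding local_lip_def D_def by auto
    \<comment> \<open>The margin does not depend on i and thus survives the supremum that gives
      \<open>d\<close>.\<close>
    define t where "t = \<bar>f y - f z\<bar> - 1 / Suc q"
    have st: "s x * di i y z \<le> t" if "i \<in> I" for i using D that by (auto simp: D_def t_def)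
    obtain i0 where "i0 \<in> I" using Ine by blast
    then have t0: "0 \<le> t" using st[of i0] di_dist(2)[of i0 y z] yz sx by (meson mult_nonneg_nonneg less_imp_le order_trans)
    have "d y z \<le> ennreal (t / s x)"
      unfolding d_eq[OF yz] using st sx by (intro SUP_least ennreal_leI) (simp add: field_simps)
    then have "ennreal (s x) * d y z \<le> ennreal (s x) * ennreal (t / s x)" by (rule mult_left_mono) simp
    also have "\<dots> = ennreal t" using sx t0 by (simp flip: ennreal_mult)
    finally have "ennreal \<bar>f y - f z\<bar> \<le> ennreal t" by (rule order_trans[OF *])
    then have "\<bar>f y - f z\<bar> \<le> t" using t0 by simp
    then show False by (simp add: t_def)
  qed
  ultimately have "(\<lambda>n. measure m (Bad n)) \<longlonglongrightarrow> 0"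
    using finite_Lim_measure_decseq[of Bad] Badm by (simp add: image_subset_iff)
  then have "\<forall>\<^sub>F n in sequentially. measure m (Bad n) < \<eta> / 3" using pos by (intro order_tendstoD(2)) auto
  then obtain n where n: "measure m (Bad n) < \<eta> / 3" by (meson eventually_sequentially order_refl)
  obtain K where K: "compactin T K" "K \<subseteq> K0 - Bad n" "K \<in> sets m" "measure m ((K0 - Bad n) - K) < \<eta> / 3"
    using radon_inner_compact[OF radon, of "K0 - Bad n" "\<eta> / 3"] pos by auto
  show thesis
  proof (rule that[of K "1 / real (Suc n)" s])
    have "space m - K \<subseteq> (space m - K0) \<union> Bad n \<union> ((K0 - Bad n) - K)" by auto
    then have "measure m (space m - K) \<le> measure m ((space m - K0) \<union> Bad n \<union> ((K0 - Bad n) - K))"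
      using K by (intro finite_measure_mono) auto
    also have "\<dots> \<le> measure m (space m - K0) + measure m (Bad n) + measure m ((K0 - Bad n) - K)"
      using K by (intro order_trans[OF measure_Un_le] add_right_mono measure_Un_le) auto
    finally show "measure m (space m - K) < \<eta>" using mK0 n K(4) by linarith
    show "continuous_map (subtopology T K) euclideanreal s"
      using conts K(2) unfolding TK_def by (meson Diff_subset continuous_map_from_subtopology_mono order_trans)
    show "\<forall>x\<in>K. 0 \<le> s x \<and> s x \<le> h x + \<epsilon> \<and> s x \<le> L + \<epsilon>"
    proof
      fix x assume "x \<in> K"
      then have "x \<in> E" using K K0E by blast
      then show "0 \<le> s x \<and> s x \<le> h x + \<epsilon> \<and> s x \<le> L + \<epsilon>" using s1[of x] s2[of x] E(2,3)[of x] by linarith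
    qed
    show "\<forall>x\<in>K. \<forall>y\<in>K. \<forall>z\<in>K. (\<forall>i\<in>I. di i x y \<le> 1 / real (Suc n)) \<longrightarrow> (\<forall>i\<in>I. di i x z \<le> 1 / real (Suc n)) \<longrightarrow>
       (\<forall>e>0. \<exists>i\<in>I. \<bar>f y - f z\<bar> < s x * di i y z + e)"
    proof (intro ballI impI allI, rule ccontr)
      fix x y z and e :: real
      assume xyz: "x \<in> K" "y \<in> K" "z \<in> K" and d: "\<forall>i\<in>I. di i x y \<le> 1 / real (Suc n)" "\<forall>i\<in>I. di i x z \<le> 1 / real (Suc n)"
        and e: "0 < e" and no: "\<not> (\<exists>i\<in>I. \<bar>f y - f z\<bar> < s x * di i y z + e)"
      obtain q where q: "1 / real (Suc q) < e" using e nat_approx_posE by metis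
      have "(x, y, z) \<in> D n q" using xyz K(2) d no q by (force simp: D_def topW)
      then have "x \<in> Bad n" by (force simp: Bad_def)
      then show False using xyz K by blast
    qed
  qed (use K in auto)
qed

end

section \<open>From the compact set to a single semidistance, and the approximation
  statement\<close>

context monotone_approximation
begin

text \<open>For a larger index both the closeness of the points and the failure of the bound are
  harder to satisfy, so the sets of failing triples decrease. No triple fails for every index, by
  \<open>triple\<close> for the local bound and by the \<open>d\<close>-Lipschitz property for the
  global one.\<close>

lemma compact_index:
  assumes K: "compactin T K" and r: "0 < r" and \<theta>: "0 < \<theta>"
    and s: "continuous_map (subtopology T K) euclideanreal s" "\<forall>x\<in>K. 0 \<le> s x"
    and f: "continuous_map T euclideanreal f"
    and L: "\<forall>x\<in>topspace T. \<forall>y\<in>topspace T. ennreal \<bar>f x - f y\<bar> \<le> ennreal \<Lambda> * d x y" "0 < \<Lambda>"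
    and triple: "\<forall>x\<in>K. \<forall>y\<in>K. \<forall>z\<in>K. (\<forall>i\<in>I. di i x y \<le> r) \<longrightarrow> (\<forall>i\<in>I. di i x z \<le> r) \<longrightarrow>
       (\<forall>e>0. \<exists>i\<in>I. \<bar>f y - f z\<bar> < s x * di i y z + e)"
  obtains i where "i \<in> I"
    "\<And>x y z. \<lbrakk>x \<in> K; y \<in> K; z \<in> K; di i x y \<le> r; di i x z \<le> r\<rbrakk> \<Longrightarrow> \<bar>f y - f z\<bar> \<le> s x * di i y z + \<theta>"
    "\<And>y z. \<lbrakk>y \<in> K; z \<in> K\<rbrakk> \<Longrightarrow> \<bar>f y - f z\<bar> \<le> \<Lambda> * di i y z + \<theta>"
proof -
  have KT: "K \<subseteq> topspace T" using K compactin_subset_topspace by blast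
  have Ine: "I \<noteq> {}" using directed by (simp add: directed_set_def)
  define W where "W = prod_topology (subtopology T K) (prod_topology (subtopology T K) (subtopology T K))"
  note W = compact_triples[OF K, folded W_def]
  note topW = W(1) and compW = W(2) and pT = W(4-6)
  note fc = pT(2,3)[THEN continuous_map_compose[OF _ f], unfolded o_def]
  note sc = continuous_map_compose[OF W(3) s(1), unfolded o_def]
  define D where "D i = {p \<in> topspace W. di i (fst p) (fst (snd p)) \<le> r \<and> di i (fst p) (snd (snd p)) \<le> r \<and>
     s (fst p) * di i (fst (snd p)) (snd (snd p)) + \<theta> \<le> \<bar>f (fst (snd p)) - f (snd (snd p))\<bar>}" for i
  have "\<exists>i\<in>I. D i = {}"
  proof (rule compact_space_directed_empty[OF compW directed])
    fix i assume "i \<in> I"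
    then show "closedin W (D i)"
      unfolding D_def
      by (intro closedin_Collect_conj closedin_Collect_le_real continuous_di pT continuous_intros sc
        continuous_map_real_abs continuous_map_diff fc) auto
  next
    fix i j assume ij: "i \<in> I" "j \<in> I" "le i j"
    show "D j \<subseteq> D i"
    proof
      fix p assume "p \<in> D j"
      then obtain x y z where p: "p = (x, y, z)" "x \<in> K" "y \<in> K" "z \<in> K" "di j x y \<le> r" "di j x z \<le> r"
        "s x * di j y z + \<theta> \<le> \<bar>f y - f z\<bar>" by (cases p) (auto simp: D_def topW)
      then have m: "di i x y \<le> di j x y" "di i x z \<le> di j x z" "di i y z \<le> di j y z"
        using di_mono[OF ij] KT by blast+
      have "s x * di i y z \<le> s x * di j y z" using m(3) s(2) p by (intro mult_left_mono) auto
      then show "p \<in> D i" using p m by (auto simp: D_def topW)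
    qed
  next
    show "(\<Inter>i\<in>I. D i) = {}"
    proof (rule ccontr)
      assume "(\<Inter>i\<in>I. D i) \<noteq> {}"
      then obtain x y z where *: "\<And>i. i \<in> I \<Longrightarrow> (x, y, z) \<in> D i" by fast
      then have "x \<in> K" "y \<in> K" "z \<in> K" using Ine by (auto simp: D_def topW)
      then obtain i where "i \<in> I" "\<bar>f y - f z\<bar> < s x * di i y z + \<theta>"
        using triple * \<theta> unfolding D_def by force
      then show False using *[of i] by (simp add: D_def)
    qed
  qed
  then obtain i1 where i1: "i1 \<in> I" "D i1 = {}" by blast
  \<comment> \<open>The first coordinate is idle, so that the same compact product can be used;
    hence the triple (y, y, z) below.\<close>
  define D2 where "D2 i = {p \<in> topspace W. \<Lambda> * di i (fst (snd p)) (snd (snd p)) + \<theta> \<le>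
      \<bar>f (fst (snd p)) - f (snd (snd p))\<bar>}" for i
  have "\<exists>i\<in>I. D2 i = {}"
  proof (rule compact_space_directed_empty[OF compW directed])
    fix i assume "i \<in> I"
    then show "closedin W (D2 i)"
      unfolding D2_def
      by (intro closedin_Collect_le_real continuous_di pT continuous_intros
        continuous_map_real_abs continuous_map_diff fc) auto
  next
    fix i j assume ij: "i \<in> I" "j \<in> I" "le i j"
    show "D2 j \<subseteq> D2 i"
    proof
      fix p assume "p \<in> D2 j"
      then obtain x y z where p: "p = (x, y, z)" "x \<in> K" "y \<in> K" "z \<in> K" "\<Lambda> * di j y z + \<theta> \<le> \<bar>f y - f z\<bar>"
        by (cases p) (auto simp: D2_def topW)
      then have "di i y z \<le> di j y z" using di_mono[OF ij] KT by blast
      then have "\<Lambda> * di i y z \<le> \<Lambda> * di j y z" using L by (intro mult_left_mono) auto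
      then show "p \<in> D2 i" using p by (auto simp: D2_def topW)
    qed
  next
    show "(\<Inter>i\<in>I. D2 i) = {}"
    proof (rule ccontr)
      assume "(\<Inter>i\<in>I. D2 i) \<noteq> {}"
      then obtain x y z where *: "\<And>i. i \<in> I \<Longrightarrow> (x, y, z) \<in> D2 i" by fast
      then have yz: "y \<in> topspace T" "z \<in> topspace T" using Ine KT by (auto simp: D2_def topW)
      define t where "t = \<bar>f y - f z\<bar> - \<theta>"
      have st: "\<Lambda> * di i y z \<le> t" if "i \<in> I" for i using *[OF that] by (simp add: D2_def t_def)
      obtain i0 where "i0 \<in> I" using Ine by blast
      then have t0: "0 \<le> t" using st[of i0] di_dist(2)[of i0 y z] yz L(2) by (meson mult_nonneg_nonneg less_imp_le order_trans)
      have "d y z \<le> ennreal (t / \<Lambda>)"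
        unfolding d_eq[OF yz] using st L(2) by (intro SUP_least ennreal_leI) (simp add: field_simps)
      then have "ennreal \<Lambda> * d y z \<le> ennreal \<Lambda> * ennreal (t / \<Lambda>)" by (rule mult_left_mono) simp
      also have "\<dots> = ennreal t" using L(2) t0 by (simp flip: ennreal_mult)
      finally have "ennreal \<bar>f y - f z\<bar> \<le> ennreal t" using L(1) yz by (meson order_trans)
      then have "\<bar>f y - f z\<bar> \<le> t" using t0 by (simp add: ennreal_le_iff)
      then show False using \<theta> by (simp add: t_def)
    qed
  qed
  then obtain i2 where i2: "i2 \<in> I" "D2 i2 = {}" by blast
  \<comment> \<open>Both bounds persist for larger indices: closeness for \<open>di i\<close>
    implies closeness for the smaller semidistance, and the right-hand sides grow.\<close>
  obtain i where i: "i \<in> I" "le i1 i" "le i2 i" using directed i1 i2 unfolding directed_set_def by meson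
  show thesis
  proof (rule that[OF i(1)])
    fix x y z assume xyz: "x \<in> K" "y \<in> K" "z \<in> K" and d: "di i x y \<le> r" "di i x z \<le> r"
    then have m: "di i1 x y \<le> di i x y" "di i1 x z \<le> di i x z" "di i1 y z \<le> di i y z"
      using di_mono[OF i1(1) i(1,2)] KT by blast+
    have "(x, y, z) \<notin> D i1" using i1 by simp
    then have "\<bar>f y - f z\<bar> < s x * di i1 y z + \<theta>" using xyz d m by (auto simp: D_def topW)
    moreover have "s x * di i1 y z \<le> s x * di i y z" using m s(2) xyz by (intro mult_left_mono) auto
    ultimately show "\<bar>f y - f z\<bar> \<le> s x * di i y z + \<theta>" by linarith
  next
    fix y z assume yz: "y \<in> K" "z \<in> K"
    then have m: "di i2 y z \<le> di i y z" using di_mono[OF i2(1) i(1,3)] KT by blast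
    have "(y, y, z) \<notin> D2 i2" using i2 by simp
    then have "\<bar>f y - f z\<bar> < \<Lambda> * di i2 y z + \<theta>" using yz by (auto simp: D2_def topW)
    moreover have "\<Lambda> * di i2 y z \<le> \<Lambda> * di i y z" using m L by (intro mult_left_mono) auto
    ultimately show "\<bar>f y - f z\<bar> \<le> \<Lambda> * di i y z + \<theta>" by linarith
  qed
qed

abbreviation "dist_i i \<equiv> \<lambda>x y. ennreal (di i x y)"

abbreviation "lip_bi i F \<equiv> bounded (F ` topspace T) \<and> lipschitz_wrt (topspace T) (dist_i i) F"

abbreviation "slope_i i F \<equiv> lip_a (topspace T) (dist_i i) F"

lemma di_ball_open:
  assumes i: "i \<in> I" and x: "x \<in> topspace T"
  shows "openin T {y \<in> topspace T. ennreal (di i y x) < ennreal \<rho>}"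
proof -
  have "openin T {y \<in> topspace T. di i y x \<in> {..<\<rho>}}"
    by (rule openin_continuous_map_preimage[of T euclideanreal])
       (use continuous_di[OF i, of T "\<lambda>y. y" "\<lambda>_. x"] x in auto)
  moreover have "{y \<in> topspace T. ennreal (di i y x) < ennreal \<rho>} = {y \<in> topspace T. di i y x \<in> {..<\<rho>}}"
    using di_dist(2)[OF i] x by (auto simp: ennreal_less_iff)
  ultimately show ?thesis by simp
qed

lemma continuous_lip_bi:
  assumes i: "i \<in> I" and F: "lipschitz_wrt (topspace T) (dist_i i) F"
  shows "continuous_map T euclideanreal F"
  by (rule continuous_map_lipschitz[OF F _ di_ball_open[OF i]]) (use di_dist(1)[OF i] in auto)

lemma lip_bi_lip_b:
  assumes i: "i \<in> I" and F: "lip_bi i F"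
  shows "F \<in> lip_b T d"
  using F continuous_lip_bi[OF i] lipschitz_wrt_mono_dist[of "topspace T" "dist_i i" F d] di_le_d[OF i]
  by (auto simp: lip_b_def)

lemma lip_bi_L2: assumes "i \<in> I" "lip_bi i F" shows "F \<in> L2 m"
  using lip_b_L2[OF prob sets_m lip_bi_lip_b[OF assms]] .

lemma slope_i_measurable:
  assumes i: "i \<in> I" and F: "lipschitz_wrt (topspace T) (dist_i i) F"
  shows "slope_i i F \<in> borel_measurable m"
proof (rule borel_measurable_lip_a[OF sets_m _ _ _ _ F])
  fix x y z assume xyz: "x \<in> topspace T" "y \<in> topspace T" "z \<in> topspace T"
  show "ennreal (di i x z) \<le> ennreal (di i x y) + ennreal (di i y z)"
    using di_dist[OF i] xyz by (simp flip: ennreal_plus)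
next
  show "openin T {y \<in> topspace T. ennreal (di i y x) < ennreal \<rho>}" if "x \<in> topspace T" for x \<rho>
    by (rule di_ball_open[OF i that])
qed (use di_dist[OF i] in auto)

lemma slope_i_L2:
  assumes i: "i \<in> I" and F: "lipschitz_wrt (topspace T) (dist_i i) F"
  shows "slope_i i F \<in> L2 m"
proof -
  obtain L where L: "0 < L" "\<forall>x\<in>topspace T. \<forall>y\<in>topspace T. ennreal \<bar>F x - F y\<bar> \<le> ennreal L * ennreal (di i x y)"
    using lipschitz_wrtE[OF F] by blast
  have "slope_i i F x \<le> L" for x
    using lip_a_le_const[of "topspace T" F L "dist_i i"] L by simp
  then show ?thesis
    by (intro L2_bounded[of m _ L] slope_i_measurable assms finite_measure_axioms) auto
qed

lemma slope_i_antimono: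
  assumes "i \<in> I" "j \<in> I" "le i j" "lipschitz_wrt (topspace T) (dist_i i) F"
  shows "lipschitz_wrt (topspace T) (dist_i j) F"
    "x \<in> topspace T \<Longrightarrow> slope_i j F x \<le> slope_i i F x"
proof -
  have le: "ennreal (di i x y) \<le> ennreal (di j x y)" if "x \<in> topspace T" "y \<in> topspace T" for x y
    using di_mono[OF assms(1-3) that] by (rule ennreal_leI)
  show "lipschitz_wrt (topspace T) (dist_i j) F"
    using lipschitz_wrt_mono_dist[OF assms(4) le] .
  show "x \<in> topspace T \<Longrightarrow> slope_i j F x \<le> slope_i i F x"
    using lip_a_mono_dist[OF assms(4) le] .
qed

lemma slope_d_le_slope_i:
  assumes "i \<in> I" "lipschitz_wrt (topspace T) (dist_i i) F" "x \<in> topspace T"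
  shows "lip_a (topspace T) d F x \<le> slope_i i F x"
  using lip_a_mono_dist[OF assms(2) di_le_d[OF assms(1)] assms(3)] .

text \<open>On K the chain envelope has the right values and slopes. Off K only crude bounds by M
  are available, and the small measure of the complement makes them negligible in L2.\<close>

theorem recovery:
  assumes f: "f \<in> lip_b T d" and \<epsilon>: "0 < \<epsilon>"
  shows "\<exists>i\<in>I. \<exists>F. lip_bi i F \<and> l2dist m F f < \<epsilon> \<and>
    l2norm m (slope_i i F) \<le> l2norm m (lip_a_star T d m f) + \<epsilon>"
proof -
  define h where "h = lip_a_star T d m f"
  obtain B0 where B0: "\<forall>x\<in>topspace T. \<bar>f x\<bar> \<le> B0" using lip_bD(3)[OF f] by (auto simp: bounded_iff)
  define B where "B = max B0 0"
  have B: "\<And>x. x \<in> topspace T \<Longrightarrow> \<bar>f x\<bar> \<le> B" "0 \<le> B" using B0 by (auto simp: B_def max.coboundedI1)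
  obtain L where L: "0 < L" "\<forall>x\<in>topspace T. \<forall>y\<in>topspace T. ennreal \<bar>f x - f y\<bar> \<le> ennreal L * d x y"
    using lipschitz_wrtE[OF lip_bD(1)[OF f]] by blast
  note hp = lip_a_star_bounds[OF prob sets_m L(2) less_imp_le[OF L(1)], folded h_def]
  \<comment> \<open>It is spent twice in the slope, once for the rounding in
    \<open>compact_core\<close> and once as the surcharge \<kappa>; twice \<epsilon>1 is at most
    \<epsilon>/4.\<close>
  define \<epsilon>1 where "\<epsilon>1 = min 1 (\<epsilon> / 8)"
  have e1: "0 < \<epsilon>1" "\<epsilon>1 \<le> 1" "8 * \<epsilon>1 \<le> \<epsilon>" using \<epsilon> by (auto simp: \<epsilon>1_def min_def)
  \<comment> \<open>Large enough for the Lipschitz constant L + 1 + \<epsilon>1 of F as well as for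
    |F - f|, which is at most 2B.\<close>
  define M where "M = L + 2 * B + 3"
  \<comment> \<open>The square is undone by the root in the norm of an indicator, leaving at most
    \<epsilon>/4 after multiplication by M. The bound 1/2 forces \<eta> below 1, so that K is
    nonempty.\<close>
  define \<eta> where "\<eta> = (min (1/2) (\<epsilon> / (4 * M)))\<^sup>2"
  have M: "0 < M" using L B by (simp add: M_def)
  then have "0 < min (1/2) (\<epsilon> / (4 * M))" using \<epsilon> by simp
  then have \<eta>: "0 < \<eta>" unfolding \<eta>_def by (rule zero_less_power)
  have sqrt_\<eta>: "sqrt \<eta> = min (1/2) (\<epsilon> / (4 * M))" unfolding \<eta>_def using M \<epsilon> by (intro real_sqrt_abs[THEN trans]) auto
  obtain s K r where K: "compactin T K" and Km [measurable]: "K \<in> sets m" and mK: "measure m (space m - K) < \<eta>" and r: "0 < r"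
    and sc: "continuous_map (subtopology T K) euclideanreal s"
    and s: "\<forall>x\<in>K. 0 \<le> s x \<and> s x \<le> h x + \<epsilon>1 \<and> s x \<le> L + \<epsilon>1"
    and tri: "\<forall>x\<in>K. \<forall>y\<in>K. \<forall>z\<in>K. (\<forall>i\<in>I. di i x y \<le> r) \<longrightarrow> (\<forall>i\<in>I. di i x z \<le> r) \<longrightarrow>
       (\<forall>e>0. \<exists>i\<in>I. \<bar>f y - f z\<bar> < s x * di i y z + e)"
    by (rule compact_core[OF f hp(1) hp(2,3,4) e1(1) \<eta>])
  have KT: "K \<subseteq> topspace T" using K compactin_subset_topspace by blast
  \<comment> \<open>One above L, because s may exceed the slope bound L by \<epsilon>1, which is at
    most 1.\<close>
  define \<Lambda> where "\<Lambda> = L + 1"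
  have \<Lambda>: "0 < \<Lambda>" "\<forall>x\<in>K. s x \<le> \<Lambda>" using L s e1 by (auto simp: \<Lambda>_def)
  have \<Lambda>L: "\<forall>x\<in>topspace T. \<forall>y\<in>topspace T. ennreal \<bar>f x - f y\<bar> \<le> ennreal \<Lambda> * d x y"
  proof (intro ballI)
    fix x y assume "x \<in> topspace T" "y \<in> topspace T"
    then have "ennreal \<bar>f x - f y\<bar> \<le> ennreal L * d x y" using L by blast
    also have "\<dots> \<le> ennreal \<Lambda> * d x y" by (intro mult_right_mono ennreal_leI) (auto simp: \<Lambda>_def)
    finally show "ennreal \<bar>f x - f y\<bar> \<le> ennreal \<Lambda> * d x y" .
  qed
  define b where "b = min (\<epsilon>1 * r / 4) (\<epsilon> / 4)"
  define \<theta> where "\<theta> = min 1 (min (r / 4) (b / (4 * \<Lambda> + r + 5)))"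
  have b: "0 < b" using e1 r \<epsilon> by (simp add: b_def)
  have den: "0 < 4 * \<Lambda> + r + 5" using \<Lambda> r by simp
  have \<theta>: "0 < \<theta>" "4 * \<theta> \<le> r" "\<theta> \<le> 1" "\<theta> \<le> b / (4 * \<Lambda> + r + 5)" using b r den by (auto simp: \<theta>_def)
  have err: "4 * \<Lambda> * \<theta> + \<theta> * (r + 2 * \<theta> + 2) + \<theta> \<le> b"
  proof -
    have "4 * \<Lambda> * \<theta> + \<theta> * (r + 2 * \<theta> + 2) + \<theta> \<le> \<theta> * (4 * \<Lambda> + r + 5)"
      using \<theta> mult_left_mono[of \<theta> 1 \<theta>] by (simp add: algebra_simps)
    also have "\<dots> \<le> b" using \<theta>(4) den by (simp add: field_simps)
    finally show ?thesis .
  qed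
  obtain i where i: "i \<in> I"
    and i1: "\<And>x y z. \<lbrakk>x \<in> K; y \<in> K; z \<in> K; di i x y \<le> r; di i x z \<le> r\<rbrakk> \<Longrightarrow> \<bar>f y - f z\<bar> \<le> s x * di i y z + \<theta>"
    and i2: "\<And>y z. \<lbrakk>y \<in> K; z \<in> K\<rbrakk> \<Longrightarrow> \<bar>f y - f z\<bar> \<le> \<Lambda> * di i y z + \<theta>"
    using compact_index[OF K r \<theta>(1) sc _ lip_bD(2)[OF f] \<Lambda>L \<Lambda>(1) tri] s by blast
  have "K \<noteq> {}"
  proof
    assume "K = {}"
    then have "1 < \<eta>" using mK by (simp add: prob_space)
    moreover have "\<eta> \<le> (1/2)\<^sup>2" unfolding \<eta>_def using M \<epsilon> by (intro power_mono) auto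
    ultimately show False by (simp add: power2_eq_square)
  qed
  interpret slope_chain "topspace T" "di i" K f s \<Lambda> r \<theta> \<epsilon>1 B
  proof
    have "4 * (4 * \<Lambda> * \<theta> + \<theta> * (r + 2 * \<theta> + 2)) \<le> 4 * b" using err \<theta>(1) by simp
    also have "\<dots> \<le> \<epsilon>1 * r" by (simp add: b_def)
    finally show "4 * (4 * \<Lambda> * \<theta> + \<theta> * (r + 2 * \<theta> + 2)) \<le> \<epsilon>1 * r" .
  qed (use semi[OF i] KT \<open>K \<noteq> {}\<close> B s \<Lambda> \<theta> r e1 i1 i2 in auto)
  define F where "F = envelope"
  have FL: "ennreal \<bar>F x - F y\<bar> \<le> ennreal (\<Lambda> + \<epsilon>1) * ennreal (di i x y)" if "x \<in> topspace T" "y \<in> topspace T" for x y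
  proof -
    have "ennreal \<bar>F x - F y\<bar> \<le> ennreal ((\<Lambda> + \<epsilon>1) * di i x y)"
      using envelope_lip[OF that] unfolding F_def by (rule ennreal_leI)
    then show ?thesis using di_dist(2)[OF i that] \<Lambda> e1 by (subst (asm) ennreal_mult) auto
  qed
  then have Flip: "lipschitz_wrt (topspace T) (dist_i i) F"
    unfolding lipschitz_wrt_def using \<Lambda> e1 by (intro exI[of _ "\<Lambda> + \<epsilon>1"]) auto
  have FB: "\<bar>F x\<bar> \<le> B" if "x \<in> topspace T" for x using envelope_bound[OF that] by (simp add: F_def)
  have Fbi: "lip_bi i F" using Flip FB by (auto simp: bounded_iff)
  have slopeK: "slope_i i F x \<le> h x + 2 * \<epsilon>1" if x: "x \<in> K" for x
  proof -
    have "slope_i i F x \<le> s x + \<epsilon>1"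
    proof (rule lip_a_leI)
      fix e :: real assume "0 < e"
      then obtain \<rho> where \<rho>: "\<rho> > 0" "\<forall>y\<in>topspace T. \<forall>z\<in>topspace T. di i y x < \<rho> \<longrightarrow> di i z x < \<rho> \<longrightarrow>
          \<bar>F y - F z\<bar> \<le> (s x + \<epsilon>1 + e) * di i y z" using envelope_local[OF x] unfolding F_def by blast
      have "local_lip (topspace T) (dist_i i) F x (s x + \<epsilon>1 + e) \<rho>"
        unfolding local_lip_def
      proof (intro ballI impI)
        fix y z assume yz: "y \<in> topspace T" "z \<in> topspace T" "ennreal (di i y x) < ennreal \<rho>" "ennreal (di i z x) < ennreal \<rho>"
        then have "di i y x < \<rho>" "di i z x < \<rho>" using di_dist(2)[OF i] x KT by (auto simp: ennreal_less_iff)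
        then have "\<bar>F y - F z\<bar> \<le> (s x + \<epsilon>1 + e) * di i y z" using \<rho> yz by blast
        then show "ennreal \<bar>F y - F z\<bar> \<le> ennreal (s x + \<epsilon>1 + e) * ennreal (di i y z)"
          using s x e1 \<open>0 < e\<close> di_dist(2)[OF i yz(1,2)] by (subst ennreal_mult[symmetric]) (auto intro: ennreal_leI)
      qed
      then show "\<exists>\<rho>>0. local_lip (topspace T) (dist_i i) F x (s x + \<epsilon>1 + e) \<rho>" using \<rho> by blast
    qed (use s x e1 in auto)
    then show ?thesis using s x by force
  qed
  have slopeX: "slope_i i F x \<le> M" for x
    using lip_a_le_const[of "topspace T" F "\<Lambda> + \<epsilon>1" "dist_i i" x] FL \<Lambda> e1 B
    by (force simp: \<Lambda>_def M_def)
  let ?O = "space m - K"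
  have small: "M * sqrt (measure m ?O) < \<epsilon> / 2"
  proof -
    have "sqrt (measure m ?O) < sqrt \<eta>" using mK by simp
    also have "\<dots> \<le> \<epsilon> / (4 * M)" by (simp add: sqrt_\<eta>)
    finally have "M * sqrt (measure m ?O) < M * (\<epsilon> / (4 * M))" using M by (rule mult_strict_left_mono)
    also have "\<dots> = \<epsilon> / 4" using M by simp
    finally show ?thesis using \<epsilon> by simp
  qed
  have ind: "(\<lambda>x. M * indicator ?O x) \<in> L2 m" by (intro L2_indicator finite_measure_axioms) auto
  have nind: "l2norm m (\<lambda>x. M * indicator ?O x) < \<epsilon> / 2"
    using l2norm_indicator[of ?O m M] small M by simp
  have const: "(\<lambda>x. c) \<in> L2 m" "0 \<le> c \<Longrightarrow> l2norm m (\<lambda>x. c) = c" for c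
    by (auto intro: L2_const finite_measure_axioms simp: l2norm_def prob_space)
  have "l2norm m (slope_i i F) \<le> l2norm m (\<lambda>x. h x + (2 * \<epsilon>1 + M * indicator ?O x))"
  proof (rule l2norm_mono)
    show "AE x in m. \<bar>slope_i i F x\<bar> \<le> \<bar>h x + (2 * \<epsilon>1 + M * indicator ?O x)\<bar>"
      using hp(3) AE_space
    proof eventually_elim
      fix x assume x: "0 \<le> h x" "x \<in> space m"
      have "slope_i i F x \<le> h x + (2 * \<epsilon>1 + M * indicator ?O x)"
        using slopeK[of x] slopeX[of x] x e1 by (cases "x \<in> K") auto
      then show "\<bar>slope_i i F x\<bar> \<le> \<bar>h x + (2 * \<epsilon>1 + M * indicator ?O x)\<bar>"
        using lip_a_nonneg[of "topspace T" "dist_i i" F x] by linarith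
    qed
  qed (use slope_i_measurable[OF i Flip] in \<open>auto intro!: L2_add hp(5) const ind\<close>)
  also have "\<dots> \<le> l2norm m h + (l2norm m (\<lambda>x. 2 * \<epsilon>1) + l2norm m (\<lambda>x. M * indicator ?O x))"
    by (intro order_trans[OF l2norm_add_le] add_left_mono l2norm_add_le L2_add hp(5) const ind)
  also have "\<dots> \<le> l2norm m h + \<epsilon>" using nind const(2)[of "2 * \<epsilon>1"] e1 by simp
  finally have 1: "l2norm m (slope_i i F) \<le> l2norm m h + \<epsilon>" .
  have FL2: "F \<in> L2 m" "f \<in> L2 m" using lip_bi_L2[OF i Fbi] lip_b_L2[OF prob sets_m f] by auto
  have "l2dist m F f \<le> l2norm m (\<lambda>x. \<epsilon> / 4 + M * indicator ?O x)"
  proof (rule l2norm_mono)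
    show "AE x in m. \<bar>F x - f x\<bar> \<le> \<bar>\<epsilon> / 4 + M * indicator ?O x\<bar>"
      using AE_space
    proof eventually_elim
      fix x assume x: "x \<in> space m"
      show "\<bar>F x - f x\<bar> \<le> \<bar>\<epsilon> / 4 + M * indicator ?O x\<bar>"
      proof (cases "x \<in> K")
        case True
        have "b \<le> \<epsilon> / 4" by (simp add: b_def)
        then show ?thesis using envelope_le[OF True] envelope_ge[OF True] err True by (simp add: F_def err_def)
      next
        case False
        then show ?thesis using FB[of x] B(1)[of x] x L \<epsilon> by (auto simp: M_def space_m)
      qed
    qed
  qed (use FL2 in \<open>auto intro!: L2_add const ind\<close>)
  also have "\<dots> \<le> l2norm m (\<lambda>x. \<epsilon> / 4) + l2norm m (\<lambda>x. M * indicator ?O x)"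
    by (intro l2norm_add_le const ind)
  also have "\<dots> < \<epsilon>" using nind const(2)[of "\<epsilon> / 4"] \<epsilon> by simp
  finally show ?thesis using 1 Fbi i by (auto simp: h_def)
qed

end

section \<open>Cheeger energies of quotients\<close>

lemma Liminf_less_frequently:
  fixes X :: "nat \<Rightarrow> ennreal"
  assumes "liminf X < c" shows "\<exists>\<^sub>F n in sequentially. X n < c"
proof (rule ccontr)
  assume "\<not> (\<exists>\<^sub>F n in sequentially. X n < c)"
  then have "\<forall>\<^sub>F n in sequentially. c \<le> X n" by (simp add: not_frequently not_less)
  then show False using Liminf_bounded assms by (metis leD)
qed

abbreviation "star_energy T d m u \<equiv> \<integral>\<^sup>+x. ennreal ((lip_a_star T d m u x)\<^sup>2) \<partial>m"

text \<open>With its converse \<open>cheeger_leI\<close> this replaces the sequences in the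
  definition by one approximant for each precision, so that no diagonal sequences are needed
  later.\<close>

lemma cheeger_lessD:
  assumes "cheeger T d m f < c" "0 < \<delta>"
  shows "\<exists>u\<in>lip_b T d. l2dist m u f < \<delta> \<and> star_energy T d m u < c"
proof -
  obtain F where F: "\<And>n. F n \<in> lip_b T d" "l2_tendsto m F f sequentially"
    "liminf (\<lambda>n. star_energy T d m (F n)) < c"
    using assms(1) unfolding cheeger_def INF_less_iff by blast
  have "\<forall>\<^sub>F n in sequentially. l2dist m (F n) f < \<delta>"
    using F(2) assms(2) unfolding l2_tendsto_def by (intro order_tendstoD(2)) auto
  then have "\<forall>\<^sub>F n in sequentially. star_energy T d m (F n) < c \<longrightarrow>
      star_energy T d m (F n) < c \<and> l2dist m (F n) f < \<delta>"
    by (rule eventually_mono) simp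
  from frequently_rev_mp[OF Liminf_less_frequently[OF F(3)] this]
  obtain n where "star_energy T d m (F n) < c" "l2dist m (F n) f < \<delta>"
    using frequently_ex by blast
  then show ?thesis using F(1) by blast
qed

lemma cheeger_leI:
  assumes "prob_space m" "sets m = sets (borel_of T)" "f \<in> L2 m"
    and near: "\<And>\<delta>. 0 < \<delta> \<Longrightarrow> \<exists>u\<in>lip_b T d. l2dist m u f < \<delta> \<and>
      star_energy T d m u \<le> c"
  shows "cheeger T d m f \<le> c"
proof -
  have "\<exists>u. u \<in> lip_b T d \<and> l2dist m u f < 1 / Suc n \<and>
      star_energy T d m u \<le> c" for n
    using near[of "1 / Suc n"] by auto
  then obtain F where F: "\<And>n. F n \<in> lip_b T d" "\<And>n. l2dist m (F n) f < 1 / Suc n"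
      "\<And>n. star_energy T d m (F n) \<le> c" by metis
  have "(\<lambda>n. l2dist m (F n) f) \<longlonglongrightarrow> 0"
    by (rule tendsto_sandwich[OF _ _ tendsto_const LIMSEQ_Suc[OF lim_1_over_n]])
       (intro always_eventually allI less_imp_le[OF F(2)] l2norm_nonneg)+
  then have "l2_tendsto m F f sequentially"
    using lip_b_L2[OF assms(1,2) F(1)] assms(3) by (simp add: l2_tendsto_def)
  then have "cheeger T d m f \<le> liminf (\<lambda>n. star_energy T d m (F n))"
    unfolding cheeger_def using F(1) by (intro INF_lower) auto
  also have "\<dots> \<le> liminf (\<lambda>n::nat. c)" by (intro Liminf_mono always_eventually allI F(3))
  also have "\<dots> = c" by (simp add: Liminf_const)
  finally show ?thesis .
qed

lemma cheeger_lsc: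
  assumes "prob_space m" "sets m = sets (borel_of T)" "f \<in> L2 m"
    and near: "\<And>\<delta>. 0 < \<delta> \<Longrightarrow> \<exists>g\<in>L2 m. l2dist m g f < \<delta> \<and> cheeger T d m g \<le> c"
  shows "cheeger T d m f \<le> c"
proof (cases "c = top")
  case False
  show ?thesis
  proof (rule dense_ge)
    fix c' assume c': "c < c'"
    show "cheeger T d m f \<le> c'"
    proof (rule cheeger_leI[OF assms(1-3)])
      fix \<delta> :: real assume "0 < \<delta>"
      then obtain g where g: "g \<in> L2 m" "l2dist m g f < \<delta> / 2" "cheeger T d m g \<le> c"
        using near[of "\<delta> / 2"] by auto
      obtain u where u: "u \<in> lip_b T d" "l2dist m u g < \<delta> / 2"
        "star_energy T d m u < c'"
        using cheeger_lessD[of T d m g c' "\<delta> / 2"] g(3) c' \<open>0 < \<delta>\<close> by (meson half_gt_zero order_le_less_trans)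
      have "l2dist m u f < \<delta>"
        using l2norm_triangle[OF lip_b_L2[OF assms(1,2) u(1)] g(1) assms(3)] u g by simp
      then show "\<exists>u\<in>lip_b T d. l2dist m u f < \<delta> \<and> star_energy T d m u \<le> c'"
        using u by (meson less_imp_le)
    qed
  qed
qed simp

context monotone_approximation
begin

context
  fixes i assumes i: "i \<in> I"
begin

abbreviation "qX \<equiv> topspace T // zero_rel (topspace T) (di i)"
abbreviation "qd A B \<equiv> ennreal (quot_dist (topspace T) (di i) A B)"
abbreviation "qproj \<equiv> quot_proj (topspace T) (di i)"
abbreviation "qT \<equiv> quot_topology T (di i)"
abbreviation "qm \<equiv> quot_measure T (di i) m"

lemma qMetric: "Metric_space qX (quot_dist (topspace T) (di i))"
  by (rule Metric_space_quot[OF semi[OF i]])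

lemma topspace_qT: "topspace qT = qX"
  using Metric_space.topspace_mtopology[OF qMetric] by (simp add: quot_topology_def)

lemma qX_eq: "qX = qproj ` topspace T"
  by (auto simp: quotient_def quot_proj_def)

lemma qproj_in: "x \<in> topspace T \<Longrightarrow> qproj x \<in> qX" by (simp add: qX_eq)

lemma qd_proj: "x \<in> topspace T \<Longrightarrow> y \<in> topspace T \<Longrightarrow> qd (qproj x) (qproj y) = ennreal (di i x y)"
  using quot_dist_proj[OF semi[OF i]] by simp

lemma qproj_continuous: "continuous_map T qT qproj"
  unfolding continuous_map_def
proof (intro conjI allI impI)
  show "qproj \<in> topspace T \<rightarrow> topspace qT" by (auto simp: topspace_qT qproj_in)
  fix U assume U: "openin qT U"
  interpret M: Metric_space qX "quot_dist (topspace T) (di i)" by (rule qMetric)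
  show "openin T {x \<in> topspace T. qproj x \<in> U}"
  proof (subst openin_subopen, intro ballI)
    fix x assume x: "x \<in> {x \<in> topspace T. qproj x \<in> U}"
    then obtain r where r: "r > 0" "M.mball (qproj x) r \<subseteq> U"
      using U unfolding quot_topology_def M.openin_mtopology by blast
    have "openin T {y \<in> topspace T. di i x y \<in> {..<r}}"
      by (rule openin_continuous_map_preimage[of T euclideanreal])
         (use continuous_di[OF i, of T "\<lambda>_. x" "\<lambda>y. y"] x in auto)
    moreover have "{y \<in> topspace T. di i x y \<in> {..<r}} \<subseteq> {x \<in> topspace T. qproj x \<in> U}"
      using r x quot_dist_proj[OF semi[OF i]] qproj_in by (auto simp: M.mball_def subset_iff)
    moreover have "x \<in> {y \<in> topspace T. di i x y \<in> {..<r}}" using x r di_dist(1)[OF i] by auto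
    ultimately show "\<exists>S. openin T S \<and> x \<in> S \<and> S \<subseteq> {x \<in> topspace T. qproj x \<in> U}" by blast
  qed
qed

lemma qproj_measurable [measurable]: "qproj \<in> measurable m (borel_of qT)"
  unfolding borel_of_def
proof (rule measurable_measure_of)
  fix U assume "U \<in> {U. openin qT U}"
  then have "openin T {x \<in> topspace T. qproj x \<in> U}" using qproj_continuous openin_continuous_map_preimage by blast
  moreover have "qproj -` U \<inter> space m = {x \<in> topspace T. qproj x \<in> U}" using space_m by auto
  ultimately show "qproj -` U \<inter> space m \<in> sets m" using openin_borel_of sets_m by auto
next
  show "{U. openin qT U} \<subseteq> Pow (topspace qT)" using openin_subset by blast
  show "qproj \<in> space m \<rightarrow> topspace qT" by (auto simp: topspace_qT space_m qproj_in)
qed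

lemma prob_qm: "prob_space qm"
  unfolding quot_measure_def by (rule prob_space_distr[OF qproj_measurable])

lemma sets_qm: "sets qm = sets (borel_of qT)" by (simp add: quot_measure_def)

lemma measurable_comp_qproj: "g \<in> borel_measurable qm \<Longrightarrow> (\<lambda>x. g (qproj x)) \<in> borel_measurable m"
  using measurable_compose[OF qproj_measurable, of g borel] measurable_cong_sets[OF sets_qm refl] by blast

lemma l2norm_qm: "g \<in> borel_measurable qm \<Longrightarrow> l2norm qm g = l2norm m (\<lambda>x. g (qproj x))"
  unfolding l2norm_def quot_measure_def
  by (subst integral_distr[OF qproj_measurable]) (auto simp: quot_measure_def)

lemma L2_qm: assumes "g \<in> L2 qm" shows "(\<lambda>x. g (qproj x)) \<in> L2 m"
proof -
  have "integrable qm (\<lambda>A. (g A)\<^sup>2)" using L2_integrable_square[OF assms] .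
  then have "integrable m (\<lambda>x. (g (qproj x))\<^sup>2)"
    unfolding quot_measure_def
    by (subst (asm) integrable_distr_eq[OF qproj_measurable]) (use L2_measurable[OF assms] in \<open>auto simp: quot_measure_def\<close>)
  then show ?thesis using measurable_comp_qproj[OF L2_measurable[OF assms]] by (simp add: L2_def)
qed

text \<open>The projection is onto and preserves distances, so the two suprema range over the same
  quotients.\<close>

lemma slope_qproj:
  assumes FG: "\<And>x. x \<in> topspace T \<Longrightarrow> F x = G (qproj x)" and x: "x \<in> topspace T"
  shows "lip_a qX qd G (qproj x) = slope_i i F x"
proof -
  have "{ennreal \<bar>G A - G B\<bar> / qd A B | A B.
     A \<in> qX \<and> B \<in> qX \<and> max (qd A (qproj x)) (qd B (qproj x)) < ennreal r \<and> 0 < qd A B} =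
    {ennreal \<bar>F y - F z\<bar> / ennreal (di i y z) | y z.
     y \<in> topspace T \<and> z \<in> topspace T \<and> max (ennreal (di i y x)) (ennreal (di i z x)) < ennreal r \<and> 0 < ennreal (di i y z)}"
    (is "?L = ?R") for r
  proof (rule set_eqI, rule iffI)
    fix v assume "v \<in> ?L"
    then obtain A B where AB: "v = ennreal \<bar>G A - G B\<bar> / qd A B" "A \<in> qX" "B \<in> qX"
      "max (qd A (qproj x)) (qd B (qproj x)) < ennreal r" "0 < qd A B" by blast
    obtain y z where "y \<in> topspace T" "z \<in> topspace T" "A = qproj y" "B = qproj z" using AB(2,3) qX_eq by auto
    then show "v \<in> ?R" using AB FG qd_proj x by (intro CollectI exI[of _ y] exI[of _ z]) auto
  next
    fix v assume "v \<in> ?R"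
    then obtain y z where yz: "v = ennreal \<bar>F y - F z\<bar> / ennreal (di i y z)" "y \<in> topspace T" "z \<in> topspace T"
      "max (ennreal (di i y x)) (ennreal (di i z x)) < ennreal r" "0 < ennreal (di i y z)" by blast
    then show "v \<in> ?L" using FG qd_proj[OF yz(2,3)] qd_proj[OF yz(2) x] qd_proj[OF yz(3) x] qproj_in
      by (intro CollectI exI[of _ "qproj y"] exI[of _ "qproj z"]) auto
  qed
  then show ?thesis by (simp add: lip_a_def)
qed

lemma lip_b_qT_pullback:
  assumes "G \<in> lip_b qT qd"
  shows "lip_bi i (\<lambda>x. G (qproj x))"
proof
  have "(\<lambda>x. G (qproj x)) ` topspace T \<subseteq> G ` topspace qT" using topspace_qT qproj_in by auto
  then show "bounded ((\<lambda>x. G (qproj x)) ` topspace T)" using lip_bD(3)[OF assms] bounded_subset by blast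
  obtain L where "0 < L" "\<forall>A\<in>qX. \<forall>B\<in>qX. ennreal \<bar>G A - G B\<bar> \<le> ennreal L * qd A B"
    using lipschitz_wrtE[OF lip_bD(1)[OF assms]] topspace_qT by metis
  then have "\<forall>x\<in>topspace T. \<forall>y\<in>topspace T. ennreal \<bar>G (qproj x) - G (qproj y)\<bar> \<le> ennreal L * ennreal (di i x y)"
    using qproj_in qd_proj by metis
  then show "lipschitz_wrt (topspace T) (dist_i i) (\<lambda>x. G (qproj x))"
    unfolding lipschitz_wrt_def using \<open>0 < L\<close> by (intro exI[of _ L]) auto
qed

lemma qT_ball_open:
  assumes "A \<in> topspace qT"
  shows "openin qT {B \<in> topspace qT. qd B A < ennreal \<rho>}"
proof -
  interpret M: Metric_space qX "quot_dist (topspace T) (di i)" by (rule qMetric)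
  have "{B \<in> topspace qT. qd B A < ennreal \<rho>} = M.mball A \<rho>"
    using assms by (auto simp: topspace_qT ennreal_less_iff M.mball_def M.commute)
  then show ?thesis by (simp add: quot_topology_def)
qed

lemma lip_a_qT_measurable:
  assumes "lipschitz_wrt qX qd G"
  shows "lip_a qX qd G \<in> borel_measurable qm"
proof -
  interpret M: Metric_space qX "quot_dist (topspace T) (di i)" by (rule qMetric)
  have "lip_a (topspace qT) qd G \<in> borel_measurable qm"
  proof (rule borel_measurable_lip_a[OF sets_qm])
    fix A B C assume "A \<in> topspace qT" "B \<in> topspace qT" "C \<in> topspace qT"
    then show "qd A C \<le> qd A B + qd B C"
      using M.triangle by (simp add: topspace_qT ennreal_leI flip: ennreal_plus)
  next
    show "openin qT {B \<in> topspace qT. qd B A < ennreal \<rho>}" if "A \<in> topspace qT" for A \<rho>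
      by (rule qT_ball_open[OF that])
  qed (use assms M.commute topspace_qT in auto)
  then show ?thesis by (simp add: topspace_qT)
qed

text \<open>Balls of the quotient metric are open, so the slope there is Borel and coincides almost
  everywhere with its envelope; the integral is then transported by the projection.\<close>

lemma quot_energy:
  assumes G: "G \<in> lip_b qT qd" and FG: "\<And>x. x \<in> topspace T \<Longrightarrow> F x = G (qproj x)"
  shows "star_energy qT qd qm G = ennreal ((l2norm m (slope_i i F))\<^sup>2)"
proof -
  have Glip: "lipschitz_wrt qX qd G" using lip_bD(1)[OF G] topspace_qT by simp
  note meas = lip_a_qT_measurable[OF Glip]
  have "AE A in qm. lip_a_star qT qd qm G A = lip_a qX qd G A"
    using lip_a_star_AE_eq[OF prob_qm sets_qm lip_bD(1)[OF G]] meas topspace_qT by simp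
  then have "star_energy qT qd qm G = (\<integral>\<^sup>+A. ennreal ((lip_a qX qd G A)\<^sup>2) \<partial>qm)"
    by (intro nn_integral_cong_AE) auto
  also have "\<dots> = (\<integral>\<^sup>+x. ennreal ((lip_a qX qd G (qproj x))\<^sup>2) \<partial>m)"
    unfolding quot_measure_def
    by (subst nn_integral_distr[OF qproj_measurable]) (use meas in \<open>auto simp: quot_measure_def\<close>)
  also have "\<dots> = (\<integral>\<^sup>+x. ennreal ((slope_i i F x)\<^sup>2) \<partial>m)"
    using slope_qproj[of F G, OF FG] by (intro nn_integral_cong) (simp add: space_m)
  also have "\<dots> = ennreal ((l2norm m (slope_i i F))\<^sup>2)"
  proof (rule nn_integral_square_L2[OF slope_i_L2[OF i]])
    have "lipschitz_wrt (topspace T) (dist_i i) (\<lambda>x. G (qproj x))"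
      using lip_b_qT_pullback[OF G] by blast
    then show "lipschitz_wrt (topspace T) (dist_i i) F"
      using FG by (simp add: lipschitz_wrt_def)
  qed
  finally show ?thesis .
qed

lemma lip_bi_factor:
  assumes F: "lip_bi i F"
  obtains G where "G \<in> lip_b qT qd" "\<forall>x\<in>topspace T. F x = G (qproj x)"
proof -
  \<comment> \<open>The choice of representative is immaterial: points at distance zero have equal
    values under a Lipschitz function.\<close>
  define G where "G A = F (inv_into (topspace T) qproj A)" for A
  have FG: "F x = G (qproj x)" if x: "x \<in> topspace T" for x
  proof -
    define y where "y = inv_into (topspace T) qproj (qproj x)"
    have y: "y \<in> topspace T" "qproj y = qproj x"
      unfolding y_def by (rule inv_into_into f_inv_into_f, rule imageI, rule x)+
    have "qd (qproj x) (qproj y) = 0" using y Metric_space.zero[OF qMetric, of "qproj x" "qproj x"] qproj_in[OF x] by simp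
    then have "ennreal (di i x y) = 0" using qd_proj[OF x y(1)] by simp
    then show ?thesis using lipschitz_wrt_zero[of "topspace T" "dist_i i" F x y] F x y
      by (simp add: G_def y_def)
  qed
  obtain L where L: "0 < L" "\<forall>x\<in>topspace T. \<forall>y\<in>topspace T. ennreal \<bar>F x - F y\<bar> \<le> ennreal L * ennreal (di i x y)"
    using lipschitz_wrtE[OF conjunct2[OF F]] by blast
  have GL: "ennreal \<bar>G A - G B\<bar> \<le> ennreal L * qd A B" if AB: "A \<in> qX" "B \<in> qX" for A B
  proof -
    obtain x y where "x \<in> topspace T" "y \<in> topspace T" "A = qproj x" "B = qproj y" using AB qX_eq by auto
    then show ?thesis using L(2) FG qd_proj by metis
  qed
  have Glip: "lipschitz_wrt (topspace qT) qd G"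
    using GL L(1) by (auto simp: lipschitz_wrt_def topspace_qT intro!: exI[of _ L])
  have "qd A A = 0" if "A \<in> topspace qT" for A
    using Metric_space.zero[OF qMetric, of A A] that topspace_qT by simp
  then have "continuous_map qT euclideanreal G"
    by (intro continuous_map_lipschitz[OF Glip _ qT_ball_open]) auto
  moreover have "G ` topspace qT = F ` topspace T" using FG by (auto simp: topspace_qT qX_eq)
  ultimately have "G \<in> lip_b qT qd"
    using F Glip by (simp add: lip_b_def)
  then show thesis using that FG by blast
qed

text \<open>Composition with the projection is an isometry, so the distance to a factor of f depends
  on f alone and not on the factor picked by \<open>SOME\<close>.\<close>

lemma factors_l2norm:
  assumes "factors_to T (di i) m f g" "f \<in> L2 m" "G \<in> L2 qm" and FG: "\<And>x. x \<in> topspace T \<Longrightarrow> F x = G (qproj x)"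
  shows "l2dist qm G g = l2dist m F f"
proof -
  have g: "g \<in> L2 qm" "AE x in m. f x = g (qproj x)" using assms(1) by (auto simp: factors_to_def)
  have "l2dist qm G g = l2norm m (\<lambda>x. G (qproj x) - g (qproj x))"
    using l2norm_qm[of "\<lambda>A. G A - g A"] g assms(3) L2_measurable by simp
  also have "\<dots> = l2dist m F f"
  proof (rule l2norm_AE_cong)
    show "AE x in m. G (qproj x) - g (qproj x) = F x - f x"
      using g(2) AE_space by eventually_elim (simp add: FG space_m)
    show "(\<lambda>x. G (qproj x) - g (qproj x)) \<in> borel_measurable m"
      using L2_qm[OF g(1)] L2_qm[OF assms(3)] by (intro borel_measurable_diff L2_measurable)
    have "(\<lambda>x. F x) \<in> borel_measurable m"
      using L2_measurable[OF L2_qm[OF assms(3)]] by (rule measurable_cong[THEN iffD1, rotated]) (simp add: FG space_m)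
    then show "(\<lambda>x. F x - f x) \<in> borel_measurable m"
      using L2_measurable[OF assms(2)] by (intro borel_measurable_diff)
  qed
  finally show ?thesis .
qed

lemma cheeger_semi_lessD:
  assumes "cheeger_semi T (di i) m f < c" "f \<in> L2 m" "0 < \<delta>"
  shows "\<exists>F. lip_bi i F \<and> l2dist m F f < \<delta> \<and> ennreal ((l2norm m (slope_i i F))\<^sup>2) < c"
proof -
  define g where "g = (SOME g. factors_to T (di i) m f g)"
  have ex: "\<exists>g. factors_to T (di i) m f g" using assms(1) by (auto simp: cheeger_semi_def split: if_splits)
  then have g: "factors_to T (di i) m f g" unfolding g_def by (rule someI_ex)
  have "cheeger qT qd qm g < c" using assms(1) ex by (simp add: cheeger_semi_def cheeger_quot_def g_def)
  then obtain G where G: "G \<in> lip_b qT qd" "l2dist qm G g < \<delta>"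
    "star_energy qT qd qm G < c" using cheeger_lessD assms(3) by blast
  define F where "F = (\<lambda>x. G (qproj x))"
  have "lip_bi i F" using lip_b_qT_pullback[OF G(1)] by (simp add: F_def)
  moreover have "l2dist m F f < \<delta>"
    using factors_l2norm[OF g assms(2) lip_b_L2[OF prob_qm sets_qm G(1)], of F] G(2) by (simp add: F_def)
  moreover have "ennreal ((l2norm m (slope_i i F))\<^sup>2) < c"
    using quot_energy[OF G(1), of F] G(3) by (simp add: F_def)
  ultimately show ?thesis by blast
qed

text \<open>Before any estimate, f must be shown to factor through the quotient, since otherwise its
  energy is infinite. The factors of the approximants are Cauchy in L2 of the quotient by isometry,
  and their limit is a factor of f by completeness.\<close>

lemma cheeger_semi_leI:
  assumes f: "f \<in> L2 m"
    and near: "\<And>\<delta>. 0 < \<delta> \<Longrightarrow> \<exists>F. lip_bi i F \<and> l2dist m F f < \<delta> \<and> ennreal ((l2norm m (slope_i i F))\<^sup>2) \<le> c"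
  shows "cheeger_semi T (di i) m f \<le> c"
proof -
  have "\<exists>G. G \<in> lip_b qT qd \<and> l2norm m (\<lambda>x. G (qproj x) - f x) < \<delta> \<and>
      star_energy qT qd qm G \<le> c" if "0 < \<delta>" for \<delta>
  proof -
    obtain F where F: "lip_bi i F" "l2dist m F f < \<delta>" "ennreal ((l2norm m (slope_i i F))\<^sup>2) \<le> c"
      using near[OF \<open>0 < \<delta>\<close>] by blast
    obtain G where G: "G \<in> lip_b qT qd" and FG: "\<forall>x\<in>topspace T. F x = G (qproj x)"
      using lip_bi_factor[OF F(1)] by blast
    have "l2dist m F f = l2norm m (\<lambda>x. G (qproj x) - f x)"
      unfolding l2norm_def by (intro arg_cong[where f=sqrt] Bochner_Integration.integral_cong) (auto simp: space_m FG)
    then show ?thesis using G F quot_energy[OF G, of F] FG by (intro exI[of _ G]) auto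
  qed
  note Gex = this
  have "\<exists>G. G \<in> lip_b qT qd \<and> l2norm m (\<lambda>x. G (qproj x) - f x) < 1 / Suc n" for n
    using Gex[of "1 / Suc n"] by auto
  then obtain G where G: "\<And>n. G n \<in> lip_b qT qd" "\<And>n. l2norm m (\<lambda>x. G n (qproj x) - f x) < 1 / Suc n" by metis
  have GL: "G n \<in> L2 qm" for n using lip_b_L2[OF prob_qm sets_qm G(1)] .
  have GLm: "(\<lambda>x. G n (qproj x)) \<in> L2 m" for n using L2_qm[OF GL] .
  have conv: "(\<lambda>n. l2norm m (\<lambda>x. G n (qproj x) - f x)) \<longlonglongrightarrow> 0"
    by (rule tendsto_sandwich[OF _ _ tendsto_const LIMSEQ_Suc[OF lim_1_over_n]])
       (intro always_eventually allI less_imp_le[OF G(2)] l2norm_nonneg)+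
  have "\<exists>N. \<forall>j\<ge>N. \<forall>k\<ge>N. l2dist qm (G j) (G k) < e" if "0 < e" for e
  proof -
    obtain N where N: "\<forall>n\<ge>N. l2norm m (\<lambda>x. G n (qproj x) - f x) < e / 2"
      using order_tendstoD(2)[OF conv, of "e / 2"] \<open>0 < e\<close> by (auto simp: eventually_sequentially)
    have "l2dist qm (G j) (G k) < e" if "j \<ge> N" "k \<ge> N" for j k
    proof -
      have "l2dist qm (G j) (G k) = l2norm m (\<lambda>x. G j (qproj x) - G k (qproj x))"
        using l2norm_qm[of "\<lambda>A. G j A - G k A"] GL L2_measurable by simp
      also have "\<dots> \<le> l2norm m (\<lambda>x. G j (qproj x) - f x) + l2norm m (\<lambda>x. f x - G k (qproj x))"
        by (rule l2norm_triangle[OF GLm f GLm])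
      also have "\<dots> < e"
      proof -
        have "l2norm m (\<lambda>x. G j (qproj x) - f x) < e / 2" "l2norm m (\<lambda>x. G k (qproj x) - f x) < e / 2"
          using N that by auto
        then show ?thesis using l2norm_commute[of m f "\<lambda>x. G k (qproj x)"] by linarith
      qed
      finally show ?thesis .
    qed
    then show ?thesis by blast
  qed
  then have "\<forall>e>0. \<exists>N. \<forall>j\<ge>N. \<forall>k\<ge>N. l2dist qm (G j) (G k) < e" by blast
  then obtain g where g: "g \<in> L2 qm" "(\<lambda>n. l2dist qm (G n) g) \<longlonglongrightarrow> 0"
    by (rule L2_complete[of qm G, OF prob_qm GL])
  have gm: "(\<lambda>x. g (qproj x)) \<in> L2 m" using L2_qm[OF g(1)] .
  have "l2norm m (\<lambda>x. f x - g (qproj x)) \<le> l2norm m (\<lambda>x. G n (qproj x) - f x) + l2dist qm (G n) g" for n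
  proof -
    have "l2dist qm (G n) g = l2norm m (\<lambda>x. G n (qproj x) - g (qproj x))"
      using l2norm_qm[of "\<lambda>A. G n A - g A"] GL g L2_measurable by simp
    then show ?thesis using l2norm_triangle[OF f GLm gm, of n] l2norm_commute[of m f "\<lambda>x. G n (qproj x)"] by simp
  qed
  moreover have "(\<lambda>n. l2norm m (\<lambda>x. G n (qproj x) - f x) + l2dist qm (G n) g) \<longlonglongrightarrow> 0 + 0"
    by (intro tendsto_add conv g)
  ultimately have "l2norm m (\<lambda>x. f x - g (qproj x)) \<le> 0"
    by (intro tendsto_lowerbound[where F=sequentially]) auto
  then have "AE x in m. f x - g (qproj x) = 0"
    using l2norm_eq_0_AE[OF L2_diff[OF f gm]] l2norm_nonneg[of m "\<lambda>x. f x - g (qproj x)"] by linarith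
  then have ex: "\<exists>g. factors_to T (di i) m f g" using g(1) by (auto simp: factors_to_def)
  define g' where "g' = (SOME g. factors_to T (di i) m f g)"
  have g': "factors_to T (di i) m f g'" unfolding g'_def using ex by (rule someI_ex)
  have "cheeger qT qd qm g' \<le> c"
  proof (rule cheeger_leI[OF prob_qm sets_qm])
    show "g' \<in> L2 qm" using g' by (simp add: factors_to_def)
    fix \<delta> :: real assume "0 < \<delta>"
    then obtain G where G: "G \<in> lip_b qT qd" "l2norm m (\<lambda>x. G (qproj x) - f x) < \<delta>"
      "star_energy qT qd qm G \<le> c" using Gex by blast
    have "l2dist qm G g' < \<delta>"
      using factors_l2norm[OF g' f lip_b_L2[OF prob_qm sets_qm G(1)], of "\<lambda>x. G (qproj x)"] G(2) by simp
    then show "\<exists>u\<in>lip_b qT qd. l2dist qm u g' < \<delta> \<and> star_energy qT qd qm u \<le> c"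
      using G by blast
  qed
  then show ?thesis using ex by (simp add: cheeger_semi_def cheeger_quot_def g'_def)
qed

end

section \<open>Comparison of the energies along the index set\<close>

abbreviation "Ch \<equiv> cheeger T d m"
abbreviation "Chi i \<equiv> cheeger_semi T (di i) m"

lemma Chi_lsc:
  assumes "i \<in> I" "f \<in> L2 m"
    and near: "\<And>\<delta>. 0 < \<delta> \<Longrightarrow> \<exists>g\<in>L2 m. l2dist m g f < \<delta> \<and> Chi i g \<le> c"
  shows "Chi i f \<le> c"
proof (rule dense_ge)
  fix c' assume c': "c < c'"
  show "Chi i f \<le> c'"
  proof (rule cheeger_semi_leI[OF assms(1,2)])
    fix \<delta> :: real assume "0 < \<delta>"
    then obtain g where g: "g \<in> L2 m" "l2dist m g f < \<delta> / 2" "Chi i g \<le> c"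
      using near[of "\<delta> / 2"] by auto
    obtain F where F: "lip_bi i F" "l2dist m F g < \<delta> / 2" "ennreal ((l2norm m (slope_i i F))\<^sup>2) < c'"
      using cheeger_semi_lessD[OF assms(1) order_le_less_trans[OF g(3) c'] g(1), of "\<delta> / 2"] \<open>0 < \<delta>\<close> by auto
    have "l2dist m F f < \<delta>"
      using l2norm_triangle[OF lip_bi_L2[OF assms(1) F(1)] g(1) assms(2)] F g by simp
    then show "\<exists>F. lip_bi i F \<and> l2dist m F f < \<delta> \<and> ennreal ((l2norm m (slope_i i F))\<^sup>2) \<le> c'"
      using F by (meson less_imp_le)
  qed
qed

lemma Chi_lip_bi: assumes "i \<in> I" "lip_bi i F" shows "Chi i F \<le> ennreal ((l2norm m (slope_i i F))\<^sup>2)"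
  using assms by (intro cheeger_semi_leI lip_bi_L2 exI[of _ F]) auto

text \<open>The slope for \<open>di i\<close> is a measurable majorant of the slope for
  \<open>d\<close>, so the envelope lies below it.\<close>

lemma star_energy_le:
  assumes i: "i \<in> I" and F: "lip_bi i F"
  shows "AE x in m. lip_a_star T d m F x \<le> slope_i i F x"
    "star_energy T d m F \<le> ennreal ((l2norm m (slope_i i F))\<^sup>2)"
proof -
  have Fd: "F \<in> lip_b T d" using lip_bi_lip_b[OF i F] .
  have E: "is_ess_envelope m (lip_a (topspace T) d F) (lip_a_star T d m F)"
    using lip_a_star_envelope[OF prob sets_m lip_bD(1)[OF Fd]] .
  have "AE x in m. lip_a (topspace T) d F x \<le> slope_i i F x"
    using AE_space by eventually_elim (use slope_d_le_slope_i[OF i] F space_m in auto)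
  then show 1: "AE x in m. lip_a_star T d m F x \<le> slope_i i F x"
    using E slope_i_measurable[OF i] F unfolding is_ess_envelope_def by blast
  have "AE x in m. 0 \<le> lip_a_star T d m F x"
    using E unfolding is_ess_envelope_def by (auto elim!: eventually_mono intro: order_trans[OF lip_a_nonneg])
  then have "star_energy T d m F \<le> (\<integral>\<^sup>+x. ennreal ((slope_i i F x)\<^sup>2) \<partial>m)"
    using 1 by (intro nn_integral_mono_AE) (auto elim!: eventually_elim2 intro!: ennreal_leI power_mono)
  then show "star_energy T d m F \<le> ennreal ((l2norm m (slope_i i F))\<^sup>2)"
    using nn_integral_square_L2[OF slope_i_L2[OF i]] F by simp
qed

lemma Ch_le_Chi: assumes "i \<in> I" "f \<in> L2 m" shows "Ch f \<le> Chi i f"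
proof (rule dense_ge)
  fix c assume "Chi i f < c"
  show "Ch f \<le> c"
  proof (rule cheeger_leI[OF prob sets_m assms(2)])
    fix \<delta> :: real assume "0 < \<delta>"
    then obtain F where F: "lip_bi i F" "l2dist m F f < \<delta>" "ennreal ((l2norm m (slope_i i F))\<^sup>2) < c"
      using cheeger_semi_lessD[OF assms(1) \<open>Chi i f < c\<close> assms(2)] by blast
    then show "\<exists>u\<in>lip_b T d. l2dist m u f < \<delta> \<and> star_energy T d m u \<le> c"
      using star_energy_le(2)[OF assms(1) F(1)] lip_bi_lip_b[OF assms(1) F(1)] by (meson less_imp_le order_trans)
  qed
qed

text \<open>One function serves all indices beyond \<open>i0\<close>, because slopes decrease with
  the index. This uniformity is what the flows use.\<close>

lemma Chi_recovery:
  assumes f: "f \<in> L2 m" "Ch f < ennreal c" and \<epsilon>: "0 < \<epsilon>"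
  shows "\<exists>i0\<in>I. \<exists>w\<in>L2 m. l2dist m w f < \<epsilon> \<and> (\<forall>i\<in>I. le i0 i \<longrightarrow> Chi i w \<le> ennreal c)"
proof -
  obtain u where u: "u \<in> lip_b T d" "l2dist m u f < \<epsilon> / 2"
    "star_energy T d m u < ennreal c"
    using cheeger_lessD[OF f(2), of "\<epsilon> / 2"] \<epsilon> by auto
  obtain L where L: "0 < L" "\<forall>x\<in>topspace T. \<forall>y\<in>topspace T. ennreal \<bar>u x - u y\<bar> \<le> ennreal L * d x y"
    using lipschitz_wrtE[OF lip_bD(1)[OF u(1)]] by blast
  note star = lip_a_star_bounds(5)[OF prob sets_m L(2) less_imp_le[OF L(1)]]
  define N where "N = l2norm m (lip_a_star T d m u)"
  have "ennreal (N\<^sup>2) < ennreal c" using u(3) nn_integral_square_L2[OF star] by (simp add: N_def)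
  then have N: "N\<^sup>2 < c" by (simp add: ennreal_less_iff)
  have "0 \<le> N" by (simp add: N_def)
  then have "N < sqrt c" using N real_less_rsqrt by blast
  \<comment> \<open>Half of \<epsilon> is left for the distance from u to w, and the norm N may rise
    by e without its square exceeding c.\<close>
  define e where "e = min (\<epsilon> / 2) (sqrt c - N)"
  have e: "0 < e" using \<epsilon> \<open>N < sqrt c\<close> by (simp add: e_def)
  obtain i0 w where w: "i0 \<in> I" "lip_bi i0 w" "l2dist m w u < e" "l2norm m (slope_i i0 w) \<le> N + e"
    using recovery[OF u(1) e] unfolding N_def by blast
  have c0: "0 < c" using N by (meson order_le_less_trans zero_le_power2)
  have wL: "w \<in> L2 m" using lip_bi_L2 w by blast
  have "l2dist m w f < \<epsilon>"
    using l2norm_triangle[OF wL lip_b_L2[OF prob sets_m u(1)] f(1)] w(3) u(2) by (simp add: e_def)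
  moreover have "Chi i w \<le> ennreal c" if i: "i \<in> I" "le i0 i" for i
  proof -
    have wi: "lip_bi i w" using slope_i_antimono(1)[OF w(1) i] w(2) by blast
    have "l2norm m (slope_i i w) \<le> l2norm m (slope_i i0 w)"
    proof (rule l2norm_mono)
      show "AE x in m. \<bar>slope_i i w x\<bar> \<le> \<bar>slope_i i0 w x\<bar>"
        using AE_space by eventually_elim (use slope_i_antimono(2)[OF w(1) i] w(2) space_m in auto)
    qed (use slope_i_L2 slope_i_measurable i w wi in auto)
    also have "\<dots> \<le> sqrt c" using w(4) by (simp add: e_def min_def split: if_splits)
    finally have "(l2norm m (slope_i i w))\<^sup>2 \<le> (sqrt c)\<^sup>2" by (intro power_mono) auto
    then show ?thesis using Chi_lip_bi[OF i(1) wi] c0 by (simp add: ennreal_leI order_trans[OF Chi_lip_bi[OF i(1) wi]])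
  qed
  ultimately show ?thesis using w(1) wL by blast
qed

end

section \<open>Gradient curves\<close>

text \<open>Absolute continuity is only used through the majorant \<open>w\<close>: the exceptional null set is covered by an
  open set over which \<open>w\<close> has small integral, and Bolzano's principle glues the local estimates.\<close>

lemma abs_continuous_nonincreasing:
  fixes \<phi> w :: "real \<Rightarrow> real"
  assumes "a \<le> b" and w: "set_integrable lborel {a..b} w"
    and ac: "\<And>s t. \<lbrakk>a \<le> s; s \<le> t; t \<le> b\<rbrakk> \<Longrightarrow> \<phi> t - \<phi> s \<le> (LINT r:{s..t}|lborel. w r)"
    and deriv: "AE t in lborel. a < t \<and> t < b \<longrightarrow> (\<exists>D\<le>0. (\<phi> has_real_derivative D) (at t))"
  shows "\<phi> b \<le> \<phi> a"
proof -
  obtain N where N: "N \<in> null_sets lborel"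
    "{t \<in> space lborel. \<not> (a < t \<and> t < b \<longrightarrow> (\<exists>D\<le>0. (\<phi> has_real_derivative D) (at t)))} \<subseteq> N"
    using deriv unfolding eventually_ae_filter by blast
  \<comment> \<open>The derivative is known only inside the interval, so the endpoints join the
    exceptional set.\<close>
  define N' where "N' = N \<union> {a, b}"
  have N'0: "N' \<in> null_sets lborel" unfolding N'_def using N(1) finite_imp_null_set_lborel[of "{a, b}"] by (intro null_sets.Un) auto
  define v where "v r = indicator {a..b} r * \<bar>w r\<bar>" for r
  have v_int: "integrable lborel v"
    using set_integrable_abs[OF w] by (simp add: set_integrable_def v_def[abs_def])
  then have v_meas [measurable]: "v \<in> borel_measurable borel" by simp
  have v0: "0 \<le> v r" for r by (simp add: v_def)
  \<comment> \<open>A finite Borel measure vanishing on the exceptional set; its outer regularity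
    supplies the open cover.\<close>
  define \<nu> where "\<nu> = density lborel (\<lambda>r. ennreal (v r))"
  have "emeasure \<nu> (space \<nu>) = (\<integral>\<^sup>+r. ennreal (v r) \<partial>lborel)"
    by (simp add: \<nu>_def emeasure_density)
  also have "\<dots> < \<infinity>" using v_int v0 by (subst nn_integral_eq_integral) auto
  finally have fin: "emeasure \<nu> (space \<nu>) \<noteq> \<infinity>" by simp
  have N'b: "N' \<in> sets borel" using N'0 by auto
  have "emeasure \<nu> N' = 0"
    using N'0 N'b unfolding \<nu>_def by (subst emeasure_density) (auto simp: nn_integral_null_set)
  have key: "\<phi> b - \<phi> a \<le> \<epsilon> * (b - a) + \<epsilon>" if \<epsilon>: "0 < \<epsilon>" for \<epsilon>
  proof -
    have "(INF U\<in>{U. N' \<subseteq> U \<and> open U}. emeasure \<nu> U) < ennreal \<epsilon>"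
      using outer_regular[of \<nu> N'] fin N'b \<open>emeasure \<nu> N' = 0\<close> \<epsilon> by (simp add: \<nu>_def)
    then obtain U where U: "N' \<subseteq> U" "open U" "emeasure \<nu> U < ennreal \<epsilon>" by (auto simp: INF_less_iff)
    have [measurable]: "U \<in> sets borel" using U(2) by simp
    \<comment> \<open>The increment of V over (x, y] is the mass of the majorant on the part inside
      the cover; it pays for the exceptional points.\<close>
    define V where "V t = (\<integral>r. indicator ({a..t} \<inter> U) r * v r \<partial>lborel)" for t
    have int: "integrable lborel (\<lambda>r. indicator (A \<inter> U) r * v r)" if "A \<in> sets borel" for A
      by (rule Bochner_Integration.integrable_bound[OF v_int]) (use that v0 in \<open>auto simp: indicator_def\<close>)
    have V_mono: "V x \<le> V y" if "x \<le> y" for x y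
      unfolding V_def by (rule integral_mono[OF int int]) (use that v0 in \<open>auto simp: indicator_def\<close>)
    \<comment> \<open>Additive over adjacent intervals, as Bolzano requires. The length term serves
      points with a derivative, the V term the exceptional ones.\<close>
    define P where "P x y \<longleftrightarrow> (a \<le> x \<longrightarrow> y \<le> b \<longrightarrow> \<phi> y - \<phi> x \<le> \<epsilon> * (y - x) + (V y - V x))" for x y
    have "P a b"
    proof (rule Bolzano[OF \<open>a \<le> b\<close>])
      show "P x z" if "P x y" "P y z" "x \<le> y" "y \<le> z" for x y z
      proof -
        have "\<epsilon> * (z - x) = \<epsilon> * (z - y) + \<epsilon> * (y - x)" by (simp add: algebra_simps)
        then show ?thesis using that unfolding P_def by linarith
      qed
    next
      fix t assume t: "a \<le> t" "t \<le> b"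
      show "\<exists>d>0. \<forall>x y. x \<le> t \<and> t \<le> y \<and> y - x < d \<longrightarrow> P x y"
      proof (cases "t \<in> N'")
        case True
        then obtain d where d: "0 < d" "ball t d \<subseteq> U" using U open_contains_ball by blast
        have "P x y" if xy: "x \<le> t" "t \<le> y" "y - x < d" for x y
          unfolding P_def
        proof (intro impI)
          assume ab: "a \<le> x" "y \<le> b"
          have sub: "{x..y} \<subseteq> U" using d xy by (intro order_trans[OF _ d(2)]) (auto simp: dist_real_def)
          have "set_integrable lborel {x..y} w" using w ab by (auto intro: set_integrable_subset)
          then have "(LINT r:{x..y}|lborel. w r) \<le> (\<integral>r. indicator ({a..y} \<inter> U) r * v r - indicator ({a..x} \<inter> U) r * v r \<partial>lborel)"
            unfolding set_lebesgue_integral_def set_integrable_def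
          proof (rule integral_mono_AE)
            show "integrable lborel (\<lambda>r. indicator ({a..y} \<inter> U) r * v r - indicator ({a..x} \<inter> U) r * v r)"
              using int by (intro Bochner_Integration.integrable_diff) auto
            \<comment> \<open>The difference of indicators belongs to (x, y], so the inequality may
              fail at the single point x.\<close>
            show "AE r in lborel. indicator {x..y} r *\<^sub>R w r \<le> indicator ({a..y} \<inter> U) r * v r - indicator ({a..x} \<inter> U) r * v r"
              using AE_lborel_singleton[of x]
            proof eventually_elim
              fix r assume "r \<noteq> x"
              then show "indicator {x..y} r *\<^sub>R w r \<le> indicator ({a..y} \<inter> U) r * v r - indicator ({a..x} \<inter> U) r * v r"
                using sub ab xy v0[of r] by (auto simp: indicator_def v_def subset_iff split: if_splits)
            qed
          qed
          also have "\<dots> = V y - V x" unfolding V_def using int by (intro Bochner_Integration.integral_diff) auto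
          finally have "\<phi> y - \<phi> x \<le> V y - V x" using ac[of x y] ab xy by linarith
          then show "\<phi> y - \<phi> x \<le> \<epsilon> * (y - x) + (V y - V x)" using \<epsilon> xy by (simp add: add_increasing)
        qed
        then show ?thesis using d by blast
      next
        case False
        then obtain D where D: "D \<le> 0" "(\<phi> has_real_derivative D) (at t)"
          using N(2) t by (auto simp: N'_def less_le)
        then have "(\<phi> has_derivative (\<lambda>h. D * h)) (at t within UNIV)" by (simp add: has_field_derivative_def)
        then obtain d where d: "0 < d" "\<And>y. \<bar>y - t\<bar> < d \<Longrightarrow> \<bar>\<phi> y - \<phi> t - D * (y - t)\<bar> \<le> \<epsilon> * \<bar>y - t\<bar>"
          using \<epsilon> unfolding has_derivative_within_alt by auto
        have "P x y" if xy: "x \<le> t" "t \<le> y" "y - x < d" for x y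
        proof -
          have "\<bar>\<phi> y - \<phi> t - D * (y - t)\<bar> \<le> \<epsilon> * (y - t)" using d(2)[of y] xy by simp
          moreover have "\<bar>\<phi> x - \<phi> t - D * (x - t)\<bar> \<le> \<epsilon> * (t - x)" using d(2)[of x] xy by simp
          moreover have "D * (y - t) \<le> 0" "0 \<le> D * (x - t)"
            using D xy by (auto intro: mult_nonpos_nonneg mult_nonpos_nonpos)
          moreover have "\<epsilon> * (y - x) = \<epsilon> * (y - t) + \<epsilon> * (t - x)" by (simp add: algebra_simps)
          ultimately show ?thesis using V_mono[of x y] xy unfolding P_def by linarith
        qed
        then show ?thesis using d by blast
      qed
    qed
    then have "\<phi> b - \<phi> a \<le> \<epsilon> * (b - a) + (V b - V a)" by (simp add: P_def)
    moreover have "0 \<le> V a" unfolding V_def using v0 by (intro integral_nonneg_AE) auto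
    moreover have "V b \<le> \<epsilon>"
    proof -
      have "ennreal (V b) = (\<integral>\<^sup>+r. ennreal (indicator ({a..b} \<inter> U) r * v r) \<partial>lborel)"
        unfolding V_def using v0 int by (subst nn_integral_eq_integral) auto
      also have "\<dots> \<le> (\<integral>\<^sup>+r. ennreal (v r) * indicator U r \<partial>lborel)"
        by (intro nn_integral_mono) (auto simp: indicator_def)
      also have "\<dots> = emeasure \<nu> U" by (simp add: \<nu>_def emeasure_density)
      also have "\<dots> \<le> ennreal \<epsilon>" using U(3) by simp
      finally show ?thesis using \<epsilon> by (simp add: ennreal_le_iff)
    qed
    ultimately show ?thesis by linarith
  qed
  show ?thesis
  proof (rule ccontr)
    assume "\<not> \<phi> b \<le> \<phi> a"
    then have p: "0 < \<phi> b - \<phi> a" by simp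
    \<comment> \<open>This value turns the estimate \<open>key\<close> into: the gap is at most half
      of itself.\<close>
    define \<epsilon> where "\<epsilon> = (\<phi> b - \<phi> a) / (2 * (b - a + 1))"
    have "0 < \<epsilon>" using p assms(1) by (simp add: \<epsilon>_def)
    have "\<epsilon> * (b - a) + \<epsilon> = \<epsilon> * (b - a + 1)" by (simp add: distrib_left)
    also have "\<dots> = (\<phi> b - \<phi> a) / 2"
    proof -
      define c where "c = b - a + 1"
      have "0 < c" using assms(1) by (simp add: c_def)
      then show ?thesis unfolding \<epsilon>_def c_def[symmetric] by simp
    qed
    finally have "\<epsilon> * (b - a) + \<epsilon> = (\<phi> b - \<phi> a) / 2" .
    then show False using key[OF \<open>0 < \<epsilon>\<close>] p by simp
  qed
qed

section \<open>Continuity of the inner product and the derivative of the squared distance\<close>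

lemma l2_tendsto_inner:
  assumes "l2_tendsto m F f net" "g \<in> L2 m"
  shows "((\<lambda>i. \<integral>x. F i x * g x \<partial>m) \<longlongrightarrow> (\<integral>x. f x * g x \<partial>m)) net"
proof (rule Lim_null_comparison[THEN Lim_null[THEN iffD2]])
  have F: "\<forall>\<^sub>F i in net. F i \<in> L2 m" "f \<in> L2 m" "((\<lambda>i. l2dist m (F i) f) \<longlongrightarrow> 0) net"
    using assms(1) by (auto simp: l2_tendsto_def)
  show "\<forall>\<^sub>F i in net. norm ((\<integral>x. F i x * g x \<partial>m) - (\<integral>x. f x * g x \<partial>m)) \<le> l2dist m (F i) f * l2norm m g"
    using F(1)
  proof eventually_elim
    fix i assume Fi: "F i \<in> L2 m"
    have "(\<integral>x. F i x * g x \<partial>m) - (\<integral>x. f x * g x \<partial>m) = (\<integral>x. (F i x - f x) * g x \<partial>m)"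
      using L2_mult_integrable[OF Fi assms(2)] L2_mult_integrable[OF F(2) assms(2)]
      by (simp add: left_diff_distrib)
    then show "norm ((\<integral>x. F i x * g x \<partial>m) - (\<integral>x. f x * g x \<partial>m)) \<le> l2dist m (F i) f * l2norm m g"
      using l2_Cauchy_Schwarz[OF L2_diff[OF Fi F(2)] assms(2)] by simp
  qed
  show "((\<lambda>i. l2dist m (F i) f * l2norm m g) \<longlongrightarrow> 0) net"
    using tendsto_mult_right[OF F(3), of "l2norm m g"] by simp
qed

lemma l2_tendsto_norm:
  assumes "l2_tendsto m F f net"
  shows "((\<lambda>i. l2norm m (F i)) \<longlongrightarrow> l2norm m f) net"
proof (rule Lim_null_comparison[THEN Lim_null[THEN iffD2]])
  have F: "\<forall>\<^sub>F i in net. F i \<in> L2 m" "f \<in> L2 m" "((\<lambda>i. l2dist m (F i) f) \<longlongrightarrow> 0) net"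
    using assms(1) by (auto simp: l2_tendsto_def)
  then show "((\<lambda>i. l2dist m (F i) f) \<longlongrightarrow> 0) net" by simp
  show "\<forall>\<^sub>F i in net. norm (l2norm m (F i) - l2norm m f) \<le> l2dist m (F i) f"
    using F(1)
  proof eventually_elim
    fix i assume Fi: "F i \<in> L2 m"
    show "norm (l2norm m (F i) - l2norm m f) \<le> l2dist m (F i) f"
      using l2norm_le_diff[OF Fi F(2)] l2norm_le_diff[OF F(2) Fi] l2norm_commute[of m f "F i"] by auto
  qed
qed

lemma half_square_dist_derivative:
  assumes u: "\<And>s. 0 \<le> s \<Longrightarrow> u s \<in> L2 m" and v: "v \<in> L2 m" and t: "0 < t"
    and d: "l2_has_derivative m u \<xi> t"
  shows "((\<lambda>s. (l2dist m (u s) v)\<^sup>2 / 2) has_real_derivative (\<integral>x. \<xi> x * (u t x - v x) \<partial>m)) (at t)"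
proof -
  define q where "q s = (\<lambda>x. (u s x - u t x) / (s - t))" for s
  have q: "l2_tendsto m q \<xi> (at t)" using d by (simp add: l2_has_derivative_def q_def[abs_def])
  have ut: "u t \<in> L2 m" "(\<lambda>x. u t x - v x) \<in> L2 m" using L2_diff[OF u v, of t] u t by auto
  have pos: "\<forall>\<^sub>F s in at t. 0 < s \<and> s \<noteq> t"
    using order_tendstoD(1)[OF tendsto_ident_at t] eventually_neq_at_within[of t t UNIV] by (rule eventually_conj)
  \<comment> \<open>The difference quotients q converge in norm, so the quadratic remainder vanishes
    with s - t.\<close>
  have "((\<lambda>s. (\<integral>x. q s x * (u t x - v x) \<partial>m) + (s - t) * (l2norm m (q s))\<^sup>2 / 2) \<longlongrightarrow>
      (\<integral>x. \<xi> x * (u t x - v x) \<partial>m) + (t - t) * (l2norm m \<xi>)\<^sup>2 / 2) (at t)"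
    by (intro tendsto_intros l2_tendsto_inner[OF q ut(2)] l2_tendsto_norm[OF q]) auto
  moreover have "\<forall>\<^sub>F s in at t. (\<integral>x. q s x * (u t x - v x) \<partial>m) + (s - t) * (l2norm m (q s))\<^sup>2 / 2 =
      ((l2dist m (u s) v)\<^sup>2 / 2 - (l2dist m (u t) v)\<^sup>2 / 2) / (s - t)"
    using pos
  proof eventually_elim
    fix s assume s: "0 < s \<and> s \<noteq> t"
    have us: "u s \<in> L2 m" "(\<lambda>x. u s x - u t x) \<in> L2 m" "q s \<in> L2 m"
      using u[of s] s L2_diff[OF u ut(1), of s] L2_divide[OF L2_diff[OF u ut(1), of s], of "s - t"]
      by (auto simp: q_def)
    have "(l2dist m (u s) v)\<^sup>2 = (l2norm m (\<lambda>x. (u t x - v x) + (s - t) * q s x))\<^sup>2"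
      using s by (simp add: q_def)
    also have "\<dots> = (l2dist m (u t) v)\<^sup>2 + 2 * ((s - t) * (\<integral>x. q s x * (u t x - v x) \<partial>m)) + (s - t)\<^sup>2 * (l2norm m (q s))\<^sup>2"
      using l2norm_add_square[OF ut(2) L2_scale[OF us(3), of "s - t"]]
      by (simp add: l2norm_scale power_mult_distrib mult.left_commute[of _ "s - t"] mult.commute[of "q s _"])
    finally have eq: "(l2dist m (u s) v)\<^sup>2 = (l2dist m (u t) v)\<^sup>2 +
      2 * ((s - t) * (\<integral>x. q s x * (u t x - v x) \<partial>m)) + (s - t)\<^sup>2 * (l2norm m (q s))\<^sup>2" .
    have "(l2dist m (u s) v)\<^sup>2 / 2 - (l2dist m (u t) v)\<^sup>2 / 2 =
        ((\<integral>x. q s x * (u t x - v x) \<partial>m) + (s - t) * (l2norm m (q s))\<^sup>2 / 2) * (s - t)"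
    proof -
      have "A / 2 - B / 2 = (p + h * c / 2) * h" if "A = B + 2 * (h * p) + h\<^sup>2 * c" for A B p h c :: real
        unfolding that by (simp add: field_simps power2_eq_square)
      then show ?thesis using eq by blast
    qed
    then show "(\<integral>x. q s x * (u t x - v x) \<partial>m) + (s - t) * (l2norm m (q s))\<^sup>2 / 2 =
      ((l2dist m (u s) v)\<^sup>2 / 2 - (l2dist m (u t) v)\<^sup>2 / 2) / (s - t)"
      using s by simp
  qed
  ultimately have "((\<lambda>s. ((l2dist m (u s) v)\<^sup>2 / 2 - (l2dist m (u t) v)\<^sup>2 / 2) / (s - t)) \<longlongrightarrow>
      (\<integral>x. \<xi> x * (u t x - v x) \<partial>m)) (at t)"
    by (simp cong: filterlim_cong)
  then show ?thesis by (simp add: has_field_derivative_iff)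
qed

section \<open>The evolution variational inequality and its consequences\<close>

definition l2_lsc :: "'a measure \<Rightarrow> (('a \<Rightarrow> real) \<Rightarrow> ennreal) \<Rightarrow> bool" where
  "l2_lsc m \<Phi> \<longleftrightarrow> (\<forall>f\<in>L2 m. \<forall>c. (\<forall>\<delta>>0. \<exists>g\<in>L2 m. l2dist m g f < \<delta> \<and> \<Phi> g \<le> c) \<longrightarrow> \<Phi> f \<le> c)"

locale gradient_flow =
  fixes m :: "'a measure" and \<Phi> :: "('a \<Rightarrow> real) \<Rightarrow> ennreal" and f0 :: "'a \<Rightarrow> real" and u :: "real \<Rightarrow> 'a \<Rightarrow> real"
  assumes curve: "gradient_curve m \<Phi> f0 u" and lsc: "l2_lsc m \<Phi>"
begin

lemma u_L2: "0 \<le> t \<Longrightarrow> u t \<in> L2 m"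
  using curve by (simp add: gradient_curve_def)

text \<open>At almost every time the subdifferential inequality bounds the derivative of half the
  squared distance by c - k. A constant lower bound k in place of the integral of the energy avoids
  asking for measurability of the energy along the curve.\<close>

lemma evi:
  assumes st: "0 < s" "s \<le> t" and v: "v \<in> L2 m" "\<Phi> v \<le> ennreal c" and ck: "0 \<le> c" "0 \<le> k"
    and lower: "\<And>r. s < r \<Longrightarrow> r < t \<Longrightarrow> ennreal k \<le> \<Phi> (u r)"
  shows "(l2dist m (u t) v)\<^sup>2 / 2 \<le> (l2dist m (u s) v)\<^sup>2 / 2 + (t - s) * (c - k)"
proof -
  have "l2_loc_abs_continuous m u" using curve by (simp add: gradient_curve_def)
  then obtain w where w: "set_integrable lborel {s..t} w"
    "\<And>x y. s \<le> x \<Longrightarrow> x \<le> y \<Longrightarrow> y \<le> t \<Longrightarrow> l2dist m (u y) (u x) \<le> (LINT r:{x..y}|lborel. w r)"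
    unfolding l2_loc_abs_continuous_def using st by metis
  define N where "N r = l2dist m (u r) v" for r
  have N_diff: "\<bar>N y - N x\<bar> \<le> l2dist m (u y) (u x)" if "0 \<le> x" "0 \<le> y" for x y
    using l2norm_triangle[OF u_L2[OF that(2)] u_L2[OF that(1)] v(1)] l2norm_triangle[OF u_L2[OF that(1)] u_L2[OF that(2)] v(1)]
      l2norm_commute[of m "u x" "u y"] unfolding N_def by linarith
  define C where "C = (LINT r:{s..t}|lborel. \<bar>w r\<bar>)"
  have sub: "set_integrable lborel {x..y} w" if "s \<le> x" "y \<le> t" for x y
    using w(1) that by (auto intro: set_integrable_subset)
  have wC: "(LINT r:{x..y}|lborel. w r) \<le> C" if "s \<le> x" "x \<le> y" "y \<le> t" for x y
    unfolding C_def set_lebesgue_integral_def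
  proof (rule integral_mono)
    show "integrable lborel (\<lambda>r. indicat_real {x..y} r *\<^sub>R w r)" using sub that by (simp add: set_integrable_def)
    show "integrable lborel (\<lambda>r. indicat_real {s..t} r *\<^sub>R \<bar>w r\<bar>)" using set_integrable_abs[OF w(1)] by (simp add: set_integrable_def)
  qed (use that in \<open>auto simp: indicator_def\<close>)
  \<comment> \<open>A bound for the distance on the whole interval, which turns the majorant of the
    curve into one for the squared distance.\<close>
  define M where "M = N s + C"
  have N0: "0 \<le> N r" for r by (simp add: N_def)
  have NM: "N r \<le> M" if "s \<le> r" "r \<le> t" for r
    using N_diff[of s r] w(2)[of s r] wC[of s r] that st unfolding M_def by linarith
  have M0: "0 \<le> M" using NM[of s] N0[of s] st by linarith
  define \<phi> where "\<phi> r = (N r)\<^sup>2 / 2 - r * (c - k)" for r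
  have "\<phi> t \<le> \<phi> s"
  proof (rule abs_continuous_nonincreasing[OF st(2), where w="\<lambda>r. M * w r + \<bar>c - k\<bar>"])
    have const: "set_integrable lborel {x..y} (\<lambda>r. \<bar>c - k\<bar>)" for x y :: real
      unfolding set_integrable_def
      by (auto intro!: integrable_real_indicator simp: emeasure_lborel_Icc_eq)
    show "set_integrable lborel {s..t} (\<lambda>r. M * w r + \<bar>c - k\<bar>)"
      using w(1) const by (intro set_integral_add set_integrable_mult_right)  auto
    fix x y assume xy: "s \<le> x" "x \<le> y" "y \<le> t"
    have "(N y)\<^sup>2 / 2 - (N x)\<^sup>2 / 2 = (N y + N x) / 2 * (N y - N x)" by (simp add: field_simps power2_eq_square)
    also have "\<dots> \<le> M * \<bar>N y - N x\<bar>"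
    proof -
      have "(N y + N x) / 2 * (N y - N x) \<le> (N y + N x) / 2 * \<bar>N y - N x\<bar>"
        using N0[of x] N0[of y] by (intro mult_left_mono) auto
      also have "\<dots> \<le> M * \<bar>N y - N x\<bar>" using NM[of x] NM[of y] xy by (intro mult_right_mono) auto
      finally show ?thesis .
    qed
    also have "\<dots> \<le> M * (LINT r:{x..y}|lborel. w r)"
      using M0 N_diff[of x y] w(2)[of x y] xy st by (intro mult_left_mono) auto
    finally have 1: "(N y)\<^sup>2 / 2 - (N x)\<^sup>2 / 2 \<le> M * (LINT r:{x..y}|lborel. w r)" .
    have "x * (c - k) - y * (c - k) = (y - x) * (- (c - k))" by (simp add: algebra_simps)
    also have "\<dots> \<le> (y - x) * \<bar>c - k\<bar>" using xy by (intro mult_left_mono) auto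
    finally have 2: "x * (c - k) - y * (c - k) \<le> (y - x) * \<bar>c - k\<bar>" .
    have "(LINT r:{x..y}|lborel. M * w r + \<bar>c - k\<bar>) = (LINT r:{x..y}|lborel. M * w r) + (LINT r:{x..y}|lborel. \<bar>c - k\<bar>)"
      using sub[of x y] const xy by (intro set_integral_add set_integrable_mult_right) auto
    also have "\<dots> = M * (LINT r:{x..y}|lborel. w r) + (y - x) * \<bar>c - k\<bar>"
      using xy by (simp add: set_lebesgue_integral_def)
    finally show "\<phi> y - \<phi> x \<le> (LINT r:{x..y}|lborel. M * w r + \<bar>c - k\<bar>)"
      using 1 2 by (simp add: \<phi>_def)
  next
    have "AE r in lborel. 0 < r \<longrightarrow> (\<exists>\<xi>\<in>L2 m. l2_has_derivative m u \<xi> r \<and> (\<lambda>x. - \<xi> x) \<in> subdifferential m \<Phi> (u r))"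
      using curve by (simp add: gradient_curve_def)
    then show "AE r in lborel. s < r \<and> r < t \<longrightarrow> (\<exists>D\<le>0. (\<phi> has_real_derivative D) (at r))"
    proof eventually_elim
      fix r assume ex: "0 < r \<longrightarrow> (\<exists>\<xi>\<in>L2 m. l2_has_derivative m u \<xi> r \<and> (\<lambda>x. - \<xi> x) \<in> subdifferential m \<Phi> (u r))"
      show "s < r \<and> r < t \<longrightarrow> (\<exists>D\<le>0. (\<phi> has_real_derivative D) (at r))"
      proof
        assume r: "s < r \<and> r < t"
        then have r0: "0 < r" using st by simp
        obtain \<xi> where \<xi>: "\<xi> \<in> L2 m" "l2_has_derivative m u \<xi> r" "(\<lambda>x. - \<xi> x) \<in> subdifferential m \<Phi> (u r)"
          using ex r0 by blast
        have "enn2ereal (\<Phi> (u r)) + ereal (\<integral>x. - \<xi> x * (v x - u r x) \<partial>m) \<le> enn2ereal (\<Phi> v)"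
          using \<xi>(3) v(1) by (auto simp: subdifferential_def)
        also have "\<dots> \<le> enn2ereal (ennreal c)" using v(2) by (simp add: less_eq_ennreal.rep_eq)
        also have "\<dots> = ereal c" using ck by (simp add: enn2ereal_ennreal)
        finally have A: "enn2ereal (\<Phi> (u r)) + ereal (\<integral>x. - \<xi> x * (v x - u r x) \<partial>m) \<le> ereal c" .
        have "enn2ereal (ennreal k) \<le> enn2ereal (\<Phi> (u r))" using lower[of r] r by (simp add: less_eq_ennreal.rep_eq)
        then have "ereal k \<le> enn2ereal (\<Phi> (u r))" using ck by (simp add: enn2ereal_ennreal)
        then have "ereal k + ereal (\<integral>x. - \<xi> x * (v x - u r x) \<partial>m) \<le> ereal c"
          using A by (meson add_right_mono order_trans)
        then have "k + (\<integral>x. - \<xi> x * (v x - u r x) \<partial>m) \<le> c" by simp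
        moreover have "(\<integral>x. - \<xi> x * (v x - u r x) \<partial>m) = (\<integral>x. \<xi> x * (u r x - v x) \<partial>m)"
          by (intro Bochner_Integration.integral_cong) (auto simp: algebra_simps)
        ultimately have D: "(\<integral>x. \<xi> x * (u r x - v x) \<partial>m) - (c - k) \<le> 0" by simp
        have "((\<lambda>s. (N s)\<^sup>2 / 2) has_real_derivative (\<integral>x. \<xi> x * (u r x - v x) \<partial>m)) (at r)"
          unfolding N_def by (rule half_square_dist_derivative[OF u_L2 v(1) r0 \<xi>(2)])
        then have "(\<phi> has_real_derivative (\<integral>x. \<xi> x * (u r x - v x) \<partial>m) - (c - k)) (at r)"
          unfolding \<phi>_def[abs_def]
          by (rule DERIV_diff) (auto intro!: derivative_eq_intros)
        then show "\<exists>D\<le>0. (\<phi> has_real_derivative D) (at r)" using D by blast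
      qed
    qed
  qed
  then show ?thesis by (simp add: \<phi>_def N_def algebra_simps)
qed

lemma continuous_at:
  assumes "0 \<le> t" "0 < \<delta>"
  shows "\<exists>\<eta>>0. \<forall>s\<ge>0. \<bar>s - t\<bar> < \<eta> \<longrightarrow> l2dist m (u s) (u t) < \<delta>"
proof -
  have "((\<lambda>s. l2dist m (u s) (u t)) \<longlongrightarrow> 0) (at t within {0..})"
    using curve assms by (simp add: gradient_curve_def l2_tendsto_def)
  then have "\<forall>\<^sub>F s in at t within {0..}. l2dist m (u s) (u t) < \<delta>"
    using assms by (intro order_tendstoD(2))
  then obtain \<eta> where \<eta>: "\<eta> > 0" "\<forall>s\<in>{0..}. s \<noteq> t \<and> dist s t < \<eta> \<longrightarrow> l2dist m (u s) (u t) < \<delta>"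
    unfolding eventually_at by blast
  have "l2dist m (u s) (u t) < \<delta>" if "0 \<le> s" "\<bar>s - t\<bar> < \<eta>" for s
    using \<eta>(2) that assms by (cases "s = t") (auto simp: dist_real_def)
  then show ?thesis using \<eta>(1) by blast
qed

lemma lsc_real:
  assumes "0 \<le> t" "\<And>\<delta>. 0 < \<delta> \<Longrightarrow> \<exists>s\<ge>0. l2dist m (u s) (u t) < \<delta> \<and> \<Phi> (u s) \<le> c"
  shows "\<Phi> (u t) \<le> c"
proof -
  have "\<forall>\<delta>>0. \<exists>g\<in>L2 m. l2dist m g (u t) < \<delta> \<and> \<Phi> g \<le> c"
    using assms(2) u_L2 by meson
  then show ?thesis using lsc u_L2[OF assms(1)] unfolding l2_lsc_def by blast
qed

text \<open>If a level c were exceeded at time t, let q be the last time at which it is respected,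
  which exists by lower semicontinuity. From q on the energy is at least c, and \<open>evi\<close>
  tested against \<open>u q\<close> itself shows that the curve has not moved.\<close>

lemma nonincreasing:
  assumes st: "0 < s" "s \<le> t"
  shows "\<Phi> (u t) \<le> \<Phi> (u s)"
proof (rule dense_ge)
  fix c' assume c': "\<Phi> (u s) < c'"
  show "\<Phi> (u t) \<le> c'"
  proof (rule ccontr)
    assume no: "\<not> \<Phi> (u t) \<le> c'"
    then have "c' < top" using top.not_eq_extremum by fastforce
    then obtain c where c: "c' = ennreal c" "0 \<le> c" by (cases c') auto
    define A where "A = {r. s \<le> r \<and> r \<le> t \<and> \<Phi> (u r) \<le> ennreal c}"
    define q where "q = Sup A"
    have sA: "s \<in> A" using c' c st by (simp add: A_def)
    have bdd: "bdd_above A" by (auto simp: A_def intro: bdd_aboveI[of _ t])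
    have sq: "s \<le> q" unfolding q_def by (rule cSup_upper[OF sA bdd])
    have qt: "q \<le> t" unfolding q_def by (rule cSup_least) (use sA in \<open>auto simp: A_def\<close>)
    have q: "\<Phi> (u q) \<le> ennreal c"
    proof (rule lsc_real)
      show "0 \<le> q" using sq st by simp
      fix \<delta> :: real assume "0 < \<delta>"
      then obtain \<eta> where \<eta>: "\<eta> > 0" "\<forall>s\<ge>0. \<bar>s - q\<bar> < \<eta> \<longrightarrow> l2dist m (u s) (u q) < \<delta>"
        using continuous_at[of q \<delta>] sq st by auto
      obtain r where r: "r \<in> A" "q - \<eta> < r" using less_cSup_iff[of A "q - \<eta>"] sA bdd \<eta>(1) unfolding q_def by auto
      have "r \<le> q" unfolding q_def by (rule cSup_upper[OF r(1) bdd])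
      then have "l2dist m (u r) (u q) < \<delta>" using \<eta>(2) r st by (auto simp: A_def)
      then show "\<exists>s\<ge>0. l2dist m (u s) (u q) < \<delta> \<and> \<Phi> (u s) \<le> ennreal c"
        using r st by (intro exI[of _ r]) (auto simp: A_def)
    qed
    have "(l2dist m (u t) (u q))\<^sup>2 / 2 \<le> (l2dist m (u q) (u q))\<^sup>2 / 2 + (t - q) * (c - c)"
    proof (rule evi[OF _ qt _ q c(2) c(2)])
      show "0 < q" "u q \<in> L2 m" using sq st u_L2 by auto
      fix r assume r: "q < r" "r < t"
      then have "r \<notin> A" using cSup_upper[OF _ bdd, of r] by (auto simp: q_def)
      then show "ennreal c \<le> \<Phi> (u r)" using r sq by (auto simp: A_def)
    qed
    then have "l2dist m (u t) (u q) = 0" by simp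
    \<comment> \<open>Zero distance identifies the functions only almost everywhere; lower
      semicontinuity carries the energy bound over.\<close>
    then have "\<Phi> (u t) \<le> ennreal c"
      using q sq st l2norm_commute[of m "u t" "u q"] by (intro lsc_real) (auto intro!: exI[of _ q])
    then show False using no c by simp
  qed
qed

text \<open>The energy is finite at almost every time by the subdifferential condition, hence at
  some earlier time, and it does not increase.\<close>

lemma finite_energy:
  assumes "0 < t" shows "\<Phi> (u t) < top"
proof -
  have "AE r in lborel. 0 < r \<longrightarrow> (\<exists>\<xi>\<in>L2 m. l2_has_derivative m u \<xi> r \<and> (\<lambda>x. - \<xi> x) \<in> subdifferential m \<Phi> (u r))"
    using curve by (simp add: gradient_curve_def)
  then have "AE r in lborel. 0 < r \<longrightarrow> \<Phi> (u r) < top"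
    by eventually_elim (auto simp: subdifferential_def energy_domain_def)
  then obtain N where N: "N \<in> null_sets lborel" "{r \<in> space lborel. \<not> (0 < r \<longrightarrow> \<Phi> (u r) < top)} \<subseteq> N"
    unfolding eventually_ae_filter by blast
  have "\<not> {0<..<t} \<subseteq> N"
  proof
    assume "{0<..<t} \<subseteq> N"
    then have "emeasure lborel {0<..<t} \<le> emeasure lborel N" using N by (intro emeasure_mono) auto
    then show False using N assms by (simp add: null_sets_def)
  qed
  then obtain r where "r \<in> {0<..<t}" and rN: "r \<notin> N" by blast
  then have r: "0 < r" "r < t" by auto
  have "\<Phi> (u r) < top" using N(2) r rN by auto
  then show ?thesis using nonincreasing[of r t] r by auto
qed

definition E :: "real \<Rightarrow> real" where "E t = enn2real (\<Phi> (u t))"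

lemma E: "0 < t \<Longrightarrow> \<Phi> (u t) = ennreal (E t)" "0 \<le> E t"
  using finite_energy by (auto simp: E_def)

text \<open>Absolute continuity holds only away from 0, so \<open>evi\<close> with k = 0 is applied
  from a positive time that then tends to 0.\<close>

lemma evi_0:
  assumes "0 \<le> t" and v: "v \<in> L2 m" "\<Phi> v \<le> ennreal c" and c: "0 \<le> c"
  shows "(l2dist m (u t) v)\<^sup>2 / 2 \<le> (l2dist m (u 0) v)\<^sup>2 / 2 + t * c"
proof (cases "t = 0")
  case False
  then have t: "0 < t" using assms by simp
  have lim: "((\<lambda>s. l2dist m (u s) v) \<longlongrightarrow> l2dist m (u 0) v) (at_right 0)"
  proof (rule l2_tendsto_norm)
    have "l2_tendsto m u (u 0) (at_right 0)"
      using curve unfolding gradient_curve_def by (auto simp: at_within_Ici_at_right)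
    then show "l2_tendsto m (\<lambda>s x. u s x - v x) (\<lambda>x. u 0 x - v x) (at_right 0)"
      unfolding l2_tendsto_def using v(1) by (auto elim!: eventually_mono intro: L2_diff)
  qed
  have "((\<lambda>s. (l2dist m (u s) v)\<^sup>2 / 2 + (t - s) * c) \<longlongrightarrow> (l2dist m (u 0) v)\<^sup>2 / 2 + (t - 0) * c) (at_right 0)"
    by (intro tendsto_intros lim) auto
  moreover have "\<forall>\<^sub>F s in at_right 0. (l2dist m (u t) v)\<^sup>2 / 2 \<le> (l2dist m (u s) v)\<^sup>2 / 2 + (t - s) * c"
    unfolding eventually_at_right_field
    using evi[of _ t v c 0] v c t by (intro exI[of _ t]) auto
  ultimately show ?thesis by (intro tendsto_lowerbound[where F="at_right 0"]) auto
qed simp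

lemma norm_nonincreasing:
  assumes "0 \<le> t" "\<Phi> (\<lambda>x. 0) = 0"
  shows "l2norm m (u t) \<le> l2norm m (u 0)"
proof -
  have "(l2norm m (u t))\<^sup>2 / 2 \<le> (l2norm m (u 0))\<^sup>2 / 2"
    using evi_0[OF assms(1) L2_zero, of 0] assms(2) by simp
  then show ?thesis using power2_le_imp_le[of "l2norm m (u t)" "l2norm m (u 0)"] by simp
qed

end

text \<open>One time step for two flows: the curve \<open>u'\<close> is tested against an approximation \<open>w\<close> of \<open>u a\<close>, and \<open>u\<close>
  against \<open>u' b\<close>; thanks to \<open>\<Phi> \<le> \<Phi>'\<close> the energies of \<open>u'\<close> drop out.\<close>

lemma flow_step:
  assumes "gradient_flow m \<Phi> f0 u" "gradient_flow m \<Phi>' f0' u'"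
    and le: "\<forall>f\<in>L2 m. \<Phi> f \<le> \<Phi>' f" and ab: "0 < a" "a \<le> b"
    and w: "w \<in> L2 m" "\<Phi>' w \<le> ennreal (gradient_flow.E \<Phi> u a + e)" "l2dist m w (u a) \<le> e"
    and R: "l2dist m (u' b) w \<le> R" "l2dist m (u' a) (u a) \<le> R"
  shows "(l2dist m (u b) (u' b))\<^sup>2 / 2 \<le> (l2dist m (u a) (u' a))\<^sup>2 / 2
     + (b - a) * (gradient_flow.E \<Phi> u a - gradient_flow.E \<Phi> u b) + ((b - a) * e + 2 * e * R + e\<^sup>2)"
proof -
  interpret A: gradient_flow m \<Phi> f0 u by fact
  interpret B: gradient_flow m \<Phi>' f0' u' by fact
  have e0: "0 \<le> e" using w(3) l2norm_nonneg order_trans by blast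
  have b0: "0 < b" using ab by simp
  have L: "u a \<in> L2 m" "u b \<in> L2 m" "u' a \<in> L2 m" "u' b \<in> L2 m"
    using A.u_L2 B.u_L2 ab by auto
  have "\<Phi> (u' b) \<le> \<Phi>' (u' b)" using le L(4) by blast
  then have le': "\<Phi> (u' b) \<le> ennreal (B.E b)" using B.E(1)[OF b0] by simp
  \<comment> \<open>By monotonicity the energy at the right endpoint is a lower bound on the whole
    interval.\<close>
  have 1: "(l2dist m (u' b) w)\<^sup>2 / 2 \<le> (l2dist m (u' a) w)\<^sup>2 / 2 + (b - a) * (A.E a + e - B.E b)"
  proof (rule B.evi[OF ab w(1,2)])
    fix r assume "a < r" "r < b"
    then show "ennreal (B.E b) \<le> \<Phi>' (u' r)" using B.nonincreasing[of r b] B.E(1)[OF b0] ab by simp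
  qed (use A.E(2) B.E(2) e0 in auto)
  have 2: "(l2dist m (u b) (u' b))\<^sup>2 / 2 \<le> (l2dist m (u a) (u' b))\<^sup>2 / 2 + (b - a) * (B.E b - A.E b)"
  proof (rule A.evi[OF ab L(4) le'])
    fix r assume "a < r" "r < b"
    then show "ennreal (A.E b) \<le> \<Phi> (u r)" using A.nonincreasing[of r b] A.E(1)[OF b0] ab by simp
  qed (use A.E(2) B.E(2) in auto)
  have sq: "x\<^sup>2 / 2 \<le> y\<^sup>2 / 2 + e * R + e\<^sup>2 / 2" if "x \<le> y + e" "y \<le> R" "0 \<le> x" "0 \<le> y" for x y :: real
  proof -
    have "x\<^sup>2 \<le> (y + e)\<^sup>2" using that by (intro power_mono) auto
    also have "\<dots> = y\<^sup>2 + 2 * (e * y) + e\<^sup>2" by (simp add: power2_sum algebra_simps)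
    also have "\<dots> \<le> y\<^sup>2 + 2 * (e * R) + e\<^sup>2" using that(2) e0 by (simp add: mult_left_mono)
    finally show ?thesis by simp
  qed
  have 3: "(l2dist m (u a) (u' b))\<^sup>2 / 2 \<le> (l2dist m (u' b) w)\<^sup>2 / 2 + e * R + e\<^sup>2 / 2"
    by (rule sq) (use l2norm_triangle[OF L(4) w(1) L(1)] w(3) R(1) l2norm_commute[of m "u a" "u' b"] in auto)
  have 4: "(l2dist m (u' a) w)\<^sup>2 / 2 \<le> (l2dist m (u' a) (u a))\<^sup>2 / 2 + e * R + e\<^sup>2 / 2"
    by (rule sq) (use l2norm_triangle[OF L(3,1) w(1)] w(3) R(2) l2norm_commute[of m w "u a"] in auto)
  have "(b - a) * (A.E a + e - B.E b) + (b - a) * (B.E b - A.E b) = (b - a) * (A.E a - A.E b) + (b - a) * e"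
    by (simp add: algebra_simps)
  then show ?thesis using 1 2 3 4 l2norm_commute[of m "u' a" "u a"] by simp
qed

text \<open>The energy differences telescope to at most \<tau> times the initial energy, which is
  small for a fine partition. The other errors are proportional to the number n of steps and are
  made small by e after n is fixed.\<close>

lemma flow_partition:
  fixes s \<tau> e R :: real and n :: nat and w :: "nat \<Rightarrow> 'a \<Rightarrow> real"
  assumes "gradient_flow m \<Phi> f0 u" "gradient_flow m \<Phi>' f0' u'"
    and le: "\<forall>f\<in>L2 m. \<Phi> f \<le> \<Phi>' f" and s: "0 < s" and \<tau>: "0 \<le> \<tau>"
    and w: "\<And>k. k < n \<Longrightarrow> w k \<in> L2 m \<and> \<Phi>' (w k) \<le> ennreal (gradient_flow.E \<Phi> u (s + real k * \<tau>) + e) \<and>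
      l2dist m (w k) (u (s + real k * \<tau>)) \<le> e"
    and R: "\<And>k. k < n \<Longrightarrow> l2dist m (u' (s + real (Suc k) * \<tau>)) (w k) \<le> R"
      "\<And>k. k < n \<Longrightarrow> l2dist m (u' (s + real k * \<tau>)) (u (s + real k * \<tau>)) \<le> R"
  shows "(l2dist m (u (s + real n * \<tau>)) (u' (s + real n * \<tau>)))\<^sup>2 / 2 \<le> (l2dist m (u s) (u' s))\<^sup>2 / 2
     + \<tau> * gradient_flow.E \<Phi> u s + real n * (\<tau> * e + 2 * e * R + e\<^sup>2)"
proof -
  interpret A: gradient_flow m \<Phi> f0 u by fact
  have "(l2dist m (u (s + real k * \<tau>)) (u' (s + real k * \<tau>)))\<^sup>2 / 2 \<le> (l2dist m (u s) (u' s))\<^sup>2 / 2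
     + \<tau> * (A.E s - A.E (s + real k * \<tau>)) + real k * (\<tau> * e + 2 * e * R + e\<^sup>2)" if "k \<le> n" for k
    using that
  proof (induction k)
    case (Suc k)
    have k: "k < n" using Suc by simp
    have pos: "0 < s + real k * \<tau>" using s \<tau> by (simp add: add_pos_nonneg)
    have diff: "s + real (Suc k) * \<tau> - (s + real k * \<tau>) = \<tau>" by (simp add: algebra_simps)
    have mono: "s + real k * \<tau> \<le> s + real (Suc k) * \<tau>" using \<tau> by (simp add: mult_right_mono)
    have "(l2dist m (u (s + real (Suc k) * \<tau>)) (u' (s + real (Suc k) * \<tau>)))\<^sup>2 / 2 \<le>
       (l2dist m (u (s + real k * \<tau>)) (u' (s + real k * \<tau>)))\<^sup>2 / 2
        + (s + real (Suc k) * \<tau> - (s + real k * \<tau>)) * (A.E (s + real k * \<tau>) - A.E (s + real (Suc k) * \<tau>))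
        + ((s + real (Suc k) * \<tau> - (s + real k * \<tau>)) * e + 2 * e * R + e\<^sup>2)"
      using w[OF k] R[OF k] by (intro flow_step[OF assms(1,2) le, of "s + real k * \<tau>" "s + real (Suc k) * \<tau>" "w k"] pos mono) auto
    then have "(l2dist m (u (s + real (Suc k) * \<tau>)) (u' (s + real (Suc k) * \<tau>)))\<^sup>2 / 2 \<le>
       (l2dist m (u (s + real k * \<tau>)) (u' (s + real k * \<tau>)))\<^sup>2 / 2
        + \<tau> * (A.E (s + real k * \<tau>) - A.E (s + real (Suc k) * \<tau>)) + (\<tau> * e + 2 * e * R + e\<^sup>2)"
      unfolding diff .
    moreover have "\<tau> * (A.E s - A.E (s + real k * \<tau>)) + \<tau> * (A.E (s + real k * \<tau>) - A.E (s + real (Suc k) * \<tau>)) = \<tau> * (A.E s - A.E (s + real (Suc k) * \<tau>))"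
      by (simp add: right_diff_distrib)
    moreover have "real (Suc k) * (\<tau> * e + 2 * e * R + e\<^sup>2) = real k * (\<tau> * e + 2 * e * R + e\<^sup>2) + (\<tau> * e + 2 * e * R + e\<^sup>2)"
      by (simp add: distrib_right)
    ultimately show ?case using Suc by linarith
  qed simp
  from this[of n] have "(l2dist m (u (s + real n * \<tau>)) (u' (s + real n * \<tau>)))\<^sup>2 / 2 \<le> (l2dist m (u s) (u' s))\<^sup>2 / 2
     + \<tau> * (A.E s - A.E (s + real n * \<tau>)) + real n * (\<tau> * e + 2 * e * R + e\<^sup>2)" by simp
  moreover have "\<tau> * (A.E s - A.E (s + real n * \<tau>)) \<le> \<tau> * A.E s" using \<tau> A.E(2) by (intro mult_left_mono) auto
  ultimately show ?thesis by linarith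
qed

section \<open>Convergence of the gradient curves\<close>

context monotone_approximation
begin

lemma Ch_lsc: "l2_lsc m Ch"
  unfolding l2_lsc_def using cheeger_lsc[OF prob sets_m] by blast

lemma Chi_l2_lsc: "i \<in> I \<Longrightarrow> l2_lsc m (Chi i)"
  unfolding l2_lsc_def using Chi_lsc by blast

lemma Chi_zero: assumes "i \<in> I" shows "Chi i (\<lambda>x. 0) = 0"
proof -
  have lip: "lip_bi i (\<lambda>x. 0)" unfolding lipschitz_wrt_def by (auto simp: bounded_iff intro: exI[of _ 0])
  have "slope_i i (\<lambda>x. 0) x \<le> 0" for x
    using lip_a_le_const[of "topspace T" "\<lambda>x. 0" 0 "dist_i i"] by simp
  then have "slope_i i (\<lambda>x. 0) = (\<lambda>x. 0)"
    using lip_a_nonneg[of "topspace T" "dist_i i" "\<lambda>x. 0"] by (intro ext) (meson order_antisym)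
  then show ?thesis using Chi_lip_bi[OF assms lip] by simp
qed

lemma Ch_zero: "Ch (\<lambda>x. 0) = 0"
proof -
  obtain i where "i \<in> I" using directed by (auto simp: directed_set_def)
  then show ?thesis using Ch_le_Chi[OF _ L2_zero] Chi_zero by (metis le_zero_eq)
qed

lemma directed_trans: "i \<in> I \<Longrightarrow> j \<in> I \<Longrightarrow> k \<in> I \<Longrightarrow> le i j \<Longrightarrow> le j k \<Longrightarrow> le i k"
  using directed unfolding directed_set_def by meson

text \<open>The order of choices matters: a regularised starting point z, a short time s, the
  partition, the precision e, and only then the index.\<close>

proposition flows_converge:
  fixes \<rho>0 :: "'a \<Rightarrow> real" and \<rho>0i :: "'i \<Rightarrow> 'a \<Rightarrow> real" and \<rho>i :: "'i \<Rightarrow> real \<Rightarrow> 'a \<Rightarrow> real"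
  assumes \<rho>0: "\<rho>0 \<in> borel_measurable m"
    and proj: "\<forall>i\<in>I. is_l2_projection m (l2_closure m (energy_domain m (Chi i))) \<rho>0 (\<rho>0i i)"
    and flow_i: "\<forall>i\<in>I. gradient_curve m (Chi i) (\<rho>0i i) (\<rho>i i)"
    and flow: "gradient_curve m Ch \<rho>0 \<rho>" and t: "0 \<le> t"
  shows "l2_tendsto m (\<lambda>i. \<rho>i i t) (\<rho> t) (net_filter I le)"
proof -
  interpret A: gradient_flow m Ch \<rho>0 \<rho>
    using flow Ch_lsc by unfold_locales
  have B: "gradient_flow m (Chi i) (\<rho>0i i) (\<rho>i i)" if "i \<in> I" for i
    using flow_i Chi_l2_lsc that by unfold_locales auto
  have \<rho>L: "\<rho> r \<in> L2 m" if "0 \<le> r" for r using A.u_L2 that .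
  have \<rho>iL: "\<rho>i i r \<in> L2 m" if "i \<in> I" "0 \<le> r" for i r using gradient_flow.u_L2[OF B] that .
  have AE0: "AE x in m. \<rho> 0 x = \<rho>0 x" using flow by (simp add: gradient_curve_def)
  have \<rho>0L: "\<rho>0 \<in> L2 m" by (rule L2_AE_cong[OF \<rho>L \<rho>0 AE0]) simp
  \<comment> \<open>The starting point need not have finite energy, so a point of the curve at a
    small positive time is recovered instead.\<close>
  have start: "\<exists>c\<ge>0. \<exists>w\<in>L2 m. \<exists>i1\<in>I. l2dist m w (\<rho> 0) < \<delta> \<and> (\<forall>i\<in>I. le i1 i \<longrightarrow> Chi i w \<le> ennreal c)"
    if \<delta>: "0 < \<delta>" for \<delta>
  proof -
    obtain \<eta> where \<eta>: "\<eta> > 0" "\<forall>s\<ge>0. \<bar>s - 0\<bar> < \<eta> \<longrightarrow> l2dist m (\<rho> s) (\<rho> 0) < \<delta> / 2"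
      using A.continuous_at[of 0 "\<delta> / 2"] \<delta> by auto
    define s where "s = \<eta> / 2"
    have s: "0 < s" "l2dist m (\<rho> s) (\<rho> 0) < \<delta> / 2" using \<eta> by (auto simp: s_def)
    have "Ch (\<rho> s) < ennreal (A.E s + 1)" using A.E(1)[OF s(1)] A.E(2)[of s] by (simp add: ennreal_less_iff)
    then obtain i1 w where w: "i1 \<in> I" "w \<in> L2 m" "l2dist m w (\<rho> s) < \<delta> / 2"
      "\<forall>i\<in>I. le i1 i \<longrightarrow> Chi i w \<le> ennreal (A.E s + 1)"
      using Chi_recovery[of "\<rho> s" "A.E s + 1" "\<delta> / 2"] \<rho>L s \<delta> by auto
    have "l2dist m w (\<rho> 0) < \<delta>"
      using l2norm_triangle[OF w(2) \<rho>L \<rho>L, of s 0] s w by simp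
    then show ?thesis using w A.E(2)[of s] by (intro exI[of _ "A.E s + 1"]) auto
  qed
  \<comment> \<open>The projection is a nearest point, so any w in the domain of the energy bounds
    its distance to \<open>\<rho>0\<close>.\<close>
  have initial: "l2dist m (\<rho>i i 0) (\<rho> 0) < \<delta>"
    if w: "w \<in> L2 m" "l2dist m w (\<rho> 0) < \<delta>" "Chi i w \<le> ennreal c" and i: "i \<in> I" for w \<delta> i c
  proof -
    have "w \<in> energy_domain m (Chi i)" using w(1,3) by (auto simp: energy_domain_def intro: le_less_trans)
    then have "w \<in> l2_closure m (energy_domain m (Chi i))"
      unfolding l2_closure_def using w(1) by (auto intro!: bexI[of _ w])
    then have p: "l2dist m \<rho>0 (\<rho>0i i) \<le> l2dist m \<rho>0 w" "\<rho>0i i \<in> L2 m"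
      using proj i unfolding is_l2_projection_def l2_closure_def by auto
    have AEi: "AE x in m. \<rho>i i 0 x = \<rho>0i i x" using flow_i i by (simp add: gradient_curve_def)
    have "l2dist m (\<rho>i i 0) (\<rho> 0) = l2dist m (\<rho>0i i) \<rho>0"
    proof (rule l2norm_AE_cong)
      show "AE x in m. \<rho>i i 0 x - \<rho> 0 x = \<rho>0i i x - \<rho>0 x" using AEi AE0 by eventually_elim simp
    qed (intro borel_measurable_diff L2_measurable \<rho>iL i \<rho>L p(2) \<rho>0L order_refl)+
    also have "\<dots> \<le> l2dist m \<rho>0 w" using p(1) l2norm_commute[of m \<rho>0 "\<rho>0i i"] by simp
    also have "\<dots> = l2dist m w (\<rho> 0)"
      unfolding l2norm_commute[of m \<rho>0 w]
    proof (rule l2norm_AE_cong)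
      show "AE x in m. w x - \<rho>0 x = w x - \<rho> 0 x" using AE0 by eventually_elim simp
    qed (intro borel_measurable_diff L2_measurable w(1) \<rho>L \<rho>0L order_refl)+
    finally show ?thesis using w(2) by simp
  qed
  have main: "\<exists>i0\<in>I. \<forall>i\<in>I. le i0 i \<longrightarrow> l2dist m (\<rho>i i t) (\<rho> t) < \<epsilon>" if \<epsilon>: "0 < \<epsilon>" for \<epsilon>
  proof -
    define \<delta> where "\<delta> = \<epsilon> / 6"
    have \<delta>: "0 < \<delta>" using \<epsilon> by (simp add: \<delta>_def)
    obtain c z i1 where z: "0 \<le> c" "z \<in> L2 m" "i1 \<in> I" "l2dist m z (\<rho> 0) < \<delta>"
      "\<forall>i\<in>I. le i1 i \<longrightarrow> Chi i z \<le> ennreal c" using start[OF \<delta>] by blast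
    have init: "l2dist m (\<rho>i i 0) (\<rho> 0) < \<delta>" if "i \<in> I" "le i1 i" for i
      using initial[OF z(2,4)] z(5) that by blast
    show ?thesis
    proof (cases "t = 0")
      case True
      have "l2dist m (\<rho>i i t) (\<rho> t) < \<epsilon>" if "i \<in> I" "le i1 i" for i
        using init[OF that] \<epsilon> True by (simp add: \<delta>_def)
      then show ?thesis using z(3) by blast
    next
      case False
      then have t0: "0 < t" using t by simp
      obtain \<eta> where \<eta>: "\<eta> > 0" "\<forall>s\<ge>0. \<bar>s - 0\<bar> < \<eta> \<longrightarrow> l2dist m (\<rho> s) (\<rho> 0) < \<delta>"
        using A.continuous_at[of 0 \<delta>] \<delta> by auto
      define s where "s = min (t / 2) (min (\<eta> / 2) (\<delta>\<^sup>2 / (2 * (c + 1))))"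
      have s: "0 < s" "s < t" "s < \<eta>" using t0 \<eta> \<delta> z(1) by (auto simp: s_def)
      have sc: "s * c \<le> \<delta>\<^sup>2 / 2"
      proof -
        have "s * c \<le> \<delta>\<^sup>2 / (2 * (c + 1)) * (c + 1)" using s z(1) by (intro mult_mono) (auto simp: s_def)
        also have "\<dots> = \<delta>\<^sup>2 / 2" using z(1) by (simp add: field_simps)
        finally show ?thesis .
      qed
      have Ds: "l2dist m (\<rho> s) (\<rho>i i s) \<le> 5 * \<delta>" if i: "i \<in> I" "le i1 i" for i
      proof -
        interpret Bi: gradient_flow m "Chi i" "\<rho>0i i" "\<rho>i i" by (rule B[OF i(1)])
        have "l2dist m (\<rho>i i 0) z \<le> 2 * \<delta>"
          using l2norm_triangle[OF \<rho>iL[OF i(1)] \<rho>L z(2), of 0 0] init[OF i] z(4) l2norm_commute[of m z "\<rho> 0"] by simp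
        then have "(l2dist m (\<rho>i i 0) z)\<^sup>2 \<le> (2 * \<delta>)\<^sup>2" by (intro power_mono) auto
        moreover have "(l2dist m (\<rho>i i s) z)\<^sup>2 / 2 \<le> (l2dist m (\<rho>i i 0) z)\<^sup>2 / 2 + s * c"
          using Bi.evi_0[of s z c] s z i by auto
        moreover have "(2 * \<delta>)\<^sup>2 = 4 * \<delta>\<^sup>2" "(3 * \<delta>)\<^sup>2 = 9 * \<delta>\<^sup>2" "0 \<le> \<delta>\<^sup>2" by (auto simp: power_mult_distrib)
        ultimately have "(l2dist m (\<rho>i i s) z)\<^sup>2 \<le> (3 * \<delta>)\<^sup>2" using sc by linarith
        then have "l2dist m (\<rho>i i s) z \<le> 3 * \<delta>" using \<delta> power2_le_imp_le[of "l2dist m (\<rho>i i s) z" "3 * \<delta>"] by simp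
        moreover have "l2dist m (\<rho> s) z \<le> 2 * \<delta>"
          using l2norm_triangle[OF \<rho>L \<rho>L z(2), of s 0] \<eta>(2)[rule_format, of s] s z(4)
            l2norm_commute[of m z "\<rho> 0"] by simp
        ultimately show ?thesis
          using l2norm_triangle[OF \<rho>L z(2) \<rho>iL[OF i(1)], of s s] s l2norm_commute[of m z "\<rho>i i s"] by simp
      qed
      define n where "n = Suc (nat \<lceil>(t - s) * A.E s / \<delta>\<^sup>2\<rceil>)"
      have n: "(t - s) * A.E s / \<delta>\<^sup>2 \<le> real n" unfolding n_def by linarith
      have n0: "0 < n" by (simp add: n_def)
      define \<tau> where "\<tau> = (t - s) / n"
      have \<tau>: "0 \<le> \<tau>" "s + real n * \<tau> = t" using s n0 by (auto simp: \<tau>_def)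
      have \<tau>E: "\<tau> * A.E s \<le> \<delta>\<^sup>2" using n n0 \<delta> by (simp add: \<tau>_def field_simps)
      \<comment> \<open>Norms do not increase along either flow, so this bounds all distances in the
        partition uniformly in the index.\<close>
      define R where "R = 2 * l2norm m (\<rho> 0) + \<delta> + 1"
      have R0: "0 \<le> R" using \<delta> by (simp add: R_def)
      define W where "W = real n * (\<tau> + 2 * R + 1)"
      have den: "0 < W" unfolding W_def using n0 \<tau> R0 by (intro mult_pos_pos) auto
      define e where "e = min 1 (\<delta>\<^sup>2 / W)"
      have e: "0 < e" "e \<le> 1" using \<delta> den by (auto simp: e_def)
      have rest: "real n * (\<tau> * e + 2 * e * R + e\<^sup>2) \<le> \<delta>\<^sup>2"
      proof -
        have "e\<^sup>2 \<le> e" using e by (simp add: power2_eq_square mult_left_le)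
        then have "real n * (\<tau> * e + 2 * e * R + e\<^sup>2) \<le> real n * (e * (\<tau> + 2 * R + 1))"
          by (intro mult_left_mono) (auto simp: algebra_simps)
        also have "\<dots> = e * W" by (simp add: W_def)
        also have "\<dots> \<le> \<delta>\<^sup>2 / W * W"
          using den by (intro mult_right_mono) (auto simp: e_def)
        also have "\<dots> = \<delta>\<^sup>2" using den by simp
        finally show ?thesis .
      qed
      have pos: "0 < s + real k * \<tau>" for k using s \<tau> by (simp add: add_pos_nonneg)
      have "\<exists>ik w. ik \<in> I \<and> w \<in> L2 m \<and> l2dist m w (\<rho> (s + real k * \<tau>)) < e \<and>
          (\<forall>i\<in>I. le ik i \<longrightarrow> Chi i w \<le> ennreal (A.E (s + real k * \<tau>) + e))" for k
      proof -
        have "Ch (\<rho> (s + real k * \<tau>)) < ennreal (A.E (s + real k * \<tau>) + e)"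
          using A.E(1)[OF pos, of k] A.E(2)[of "s + real k * \<tau>"] e by (simp add: ennreal_less_iff)
        then show ?thesis using Chi_recovery[OF \<rho>L _ e(1), of "s + real k * \<tau>"] pos[of k] by (meson less_imp_le)
      qed
      then obtain ik w where w: "\<And>k. ik k \<in> I" "\<And>k. w k \<in> L2 m"
        "\<And>k. l2dist m (w k) (\<rho> (s + real k * \<tau>)) < e"
        "\<And>k i. i \<in> I \<Longrightarrow> le (ik k) i \<Longrightarrow> Chi i (w k) \<le> ennreal (A.E (s + real k * \<tau>) + e)"
        by metis
      \<comment> \<open>Only the finitely many recovery points of the partition and z have to be
        served.\<close>
      obtain i0 where i0: "i0 \<in> I" "\<forall>i\<in>insert i1 (ik ` {..<n}). le i i0"
        using directed_upper_bound[OF directed, of "insert i1 (ik ` {..<n})"] z(3) w(1) by auto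
      have "l2dist m (\<rho>i i t) (\<rho> t) < \<epsilon>" if i: "i \<in> I" "le i0 i" for i
      proof -
        have le1: "le i1 i" using directed_trans[OF z(3) i0(1) i(1)] i0(2) i(2) by blast
        have lek: "le (ik k) i" if "k < n" for k
          using directed_trans[OF w(1) i0(1) i(1)] i0(2) i(2) that by blast
        interpret Bi: gradient_flow m "Chi i" "\<rho>0i i" "\<rho>i i" by (rule B[OF i(1)])
        have nrm: "l2norm m (\<rho>i i r) \<le> l2norm m (\<rho> 0) + \<delta>" "l2norm m (\<rho> r) \<le> l2norm m (\<rho> 0)" if "0 \<le> r" for r
          using Bi.norm_nonincreasing[OF that Chi_zero[OF i(1)]] A.norm_nonincreasing[OF that Ch_zero]
            l2norm_le_diff[OF \<rho>iL[OF i(1)] \<rho>L, of 0 0] init[OF i(1) le1] by auto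
        have "(l2dist m (\<rho> (s + real n * \<tau>)) (\<rho>i i (s + real n * \<tau>)))\<^sup>2 / 2 \<le>
            (l2dist m (\<rho> s) (\<rho>i i s))\<^sup>2 / 2 + \<tau> * A.E s + real n * (\<tau> * e + 2 * e * R + e\<^sup>2)"
        proof (rule flow_partition[OF A.gradient_flow_axioms Bi.gradient_flow_axioms _ s(1) \<tau>(1)])
          show "\<forall>f\<in>L2 m. Ch f \<le> Chi i f" using Ch_le_Chi[OF i(1)] by blast
        next
          fix k assume k: "k < n"
          show "w k \<in> L2 m \<and> Chi i (w k) \<le> ennreal (A.E (s + real k * \<tau>) + e) \<and>
              l2dist m (w k) (\<rho> (s + real k * \<tau>)) \<le> e"
            using w(2) w(3)[of k] w(4)[OF i(1) lek[OF k]] by simp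
          have r: "0 \<le> s + real k * \<tau>" "0 \<le> s + real (Suc k) * \<tau>" using pos less_imp_le by blast+
          have "l2norm m (w k) \<le> l2norm m (\<rho> 0) + 1"
            using l2norm_le_diff[OF w(2)[of k] \<rho>L[OF r(1)]] w(3)[of k] nrm(2)[OF r(1)] e by linarith
          then show "l2dist m (\<rho>i i (s + real (Suc k) * \<tau>)) (w k) \<le> R"
            using l2norm_triangle[OF \<rho>iL[OF i(1) r(2)] L2_zero w(2)[of k]] nrm(1)[OF r(2)] by (simp add: R_def l2norm_minus)
          show "l2dist m (\<rho>i i (s + real k * \<tau>)) (\<rho> (s + real k * \<tau>)) \<le> R"
            using l2norm_triangle[OF \<rho>iL[OF i(1) r(1)] L2_zero \<rho>L[OF r(1)]] nrm[OF r(1)] by (simp add: R_def l2norm_minus)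
        qed
        moreover have "(l2dist m (\<rho> s) (\<rho>i i s))\<^sup>2 \<le> (5 * \<delta>)\<^sup>2"
          using Ds[OF i(1) le1] by (intro power_mono) auto
        ultimately have "(l2dist m (\<rho> t) (\<rho>i i t))\<^sup>2 / 2 \<le> (5 * \<delta>)\<^sup>2 / 2 + 2 * \<delta>\<^sup>2"
          using \<tau>E rest unfolding \<tau>(2) by linarith
        moreover have "(5 * \<delta>)\<^sup>2 = 25 * \<delta>\<^sup>2" "\<epsilon>\<^sup>2 = 36 * \<delta>\<^sup>2" "0 < \<delta>\<^sup>2" using \<delta> by (auto simp: \<delta>_def power_mult_distrib power_divide)
        ultimately have "(l2dist m (\<rho> t) (\<rho>i i t))\<^sup>2 < \<epsilon>\<^sup>2" by linarith
        then have "l2dist m (\<rho> t) (\<rho>i i t) < \<epsilon>" using \<epsilon> by (intro power2_less_imp_less[of _ \<epsilon>]) auto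
        then show ?thesis using l2norm_commute[of m "\<rho> t"] by simp
      qed
      then show ?thesis using i0(1) by blast
    qed
  qed
  obtain i00 where "i00 \<in> I" using directed by (auto simp: directed_set_def)
  show ?thesis unfolding l2_tendsto_def
  proof (intro conjI \<rho>L t)
    show "\<forall>\<^sub>F i in net_filter I le. \<rho>i i t \<in> L2 m"
      unfolding eventually_net_filter[OF directed] using \<rho>iL t \<open>i00 \<in> I\<close> by blast
    show "((\<lambda>i. l2dist m (\<rho>i i t) (\<rho> t)) \<longlongrightarrow> 0) (net_filter I le)"
    proof (rule tendstoI)
      fix \<epsilon> :: real assume "0 < \<epsilon>"
      then show "\<forall>\<^sub>F i in net_filter I le. dist (l2dist m (\<rho>i i t) (\<rho> t)) 0 < \<epsilon>"
        unfolding eventually_net_filter[OF directed] using main[of \<epsilon>] by (simp add: dist_real_def)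
    qed
  qed
qed

end

section \<open>Minimal relaxed slopes\<close>

text \<open>The sets need not be closed and may have empty intersection, but the infima of the norm
  increase to a limit \<mu>. A midpoint of two near-minimisers stays in its set, so its norm is at
  least the infimum and the parallelogram identity forces the two together.\<close>

lemma minimal_norm_limit:
  fixes S :: "nat \<Rightarrow> ('a \<Rightarrow> real) set"
  assumes prob: "prob_space m" and L: "\<And>n. S n \<subseteq> L2 m" and dec: "decseq S"
    and convex: "\<And>n g h t. \<lbrakk>g \<in> S n; h \<in> S n; 0 \<le> t; t \<le> 1\<rbrakk> \<Longrightarrow> (\<lambda>x. (1 - t) * g x + t * h x) \<in> S n"
    and bound: "\<And>n. \<exists>g\<in>S n. l2norm m g \<le> C"
  obtains G where "G \<in> L2 m"
    "\<forall>\<epsilon>>0. \<exists>n. \<exists>\<eta>>0. \<forall>g\<in>S n. l2norm m g \<le> l2norm m G + \<eta> \<longrightarrow> l2dist m g G < \<epsilon>"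
    "\<forall>n. \<forall>\<eta>>0. \<exists>g\<in>S n. l2norm m g \<le> l2norm m G + \<eta>"
    "(\<forall>n. S n = S 0) \<longrightarrow> (\<forall>g\<in>S 0. l2norm m G \<le> l2norm m g)"
proof -
  define \<nu> where "\<nu> n = (INF g\<in>S n. l2norm m g)" for n
  have bdd: "bdd_below (l2norm m ` S n)" for n by (rule bdd_belowI2[of _ 0]) simp
  have ne: "S n \<noteq> {}" for n using bound by blast
  have \<nu>_le: "\<nu> n \<le> l2norm m g" if "g \<in> S n" for n g unfolding \<nu>_def by (rule cINF_lower[OF bdd that])
  have \<nu>0: "0 \<le> \<nu> n" for n unfolding \<nu>_def by (rule cINF_greatest[OF ne]) simp
  have \<nu>_mono: "incseq \<nu>" unfolding incseq_def
  proof (intro allI impI)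
    fix n k :: nat assume "n \<le> k"
    then have "S k \<subseteq> S n" using dec by (simp add: decseq_def)
    then show "\<nu> n \<le> \<nu> k" unfolding \<nu>_def by (intro cINF_superset_mono ne bdd) auto
  qed
  have "\<nu> n \<le> C" for n using bound[of n] \<nu>_le order_trans by blast
  then obtain \<mu> where \<mu>: "\<nu> \<longlonglongrightarrow> \<mu>" "\<forall>n. \<nu> n \<le> \<mu>" using incseq_convergent[OF \<nu>_mono] by blast
  \<comment> \<open>What the parallelogram identity leaves when both norms are at most \<mu> +
    1/(n+1) and the midpoint has norm at least \<open>\<nu> n\<close>.\<close>
  define \<kappa> where "\<kappa> n = 4 * ((\<mu> + 1 / real (Suc n))\<^sup>2 - (\<nu> n)\<^sup>2)" for n
  have "\<kappa> \<longlonglongrightarrow> 4 * ((\<mu> + 0)\<^sup>2 - \<mu>\<^sup>2)"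
    unfolding \<kappa>_def by (intro tendsto_intros \<mu>(1) LIMSEQ_Suc[OF lim_1_over_n])
  then have \<kappa>: "\<kappa> \<longlonglongrightarrow> 0" by simp
  have near: "(l2dist m g h)\<^sup>2 \<le> \<kappa> n"
    if g: "g \<in> S n" "l2norm m g \<le> \<mu> + 1 / real (Suc n)" and h: "h \<in> S n" "l2norm m h \<le> \<mu> + 1 / real (Suc n)" for g h n
  proof -
    have "(\<lambda>x. (g x + h x) / 2) \<in> S n" using convex[OF g(1) h(1), of "1/2"] by (simp add: add_divide_distrib)
    then have "(\<nu> n)\<^sup>2 \<le> (l2norm m (\<lambda>x. (g x + h x) / 2))\<^sup>2" using \<nu>_le \<nu>0 by (intro power_mono) auto
    moreover have "(l2norm m g)\<^sup>2 \<le> (\<mu> + 1 / real (Suc n))\<^sup>2" "(l2norm m h)\<^sup>2 \<le> (\<mu> + 1 / real (Suc n))\<^sup>2"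
      using g(2) h(2) by (auto intro: power_mono)
    moreover have "g \<in> L2 m" "h \<in> L2 m" using g h L by blast+
    ultimately show ?thesis using l2norm_parallelogram[of g m h] unfolding \<kappa>_def right_diff_distrib by linarith
  qed
  have small: "\<exists>N. \<forall>n\<ge>N. \<kappa> n < \<epsilon>\<^sup>2" if "0 < \<epsilon>" for \<epsilon>
    using order_tendstoD(2)[OF \<kappa>, of "\<epsilon>\<^sup>2"] that by (simp add: eventually_sequentially)
  have "\<exists>g. g \<in> S n \<and> l2norm m g < \<nu> n + 1 / real (Suc n)" for n
    using cINF_less_iff[OF ne bdd, of n "\<nu> n + 1 / real (Suc n)"] unfolding \<nu>_def by auto
  then obtain g where g: "\<And>n. g n \<in> S n" "\<And>n. l2norm m (g n) < \<nu> n + 1 / real (Suc n)" by metis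
  have gS: "g k \<in> S n" "l2norm m (g k) \<le> \<mu> + 1 / real (Suc n)" if "n \<le> k" for n k
  proof -
    show "g k \<in> S n" using g(1)[of k] dec that by (auto simp: decseq_def)
    have "1 / real (Suc k) \<le> 1 / real (Suc n)" using that by (simp add: frac_le)
    then show "l2norm m (g k) \<le> \<mu> + 1 / real (Suc n)" using g(2)[of k] \<mu>(2)[rule_format, of k] by linarith
  qed
  have gL: "g n \<in> L2 m" for n using g(1) L by blast
  have "\<forall>e>0. \<exists>N. \<forall>i\<ge>N. \<forall>j\<ge>N. l2dist m (g i) (g j) < e"
  proof (intro allI impI)
    fix e :: real assume e: "0 < e"
    obtain N where N: "\<forall>n\<ge>N. \<kappa> n < e\<^sup>2" using small[OF e] by blast
    have "l2dist m (g i) (g j) < e" if "i \<ge> N" "j \<ge> N" for i j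
    proof -
      have "(l2dist m (g i) (g j))\<^sup>2 < e\<^sup>2"
        using near[OF gS[OF that(1)] gS[OF that(2)]] N by (meson le_refl order_le_less_trans)
      then show ?thesis using e by (intro power2_less_imp_less[of _ e]) auto
    qed
    then show "\<exists>N. \<forall>i\<ge>N. \<forall>j\<ge>N. l2dist m (g i) (g j) < e" by blast
  qed
  then obtain G where G: "G \<in> L2 m" "(\<lambda>n. l2dist m (g n) G) \<longlonglongrightarrow> 0"
    by (rule L2_complete[OF prob gL])
  have "(\<lambda>n. l2norm m (g n)) \<longlonglongrightarrow> l2norm m G"
    using G gL by (intro l2_tendsto_norm) (simp add: l2_tendsto_def)
  moreover have "(\<lambda>n. l2norm m (g n)) \<longlonglongrightarrow> \<mu>"
  proof (rule tendsto_sandwich[OF _ _ \<mu>(1)])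
    show "\<forall>\<^sub>F n in sequentially. \<nu> n \<le> l2norm m (g n)" using \<nu>_le g(1) by simp
    show "\<forall>\<^sub>F n in sequentially. l2norm m (g n) \<le> \<mu> + 1 / real (Suc n)" using gS(2) by (intro always_eventually) blast
    have "(\<lambda>n. \<mu> + 1 / real (Suc n)) \<longlonglongrightarrow> \<mu> + 0" by (intro tendsto_intros LIMSEQ_Suc[OF lim_1_over_n])
    then show "(\<lambda>n. \<mu> + 1 / real (Suc n)) \<longlonglongrightarrow> \<mu>" by simp
  qed
  ultimately have normG: "l2norm m G = \<mu>" by (rule LIMSEQ_unique)
  show thesis
  proof (rule that[OF G(1)])
    show "\<forall>\<epsilon>>0. \<exists>n. \<exists>\<eta>>0. \<forall>g\<in>S n. l2norm m g \<le> l2norm m G + \<eta> \<longrightarrow> l2dist m g G < \<epsilon>"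
    proof (intro allI impI)
      fix \<epsilon> :: real assume \<epsilon>: "0 < \<epsilon>"
      obtain N1 where N1: "\<forall>n\<ge>N1. \<kappa> n < (\<epsilon> / 2)\<^sup>2" using small[of "\<epsilon> / 2"] \<epsilon> by auto
      obtain N2 where N2: "\<forall>n\<ge>N2. l2dist m (g n) G < \<epsilon> / 2"
        using order_tendstoD(2)[OF G(2), of "\<epsilon> / 2"] \<epsilon> by (auto simp: eventually_sequentially)
      define n where "n = max N1 N2"
      have "l2dist m h G < \<epsilon>" if h: "h \<in> S n" "l2norm m h \<le> l2norm m G + 1 / real (Suc n)" for h
      proof -
        have "(l2dist m h (g n))\<^sup>2 \<le> \<kappa> n" using near[OF h[unfolded normG] gS[OF order_refl]] .
        also have "\<dots> < (\<epsilon> / 2)\<^sup>2" using N1 by (simp add: n_def)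
        finally have "l2dist m h (g n) < \<epsilon> / 2" using \<epsilon> by (intro power2_less_imp_less[of _ "\<epsilon> / 2"]) auto
        moreover have "l2dist m (g n) G < \<epsilon> / 2" using N2 by (simp add: n_def)
        moreover have "h \<in> L2 m" using h L by blast
        ultimately show ?thesis using l2norm_triangle[OF _ gL G(1), of h n] by simp
      qed
      then show "\<exists>n. \<exists>\<eta>>0. \<forall>g\<in>S n. l2norm m g \<le> l2norm m G + \<eta> \<longrightarrow> l2dist m g G < \<epsilon>"
        by (intro exI[of _ n] exI[of _ "1 / real (Suc n)"]) auto
    qed
    show "\<forall>n. \<forall>\<eta>>0. \<exists>g\<in>S n. l2norm m g \<le> l2norm m G + \<eta>"
    proof (intro allI impI)
      fix n and \<eta> :: real assume "0 < \<eta>"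
      then obtain h where "h \<in> S n" "l2norm m h < \<nu> n + \<eta>"
        using cINF_less_iff[OF ne bdd, of n "\<nu> n + \<eta>"] unfolding \<nu>_def by auto
      then show "\<exists>g\<in>S n. l2norm m g \<le> l2norm m G + \<eta>" using \<mu>(2)[rule_format, of n] normG by (intro bexI[of _ h]) auto
    qed
    show "(\<forall>n. S n = S 0) \<longrightarrow> (\<forall>g\<in>S 0. l2norm m G \<le> l2norm m g)"
    proof (intro impI ballI)
      fix h assume "\<forall>n. S n = S 0" "h \<in> S 0"
      then have "\<nu> n \<le> l2norm m h" for n using \<nu>_le by metis
      then show "l2norm m G \<le> l2norm m h" using \<mu>(1) normG by (intro LIMSEQ_le_const2) auto
    qed
  qed
qed

text \<open>The projection of 0 onto the closure of S with its first-order condition. Closures are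
  not formed: p is approached by elements of S instead.\<close>

lemma minimal_norm_variational:
  assumes "prob_space m" and L: "S \<subseteq> L2 m" "S \<noteq> {}"
    and convex: "\<And>g h t. \<lbrakk>g \<in> S; h \<in> S; 0 \<le> t; t \<le> 1\<rbrakk> \<Longrightarrow> (\<lambda>x. (1 - t) * g x + t * h x) \<in> S"
  obtains p where "p \<in> L2 m" "\<forall>\<epsilon>>0. \<exists>g\<in>S. l2dist m g p < \<epsilon> \<and> l2norm m g \<le> l2norm m p + \<epsilon>"
    "\<forall>g\<in>S. l2norm m p \<le> l2norm m g" "\<forall>h\<in>S. (l2norm m p)\<^sup>2 \<le> (\<integral>x. h x * p x \<partial>m)"
proof -
  obtain g0 where g0: "g0 \<in> S" using L by blast
  obtain p where p: "p \<in> L2 m"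
    "\<forall>\<epsilon>>0. \<exists>n::nat. \<exists>\<eta>>0. \<forall>g\<in>S. l2norm m g \<le> l2norm m p + \<eta> \<longrightarrow> l2dist m g p < \<epsilon>"
    "\<forall>n::nat. \<forall>\<eta>>0. \<exists>g\<in>S. l2norm m g \<le> l2norm m p + \<eta>"
    "(\<forall>n::nat. S = S) \<longrightarrow> (\<forall>g\<in>S. l2norm m p \<le> l2norm m g)"
  proof (rule minimal_norm_limit[of m "\<lambda>_. S" "l2norm m g0"])
    show "decseq (\<lambda>_::nat. S)" by (simp add: decseq_def)
    show "\<exists>g\<in>S. l2norm m g \<le> l2norm m g0" using g0 by blast
  qed (use assms in blast)+
  have p4: "\<forall>g\<in>S. l2norm m p \<le> l2norm m g" using p(4) by simp
  have approx: "\<exists>g\<in>S. l2dist m g p < \<epsilon> \<and> l2norm m g \<le> l2norm m p + \<epsilon>" if \<epsilon>: "0 < \<epsilon>" for \<epsilon>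
  proof -
    obtain \<eta> where \<eta>: "\<eta> > 0" "\<forall>g\<in>S. l2norm m g \<le> l2norm m p + \<eta> \<longrightarrow> l2dist m g p < \<epsilon>" using p(2) \<epsilon> by blast
    obtain g where "g \<in> S" "l2norm m g \<le> l2norm m p + min \<eta> \<epsilon>" using p(3) \<eta>(1) \<epsilon> by (meson min_less_iff_conj)
    then show ?thesis using \<eta>(2) by (intro bexI[of _ g]) auto
  qed
  have var: "(l2norm m p)\<^sup>2 \<le> (\<integral>x. h x * p x \<partial>m)" if h: "h \<in> S" for h
  proof -
    have hL: "h \<in> L2 m" using h L by blast
    have hp: "(\<lambda>x. h x - p x) \<in> L2 m" using L2_diff[OF hL p(1)] .
    \<comment> \<open>The segment from p to h need not lie in S; the segments from nearby elements
      of S do, and their error tends to 0.\<close>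
    have low: "l2norm m p \<le> l2norm m (\<lambda>x. p x + t * (h x - p x))" if t: "0 \<le> t" "t \<le> 1" for t
    proof (rule field_le_epsilon)
      fix \<epsilon> :: real assume "0 < \<epsilon>"
      then obtain g where g: "g \<in> S" "l2dist m g p < \<epsilon>" using approx by blast
      have gL: "g \<in> L2 m" using g L by blast
      have "l2norm m p \<le> l2norm m (\<lambda>x. (1 - t) * g x + t * h x)" using p4 convex[OF g(1) h t] by blast
      also have "\<dots> \<le> l2norm m (\<lambda>x. p x + t * (h x - p x)) + l2norm m (\<lambda>x. ((1 - t) * g x + t * h x) - (p x + t * (h x - p x)))"
        by (intro l2norm_le_diff L2_add L2_scale gL hL p(1) hp)
      also have "(\<lambda>x. ((1 - t) * g x + t * h x) - (p x + t * (h x - p x))) = (\<lambda>x. (1 - t) * (g x - p x))"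
        by (auto simp: algebra_simps)
      also have "l2norm m (\<lambda>x. (1 - t) * (g x - p x)) = (1 - t) * l2dist m g p"
        using t by (simp add: l2norm_scale)
      also have "\<dots> \<le> 1 * \<epsilon>" using g(2) t by (intro mult_mono) auto
      finally show "l2norm m p \<le> l2norm m (\<lambda>x. p x + t * (h x - p x)) + \<epsilon>" by simp
    qed
    define P where "P = (\<integral>x. p x * (h x - p x) \<partial>m)"
    define Q where "Q = (l2dist m h p)\<^sup>2"
    have quad: "0 \<le> 2 * P + t * Q" if t: "0 < t" "t \<le> 1" for t
    proof -
      have "(l2norm m p)\<^sup>2 \<le> (l2norm m (\<lambda>x. p x + t * (h x - p x)))\<^sup>2" using low[of t] t by (intro power_mono) auto
      also have "\<dots> = (l2norm m p)\<^sup>2 + 2 * (t * P) + t\<^sup>2 * Q"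
        using l2norm_add_square[OF p(1) L2_scale[OF hp, of t]]
        by (simp add: l2norm_scale power_mult_distrib mult.left_commute[of _ t] P_def Q_def)
      finally have "0 \<le> t * (2 * P + t * Q)" by (simp add: algebra_simps power2_eq_square)
      then show ?thesis using t by (simp add: zero_le_mult_iff)
    qed
    have "0 \<le> P"
    proof (rule ccontr)
      assume "\<not> 0 \<le> P"
      then have P: "P < 0" by simp
      have Q: "0 \<le> Q" by (simp add: Q_def)
      \<comment> \<open>Small enough for t times Q to be at most -P, which contradicts the quadratic
        inequality if P is negative.\<close>
      define t where "t = min 1 (- P / (Q + 1))"
      have t: "0 < t" "t \<le> 1" using P Q by (auto simp: t_def divide_neg_pos)
      have "t * Q \<le> - P / (Q + 1) * (Q + 1)" using P Q t by (intro mult_mono) (auto simp: t_def)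
      also have "\<dots> = - P" using Q by simp
      finally show False using quad[OF t] P by simp
    qed
    moreover have "P = (\<integral>x. h x * p x \<partial>m) - (l2norm m p)\<^sup>2"
      using L2_mult_integrable[OF p(1) hL] L2_mult_integrable[OF p(1) p(1)]
      by (simp add: P_def right_diff_distrib l2norm_square) (simp add: power2_eq_square mult.commute)
    ultimately show ?thesis by simp
  qed
  show thesis using that[OF p(1)] approx p4 var by blast
qed

section \<open>Upper slopes and the minimal relaxed slope\<close>

context monotone_approximation
begin

definition upper_slopes :: "('a \<Rightarrow> real) \<Rightarrow> nat \<Rightarrow> ('a \<Rightarrow> real) set" where
  "upper_slopes f n = {g \<in> L2 m. \<exists>v\<in>lip_b T d. l2dist m v f < 1 / real (Suc n) \<and>
     (AE x in m. lip_a (topspace T) d v x \<le> g x)}"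

lemma upper_slopes_decseq: "decseq (upper_slopes f)"
proof (rule decseq_SucI)
  fix n
  have "1 / real (Suc (Suc n)) \<le> 1 / real (Suc n)" by (simp add: frac_le)
  then show "upper_slopes f (Suc n) \<le> upper_slopes f n"
    unfolding upper_slopes_def by (auto intro: order_less_le_trans)
qed

lemma upper_slopes_convex:
  assumes f: "f \<in> L2 m" and g: "g \<in> upper_slopes f n" "h \<in> upper_slopes f n" and t: "0 \<le> t" "t \<le> 1"
  shows "(\<lambda>x. (1 - t) * g x + t * h x) \<in> upper_slopes f n"
proof -
  obtain v where v: "v \<in> lip_b T d" "l2dist m v f < 1 / real (Suc n)" "AE x in m. lip_a (topspace T) d v x \<le> g x"
    using g unfolding upper_slopes_def by blast
  obtain w where w: "w \<in> lip_b T d" "l2dist m w f < 1 / real (Suc n)" "AE x in m. lip_a (topspace T) d w x \<le> h x"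
    using g unfolding upper_slopes_def by blast
  have gL: "g \<in> L2 m" "h \<in> L2 m" using g by (auto simp: upper_slopes_def)
  note vL = lip_b_L2[OF prob sets_m v(1)] and wL = lip_b_L2[OF prob sets_m w(1)]
  have "l2norm m (\<lambda>x. ((1 - t) * v x + t * w x) - f x) = l2norm m (\<lambda>x. (1 - t) * (v x - f x) + t * (w x - f x))"
    by (simp add: algebra_simps)
  also have "\<dots> \<le> l2norm m (\<lambda>x. (1 - t) * (v x - f x)) + l2norm m (\<lambda>x. t * (w x - f x))"
    by (intro l2norm_add_le L2_scale L2_diff vL wL f)
  also have "\<dots> = (1 - t) * l2dist m v f + t * l2dist m w f"
    using t by (simp add: l2norm_scale)
  also have "\<dots> < 1 / real (Suc n)"
    using convex_bound_lt[OF v(2) w(2), of "1 - t" t] t by simp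
  finally have "l2norm m (\<lambda>x. ((1 - t) * v x + t * w x) - f x) < 1 / real (Suc n)" .
  moreover have "AE x in m. lip_a (topspace T) d (\<lambda>x. (1 - t) * v x + t * w x) x \<le> (1 - t) * g x + t * h x"
    using v(3) w(3)
  proof eventually_elim
    fix x assume x: "lip_a (topspace T) d v x \<le> g x" "lip_a (topspace T) d w x \<le> h x"
    have "lip_a (topspace T) d (\<lambda>x. (1 - t) * v x + t * w x) x \<le> (1 - t) * lip_a (topspace T) d v x + t * lip_a (topspace T) d w x"
      by (rule lip_a_convex[OF lip_bD(1)[OF v(1)] lip_bD(1)[OF w(1)] t])
    also have "\<dots> \<le> (1 - t) * g x + t * h x" using x t by (intro add_mono mult_left_mono) auto
    finally show "lip_a (topspace T) d (\<lambda>x. (1 - t) * v x + t * w x) x \<le> (1 - t) * g x + t * h x" .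
  qed
  moreover have "(\<lambda>x. (1 - t) * g x + t * h x) \<in> L2 m" by (intro L2_add L2_scale gL)
  ultimately show ?thesis unfolding upper_slopes_def
    by (intro CollectI conjI bexI[OF _ lip_b_convex[OF v(1) w(1) t]]) auto
qed

lemma star_L2: assumes "v \<in> lip_b T d" shows "lip_a_star T d m v \<in> L2 m"
  "AE x in m. lip_a (topspace T) d v x \<le> lip_a_star T d m v x" "AE x in m. 0 \<le> lip_a_star T d m v x"
proof -
  obtain L where L: "0 < L" "\<forall>x\<in>topspace T. \<forall>y\<in>topspace T. ennreal \<bar>v x - v y\<bar> \<le> ennreal L * d x y"
    using lipschitz_wrtE[OF lip_bD(1)[OF assms]] by blast
  note * = lip_a_star_bounds[OF prob sets_m L(2) less_imp_le[OF L(1)]]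
  show "lip_a_star T d m v \<in> L2 m"
    "AE x in m. lip_a (topspace T) d v x \<le> lip_a_star T d m v x" "AE x in m. 0 \<le> lip_a_star T d m v x" by (fact *)+
qed

lemma star_norm_le:
  assumes v: "v \<in> lip_b T d" and g: "g \<in> L2 m" "AE x in m. lip_a (topspace T) d v x \<le> g x"
  shows "l2norm m (lip_a_star T d m v) \<le> l2norm m g"
proof (rule l2norm_mono[OF g(1) L2_measurable[OF star_L2(1)[OF v]]])
  have "AE x in m. lip_a_star T d m v x \<le> g x"
    using lip_a_star_envelope[OF prob sets_m lip_bD(1)[OF v]] g L2_measurable unfolding is_ess_envelope_def by blast
  then show "AE x in m. \<bar>lip_a_star T d m v x\<bar> \<le> \<bar>g x\<bar>" using star_L2(3)[OF v] by eventually_elim simp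
qed

text \<open>The limit G of near-minimal upper slopes is a relaxed slope, being a strong limit of
  envelopes. Every relaxed slope has inner product with G at least the squared norm of G; hence G is
  minimal and every minimiser equals it almost everywhere.\<close>

proposition min_relaxed_slope:
  assumes f: "f \<in> energy_domain m Ch"
  shows "min_relaxed_slope T d m f \<in> L2 m"
    "\<forall>\<epsilon>>0. \<exists>n. \<exists>\<eta>>0. \<forall>g\<in>upper_slopes f n. l2norm m g \<le> l2norm m (min_relaxed_slope T d m f) + \<eta> \<longrightarrow>
       l2dist m g (min_relaxed_slope T d m f) < \<epsilon>"
    "\<forall>n. \<forall>\<eta>>0. \<exists>g\<in>upper_slopes f n. l2norm m g \<le> l2norm m (min_relaxed_slope T d m f) + \<eta>"
proof -
  have fL: "f \<in> L2 m" and "Ch f < top" using f by (auto simp: energy_domain_def)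
  then obtain c where c: "Ch f = ennreal c" "0 \<le> c" by (cases "Ch f") auto
  have SL: "upper_slopes f n \<subseteq> L2 m" for n by (auto simp: upper_slopes_def)
  have bound: "\<exists>g\<in>upper_slopes f n. l2norm m g \<le> sqrt (c + 1)" for n
  proof -
    have "Ch f < ennreal (c + 1)" using c by (simp add: ennreal_less_iff)
    then obtain v where v: "v \<in> lip_b T d" "l2dist m v f < 1 / real (Suc n)"
      "star_energy T d m v < ennreal (c + 1)"
      using cheeger_lessD[of T d m f "ennreal (c + 1)" "1 / real (Suc n)"] by auto
    have "(l2norm m (lip_a_star T d m v))\<^sup>2 \<le> c + 1"
      using v(3) nn_integral_square_L2[OF star_L2(1)[OF v(1)]] by (simp add: ennreal_less_iff)
    then have "l2norm m (lip_a_star T d m v) \<le> sqrt (c + 1)" by (rule real_le_rsqrt)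
    then show ?thesis using v star_L2[OF v(1)] unfolding upper_slopes_def by blast
  qed
  obtain G where G: "G \<in> L2 m"
    and wp: "\<forall>\<epsilon>>0. \<exists>n. \<exists>\<eta>>0. \<forall>g\<in>upper_slopes f n. l2norm m g \<le> l2norm m G + \<eta> \<longrightarrow> l2dist m g G < \<epsilon>"
    and ex: "\<forall>n. \<forall>\<eta>>0. \<exists>g\<in>upper_slopes f n. l2norm m g \<le> l2norm m G + \<eta>"
    by (rule minimal_norm_limit[OF prob SL upper_slopes_decseq upper_slopes_convex[OF fL] bound])
  have sub: "upper_slopes f k \<subseteq> upper_slopes f n" if "n \<le> k" for n k
    using upper_slopes_decseq that by (simp add: decseq_def)
  have near: "\<exists>v\<in>lip_b T d. l2dist m v f < 1 / real (Suc k) \<and>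
      l2dist m (lip_a_star T d m v) G < 1 / real (Suc k)" for k
  proof -
    obtain n \<eta> where n: "\<eta> > 0" "\<forall>g\<in>upper_slopes f n. l2norm m g \<le> l2norm m G + \<eta> \<longrightarrow> l2dist m g G < 1 / real (Suc k)"
      using wp[rule_format, of "1 / real (Suc k)"] by auto
    \<comment> \<open>The index n makes near-minimality effective, while k forces the underlying
      function close to f.\<close>
    obtain g where g: "g \<in> upper_slopes f (max n k)" "l2norm m g \<le> l2norm m G + \<eta>" using ex n(1) by blast
    then obtain v where v: "v \<in> lip_b T d" "l2dist m v f < 1 / real (Suc (max n k))"
      "AE x in m. lip_a (topspace T) d v x \<le> g x" and gL: "g \<in> L2 m" unfolding upper_slopes_def by blast
    have "lip_a_star T d m v \<in> upper_slopes f (max n k)" using v star_L2[OF v(1)] unfolding upper_slopes_def by blast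
    then have "lip_a_star T d m v \<in> upper_slopes f n" using sub[of n "max n k"] by auto
    moreover have "l2norm m (lip_a_star T d m v) \<le> l2norm m G + \<eta>" using star_norm_le[OF v(1) gL v(3)] g(2) by simp
    ultimately have "l2dist m (lip_a_star T d m v) G < 1 / real (Suc k)" using n(2) by blast
    moreover have "1 / real (Suc (max n k)) \<le> 1 / real (Suc k)" by (simp add: frac_le)
    ultimately show ?thesis using v by (meson order_less_le_trans)
  qed
  then obtain V where V: "\<And>k. V k \<in> lip_b T d" "\<And>k. l2dist m (V k) f < 1 / real (Suc k)"
      "\<And>k. l2dist m (lip_a_star T d m (V k)) G < 1 / real (Suc k)" by metis
  have null: "a \<longlonglongrightarrow> 0" if "\<And>k. 0 \<le> a k" "\<And>k. a k < 1 / real (Suc k)" for a :: "nat \<Rightarrow> real"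
    by (rule tendsto_sandwich[OF _ _ tendsto_const LIMSEQ_Suc[OF lim_1_over_n]])
       (intro always_eventually allI less_imp_le[OF that(2)] that(1))+
  have "l2_tendsto m V f sequentially"
    unfolding l2_tendsto_def using lip_b_L2[OF prob sets_m V(1)] fL null[OF l2norm_nonneg V(2)] by simp
  moreover have starG: "l2_tendsto m (\<lambda>k. lip_a_star T d m (V k)) G sequentially"
    unfolding l2_tendsto_def using star_L2(1)[OF V(1)] G null[OF l2norm_nonneg V(3)] by simp
  have "l2_weak_limit_point m (\<lambda>k. lip_a_star T d m (V k)) G"
    unfolding l2_weak_limit_point_def
  proof (intro conjI G allI impI)
    fix \<Phi> \<epsilon> assume \<Phi>: "finite \<Phi> \<and> \<Phi> \<subseteq> L2 m \<and> (0::real) < \<epsilon>"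
    have "\<forall>\<^sub>F k in sequentially. \<bar>\<integral>x. (lip_a_star T d m (V k) x - G x) * \<phi> x \<partial>m\<bar> < \<epsilon>" if "\<phi> \<in> \<Phi>" for \<phi>
    proof -
      have \<phi>: "\<phi> \<in> L2 m" using that \<Phi> by blast
      have "(\<lambda>k. l2dist m (lip_a_star T d m (V k)) G * l2norm m \<phi>) \<longlonglongrightarrow> 0 * l2norm m \<phi>"
        using starG by (intro tendsto_intros) (simp add: l2_tendsto_def)
      then have "\<forall>\<^sub>F k in sequentially. l2dist m (lip_a_star T d m (V k)) G * l2norm m \<phi> < \<epsilon>"
        using \<Phi> by (intro order_tendstoD(2)) auto
      then show ?thesis
        by (rule eventually_mono) (rule le_less_trans[OF l2_Cauchy_Schwarz[OF L2_diff[OF star_L2(1)[OF V(1)] G] \<phi>]])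
    qed
    then have "\<forall>\<^sub>F k in sequentially. \<forall>\<phi>\<in>\<Phi>. \<bar>\<integral>x. (lip_a_star T d m (V k) x - G x) * \<phi> x \<partial>m\<bar> < \<epsilon>"
      using \<Phi> by (simp add: eventually_ball_finite_distrib)
    then show "\<exists>\<^sub>F k in sequentially. \<forall>\<phi>\<in>\<Phi>. \<bar>\<integral>x. (lip_a_star T d m (V k) x - G x) * \<phi> x \<partial>m\<bar> < \<epsilon>"
      by (rule eventually_frequently[rotated]) simp
  qed
  ultimately have relG: "relaxed_slope T d m f G"
    unfolding relaxed_slope_def using G V(1) by (intro conjI exI[of _ V] exI[of _ G]) auto
  \<comment> \<open>Needed later to multiply the inequality between g and a relaxed slope above it
    by G.\<close>
  have G0: "AE x in m. 0 \<le> G x"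
  proof -
    have "l2norm m (\<lambda>x. min (G x) 0) \<le> l2dist m (lip_a_star T d m (V k)) G" for k
    proof (rule l2norm_mono[OF L2_diff[OF star_L2(1)[OF V(1)] G]])
      show "(\<lambda>x. min (G x) 0) \<in> borel_measurable m" using L2_measurable[OF G] by simp
      show "AE x in m. \<bar>min (G x) 0\<bar> \<le> \<bar>lip_a_star T d m (V k) x - G x\<bar>"
        using star_L2(3)[OF V(1), of k] by eventually_elim auto
    qed
    then have "l2norm m (\<lambda>x. min (G x) 0) \<le> 0"
      using starG by (intro tendsto_lowerbound[where F=sequentially]) (auto simp: l2_tendsto_def)
    then have "l2norm m (\<lambda>x. min (G x) 0) = 0" using l2norm_nonneg[of m "\<lambda>x. min (G x) 0"] by linarith
    moreover have "(\<lambda>x. min (G x) 0) \<in> L2 m" by (rule L2_bound[OF G]) (use L2_measurable[OF G] in auto)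
    ultimately have "AE x in m. min (G x) 0 = 0" by (intro l2norm_eq_0_AE)
    then show ?thesis by eventually_elim (simp add: min_def split: if_splits)
  qed
  \<comment> \<open>Elements p of minimal norm for a fixed n replace G as test functions: they
    satisfy the first-order condition exactly and are close to G for suitable n.\<close>
  have test: "\<exists>p\<in>L2 m. l2dist m p G < \<epsilon> \<and> (\<exists>n. \<forall>h\<in>upper_slopes f n. (l2norm m p)\<^sup>2 \<le> (\<integral>x. h x * p x \<partial>m))"
    if \<epsilon>: "0 < \<epsilon>" for \<epsilon>
  proof -
    obtain n \<eta> where n: "\<eta> > 0" "\<forall>g\<in>upper_slopes f n. l2norm m g \<le> l2norm m G + \<eta> \<longrightarrow> l2dist m g G < \<epsilon> / 2"
      using wp[rule_format, of "\<epsilon> / 2"] \<epsilon> by auto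
    have ne: "upper_slopes f n \<noteq> {}" using bound by blast
    obtain p where p: "p \<in> L2 m" "\<forall>\<epsilon>>0. \<exists>g\<in>upper_slopes f n. l2dist m g p < \<epsilon> \<and> l2norm m g \<le> l2norm m p + \<epsilon>"
      "\<forall>g\<in>upper_slopes f n. l2norm m p \<le> l2norm m g"
      "\<forall>h\<in>upper_slopes f n. (l2norm m p)\<^sup>2 \<le> (\<integral>x. h x * p x \<partial>m)"
      by (rule minimal_norm_variational[OF prob SL ne upper_slopes_convex[OF fL]])
    have "l2norm m p \<le> l2norm m G"
    proof (rule field_le_epsilon)
      fix e :: real assume "0 < e"
      then show "l2norm m p \<le> l2norm m G + e" using ex p(3) by (meson order_trans)
    qed
    moreover obtain g where g: "g \<in> upper_slopes f n" "l2dist m g p < min (\<epsilon> / 2) \<eta>" "l2norm m g \<le> l2norm m p + min (\<epsilon> / 2) \<eta>"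
      using p(2)[rule_format, of "min (\<epsilon> / 2) \<eta>"] \<epsilon> n(1) by auto
    ultimately have "l2dist m g G < \<epsilon> / 2" using n(2) by auto
    then have "l2dist m p G < \<epsilon>"
      using l2norm_triangle[OF p(1) _ G, of g] g SL l2norm_commute[of m p g] by fastforce
    then show ?thesis using p by blast
  qed
  have inner: "(l2norm m G)\<^sup>2 \<le> (\<integral>x. G' x * G x \<partial>m)" if rel: "relaxed_slope T d m f G'" for G'
  proof -
    obtain F g where G'L: "G' \<in> L2 m" and F: "\<And>n. F n \<in> lip_b T d" "l2_tendsto m F f sequentially"
      and g: "l2_weak_limit_point m (\<lambda>n. lip_a_star T d m (F n)) g" "AE x in m. g x \<le> G' x"
      using rel unfolding relaxed_slope_def by blast
    have gL: "g \<in> L2 m" using g(1) by (simp add: l2_weak_limit_point_def)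
    \<comment> \<open>The envelopes eventually lie in \<open>upper_slopes f n\<close>, and the
      condition is linear in h, so the weak neighbourhood of g given by p alone suffices to pass to
      g.\<close>
    have gp: "(l2norm m p)\<^sup>2 \<le> (\<integral>x. g x * p x \<partial>m)"
      if p: "p \<in> L2 m" "\<forall>h\<in>upper_slopes f n. (l2norm m p)\<^sup>2 \<le> (\<integral>x. h x * p x \<partial>m)" for p n
    proof (rule field_le_epsilon)
      fix e :: real assume e: "0 < e"
      have "\<forall>\<^sub>F k in sequentially. l2dist m (F k) f < 1 / real (Suc n)"
        using F(2) unfolding l2_tendsto_def by (intro order_tendstoD(2)) auto
      then have "\<forall>\<^sub>F k in sequentially. lip_a_star T d m (F k) \<in> upper_slopes f n"
        by (rule eventually_mono) (use F(1) star_L2 in \<open>auto simp: upper_slopes_def\<close>)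
      moreover have "\<exists>\<^sub>F k in sequentially. \<forall>\<phi>\<in>{p}. \<bar>\<integral>x. (lip_a_star T d m (F k) x - g x) * \<phi> x \<partial>m\<bar> < e"
        using g(1) p(1) e unfolding l2_weak_limit_point_def by blast
      ultimately have "\<exists>\<^sub>F k in sequentially. lip_a_star T d m (F k) \<in> upper_slopes f n \<and> \<bar>\<integral>x. (lip_a_star T d m (F k) x - g x) * p x \<partial>m\<bar> < e"
        by (auto elim: frequently_rev_mp eventually_mono)
      then obtain k where k: "lip_a_star T d m (F k) \<in> upper_slopes f n" "\<bar>\<integral>x. (lip_a_star T d m (F k) x - g x) * p x \<partial>m\<bar> < e"
        using frequently_ex by blast
      have "(\<integral>x. (lip_a_star T d m (F k) x - g x) * p x \<partial>m) = (\<integral>x. lip_a_star T d m (F k) x * p x \<partial>m) - (\<integral>x. g x * p x \<partial>m)"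
        using L2_mult_integrable[OF star_L2(1)[OF F(1)] p(1)] L2_mult_integrable[OF gL p(1)] by (simp add: left_diff_distrib)
      then show "(l2norm m p)\<^sup>2 \<le> (\<integral>x. g x * p x \<partial>m) + e" using k p(2) by fastforce
    qed
    have "\<exists>p. p \<in> L2 m \<and> l2dist m p G < 1 / real (Suc k) \<and> (l2norm m p)\<^sup>2 \<le> (\<integral>x. g x * p x \<partial>m)" for k
      using test[of "1 / real (Suc k)"] gp by fastforce
    then obtain p where p: "\<And>k. p k \<in> L2 m" "\<And>k. l2dist m (p k) G < 1 / real (Suc k)"
      "\<And>k. (l2norm m (p k))\<^sup>2 \<le> (\<integral>x. g x * p k x \<partial>m)" by metis
    have pG: "l2_tendsto m p G sequentially"
      unfolding l2_tendsto_def using p(1) G null[OF l2norm_nonneg p(2)] by simp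
    have "(\<lambda>k. (l2norm m (p k))\<^sup>2) \<longlonglongrightarrow> (l2norm m G)\<^sup>2" by (intro tendsto_intros l2_tendsto_norm pG)
    moreover have "(\<lambda>k. \<integral>x. p k x * g x \<partial>m) \<longlonglongrightarrow> (\<integral>x. G x * g x \<partial>m)" by (rule l2_tendsto_inner[OF pG gL])
    ultimately have "(l2norm m G)\<^sup>2 \<le> (\<integral>x. G x * g x \<partial>m)"
      by (rule LIMSEQ_le) (use p(3) in \<open>auto simp: mult.commute\<close>)
    also have "\<dots> \<le> (\<integral>x. G' x * G x \<partial>m)"
    proof (rule integral_mono_AE[OF L2_mult_integrable[OF G gL] L2_mult_integrable[OF G'L G]])
      show "AE x in m. G x * g x \<le> G' x * G x"
        using G0 g(2) by eventually_elim (metis mult.commute mult_right_mono)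
    qed
    finally show ?thesis .
  qed
  define G' where "G' = min_relaxed_slope T d m f"
  have G'L: "G'' \<in> L2 m" if "relaxed_slope T d m f G''" for G'' using that by (simp add: relaxed_slope_def)
  have minG: "l2norm m G \<le> l2norm m G''" if rel: "relaxed_slope T d m f G''" for G''
  proof (cases "l2norm m G = 0")
    case False
    have "l2norm m G * l2norm m G \<le> l2norm m G'' * l2norm m G"
      using inner[OF rel] l2_Cauchy_Schwarz[OF G'L[OF rel] G] by (simp add: power2_eq_square)
    then show ?thesis using False l2norm_nonneg[of m G] by (metis mult_le_cancel_right linorder_not_less order_le_less)
  qed simp
  have G': "relaxed_slope T d m f G' \<and> (\<forall>G''. relaxed_slope T d m f G'' \<longrightarrow> l2norm m G' \<le> l2norm m G'')"
    unfolding G'_def min_relaxed_slope_def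
    by (rule someI[where P="\<lambda>G. relaxed_slope T d m f G \<and> (\<forall>G''. relaxed_slope T d m f G'' \<longrightarrow> l2norm m G \<le> l2norm m G'')" and x=G])
       (use relG minG in blast)
  then have G'': "G' \<in> L2 m" "l2norm m G' = l2norm m G" using G'L relG minG by (auto intro: order_antisym)
  \<comment> \<open>The norms agree, and \<open>inner\<close> makes the mixed term at least the
    squared norm, so expanding the square leaves nothing positive.\<close>
  have "(l2dist m G' G)\<^sup>2 \<le> 0"
    using l2norm_diff_square[OF G''(1) G] inner[of G'] G' G''(2) by simp
  then have "l2dist m G' G = 0" by simp
  then have AEG: "AE x in m. G' x = G x"
    using l2norm_eq_0_AE[OF L2_diff[OF G''(1) G]] by (auto elim: eventually_mono)
  have eq: "l2dist m g G' = l2dist m g G" if "g \<in> L2 m" for g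
  proof (rule l2norm_AE_cong)
    show "AE x in m. g x - G' x = g x - G x" using AEG by eventually_elim simp
  qed (intro borel_measurable_diff L2_measurable that G G''(1))+
  show "min_relaxed_slope T d m f \<in> L2 m" using G''(1) by (simp add: G'_def)
  show "\<forall>\<epsilon>>0. \<exists>n. \<exists>\<eta>>0. \<forall>g\<in>upper_slopes f n. l2norm m g \<le> l2norm m (min_relaxed_slope T d m f) + \<eta> \<longrightarrow>
       l2dist m g (min_relaxed_slope T d m f) < \<epsilon>"
    unfolding G'_def[symmetric] G''(2) using wp eq SL by (metis subsetD)
  show "\<forall>n. \<forall>\<eta>>0. \<exists>g\<in>upper_slopes f n. l2norm m g \<le> l2norm m (min_relaxed_slope T d m f) + \<eta>"
    unfolding G'_def[symmetric] G''(2) by (rule ex)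
qed

text \<open>Slopes for \<open>di i\<close> are measurable upper bounds of the slope for
  \<open>d\<close>, so they are upper slopes of f. Their norms are nearly minimal at
  \<open>i0\<close> and decrease with the index, so they are all close to the minimal relaxed
  slope.\<close>

proposition recovery_slopes:
  assumes f: "f \<in> energy_domain m Ch" and \<epsilon>: "0 < \<epsilon>"
  shows "\<exists>i0\<in>I. \<exists>F. l2dist m F f < \<epsilon> \<and> (\<forall>i\<in>I. le i0 i \<longrightarrow> lip_bi i F \<and>
     l2dist m (slope_i i F) (min_relaxed_slope T d m f) < \<epsilon>)"
proof -
  define G where "G = min_relaxed_slope T d m f"
  note min = min_relaxed_slope[OF f, folded G_def]
  have fL: "f \<in> L2 m" using f by (simp add: energy_domain_def)
  obtain n \<eta> where n: "\<eta> > 0" "\<forall>g\<in>upper_slopes f n. l2norm m g \<le> l2norm m G + \<eta> \<longrightarrow> l2dist m g G < \<epsilon>"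
    using min(2) \<epsilon> by blast
  \<comment> \<open>Two errors of size \<delta>, from f to v and from v to F, keep F within
    \<epsilon> of f and within the threshold of \<open>upper_slopes f n\<close>.\<close>
  define \<delta> where "\<delta> = min \<epsilon> (1 / real (Suc n)) / 2"
  have \<delta>: "0 < \<delta>" "2 * \<delta> \<le> \<epsilon>" "2 * \<delta> \<le> 1 / real (Suc n)" using \<epsilon> by (auto simp: \<delta>_def)
  obtain k where k: "1 / real (Suc k) < \<delta>" using \<delta>(1) nat_approx_posE by metis
  obtain g where g: "g \<in> upper_slopes f k" "l2norm m g \<le> l2norm m G + \<eta> / 2" using min(3) n(1) by (meson half_gt_zero)
  then obtain v where v: "v \<in> lip_b T d" "l2dist m v f < 1 / real (Suc k)"
    "AE x in m. lip_a (topspace T) d v x \<le> g x" and gL: "g \<in> L2 m" unfolding upper_slopes_def by blast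
  have "l2norm m (lip_a_star T d m v) \<le> l2norm m G + \<eta> / 2" using star_norm_le[OF v(1) gL v(3)] g(2) by simp
  obtain i0 F where F: "i0 \<in> I" "lip_bi i0 F" "l2dist m F v < min \<delta> (\<eta> / 2)"
    "l2norm m (slope_i i0 F) \<le> l2norm m (lip_a_star T d m v) + min \<delta> (\<eta> / 2)"
    using recovery[OF v(1), of "min \<delta> (\<eta> / 2)"] \<delta>(1) n(1) by auto
  have Ff: "l2dist m F f < 2 * \<delta>"
    using l2norm_triangle[OF lip_bi_L2[OF F(1,2)] lip_b_L2[OF prob sets_m v(1)] fL] F(3) v(2) k by simp
  have "lip_bi i F \<and> l2dist m (slope_i i F) G < \<epsilon>" if i: "i \<in> I" "le i0 i" for i
  proof -
    have Fi: "lip_bi i F" using slope_i_antimono(1)[OF F(1) i] F(2) by blast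
    have sL: "slope_i i F \<in> L2 m" using slope_i_L2[OF i(1)] Fi by blast
    have "l2norm m (slope_i i F) \<le> l2norm m (slope_i i0 F)"
    proof (rule l2norm_mono[OF slope_i_L2[OF F(1) conjunct2[OF F(2)]] L2_measurable[OF sL]])
      show "AE x in m. \<bar>slope_i i F x\<bar> \<le> \<bar>slope_i i0 F x\<bar>"
        using AE_space by eventually_elim (use slope_i_antimono(2)[OF F(1) i] F(2) space_m in auto)
    qed
    then have "l2norm m (slope_i i F) \<le> l2norm m G + \<eta>"
      using F(4) \<open>l2norm m (lip_a_star T d m v) \<le> l2norm m G + \<eta> / 2\<close> by linarith
    moreover have "slope_i i F \<in> upper_slopes f n"
    proof -
      have "AE x in m. lip_a (topspace T) d F x \<le> slope_i i F x"
        using AE_space by eventually_elim (use slope_d_le_slope_i[OF i(1)] Fi space_m in auto)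
      moreover have "l2dist m F f < 1 / real (Suc n)" using Ff \<delta>(3) by linarith
      ultimately show ?thesis unfolding upper_slopes_def using sL lip_bi_lip_b[OF i(1) Fi] by blast
    qed
    ultimately show ?thesis using n(2) Fi by blast
  qed
  then show ?thesis using Ff \<delta>(2) F(1) unfolding G_def by (meson order_less_le_trans)
qed

text \<open>The index set consists of pairs of an index and a precision, and the function depends on
  the precision alone.\<close>

proposition recovery_subnet:
  assumes f: "f \<in> energy_domain m Ch"
  shows "\<exists>(J :: ('i \<times> nat) set) leJ \<beta> (fj :: 'i \<times> nat \<Rightarrow> 'a \<Rightarrow> real).
          subnet_map J leJ I le \<beta> \<and> (\<forall>j\<in>J. lip_bi (\<beta> j) (fj j)) \<and>
          l2_tendsto m fj f (net_filter J leJ) \<and>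
          l2_tendsto m (\<lambda>j. slope_i (\<beta> j) (fj j)) (min_relaxed_slope T d m f) (net_filter J leJ)"
proof -
  have fL: "f \<in> L2 m" using f by (simp add: energy_domain_def)
  note GL = min_relaxed_slope(1)[OF f]
  define P where "P n i0 F \<longleftrightarrow> i0 \<in> I \<and> l2dist m F f < 1 / real (Suc n) \<and> (\<forall>i\<in>I. le i0 i \<longrightarrow> lip_bi i F \<and>
     l2dist m (slope_i i F) (min_relaxed_slope T d m f) < 1 / real (Suc n))" for n i0 F
  have "\<exists>i0 F. P n i0 F" for n
    using recovery_slopes[OF f, of "1 / real (Suc n)"] unfolding P_def by auto
  then obtain i0 F where "\<And>n. P n (i0 n) (F n)" by metis
  then have F: "\<And>n. i0 n \<in> I" "\<And>n. l2dist m (F n) f < 1 / real (Suc n)"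
    "\<And>n i. \<lbrakk>i \<in> I; le (i0 n) i\<rbrakk> \<Longrightarrow> lip_bi i (F n)"
    "\<And>n i. \<lbrakk>i \<in> I; le (i0 n) i\<rbrakk> \<Longrightarrow> l2dist m (slope_i i (F n)) (min_relaxed_slope T d m f) < 1 / real (Suc n)"
    unfolding P_def by blast+
  \<comment> \<open>The thresholds \<open>i0 n\<close> need not increase with n, so being beyond the
    threshold is built into the set instead of the order.\<close>
  define J where "J = {(i, n). i \<in> I \<and> le (i0 n) i}"
  define leJ where "leJ = (\<lambda>p q :: 'i \<times> nat. le (fst p) (fst q) \<and> snd p \<le> snd q)"
  define fj where "fj = (\<lambda>p :: 'i \<times> nat. F (snd p))"
  have refl: "le i i" if "i \<in> I" for i using directed that by (simp add: directed_set_def)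
  have J0: "(i0 n, n) \<in> J" for n using F(1) refl by (simp add: J_def)
  have dirJ: "directed_set J leJ"
    unfolding directed_set_def
  proof (intro conjI ballI impI)
    show "J \<noteq> {}" using J0 by blast
    show "leJ p p" if "p \<in> J" for p using that refl by (auto simp: J_def leJ_def)
    show "leJ p r" if "p \<in> J" "q \<in> J" "r \<in> J" "leJ p q" "leJ q r" for p q r
      using that directed_trans[of "fst p" "fst q" "fst r"] by (auto simp: J_def leJ_def)
    fix p q assume pq: "p \<in> J" "q \<in> J"
    define n where "n = max (snd p) (snd q)"
    obtain k where k: "k \<in> I" "\<forall>i\<in>{fst p, fst q, i0 n}. le i k"
      using directed_upper_bound[OF directed, of "{fst p, fst q, i0 n}"] pq F(1) by (auto simp: J_def)
    then show "\<exists>r\<in>J. leJ p r \<and> leJ q r"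
      by (intro bexI[of _ "(k, n)"]) (auto simp: J_def leJ_def n_def)
  qed
  have sub: "subnet_map J leJ I le fst"
    unfolding subnet_map_def
  proof (intro conjI ballI impI dirJ)
    show "fst ` J \<subseteq> I" by (auto simp: J_def)
    show "le (fst p) (fst q)" if "leJ p q" for p q using that by (simp add: leJ_def)
    fix i assume i: "i \<in> I"
    obtain k where "k \<in> I" "\<forall>j\<in>{i, i0 0}. le j k"
      using directed_upper_bound[OF directed, of "{i, i0 0}"] i F(1) by auto
    then show "\<exists>j\<in>J. le i (fst j)" by (intro bexI[of _ "(k, 0)"]) (auto simp: J_def)
  qed
  have bi: "lip_bi (fst j) (fj j)" if "j \<in> J" for j using that F(3) by (auto simp: J_def fj_def)
  have ev: "\<forall>\<^sub>F j in net_filter J leJ. j \<in> J"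
    unfolding eventually_net_filter[OF dirJ] using J0 by blast
  have lim: "(a \<longlongrightarrow> 0) (net_filter J leJ)" if a: "\<And>j. j \<in> J \<Longrightarrow> 0 \<le> a j" "\<And>j. j \<in> J \<Longrightarrow> a j < 1 / real (Suc (snd j))" for a :: "'i \<times> nat \<Rightarrow> real"
  proof (rule tendstoI)
    fix e :: real assume "0 < e"
    then obtain n where n: "1 / real (Suc n) < e" using nat_approx_posE by metis
    show "\<forall>\<^sub>F j in net_filter J leJ. dist (a j) 0 < e"
      unfolding eventually_net_filter[OF dirJ]
    proof (intro bexI[of _ "(i0 n, n)"] ballI impI J0)
      fix j assume j: "j \<in> J" "leJ (i0 n, n) j"
      then have "1 / real (Suc (snd j)) \<le> 1 / real (Suc n)" by (intro frac_le) (auto simp: leJ_def)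
      then show "dist (a j) 0 < e" using a[OF j(1)] n by (simp add: dist_real_def)
    qed
  qed
  have 1: "l2_tendsto m fj f (net_filter J leJ)"
    unfolding l2_tendsto_def
  proof (intro conjI fL)
    show "\<forall>\<^sub>F j in net_filter J leJ. fj j \<in> L2 m"
      using ev by (rule eventually_mono) (use bi lip_bi_L2 in \<open>auto simp: J_def\<close>)
    show "((\<lambda>j. l2dist m (fj j) f) \<longlongrightarrow> 0) (net_filter J leJ)"
      by (rule lim) (use F(2) in \<open>auto simp: fj_def\<close>)
  qed
  have 2: "l2_tendsto m (\<lambda>j. slope_i (fst j) (fj j)) (min_relaxed_slope T d m f) (net_filter J leJ)"
    unfolding l2_tendsto_def
  proof (intro conjI GL)
    show "\<forall>\<^sub>F j in net_filter J leJ. slope_i (fst j) (fj j) \<in> L2 m"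
      using ev by (rule eventually_mono) (use bi slope_i_L2 in \<open>auto simp: J_def\<close>)
    show "((\<lambda>j. l2dist m (slope_i (fst j) (fj j)) (min_relaxed_slope T d m f)) \<longlongrightarrow> 0) (net_filter J leJ)"
      by (rule lim) (use F(4) in \<open>auto simp: fj_def J_def\<close>)
  qed
  show ?thesis using sub bi 1 2 by blast
qed

end

theorem theorem9p2:
  fixes T :: "'a topology"
    and d :: "'a \<Rightarrow> 'a \<Rightarrow> ennreal"
    and m :: "'a measure"
    and I :: "'i set"
    and le :: "'i \<Rightarrow> 'i \<Rightarrow> bool"
    and di :: "'i \<Rightarrow> 'a \<Rightarrow> 'a \<Rightarrow> real"
  assumes "ext_metric_top_space T d"
    and "radon_prob T m"
    and "directed_set I le"
    and "\<And>i. i \<in> I \<Longrightarrow> bounded_continuous_semidistance T (di i)"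
    and "\<And>i j x y. \<lbrakk>i \<in> I; j \<in> I; le i j; x \<in> topspace T; y \<in> topspace T\<rbrakk>
           \<Longrightarrow> di i x y \<le> di j x y"
    and "\<And>x y. \<lbrakk>x \<in> topspace T; y \<in> topspace T\<rbrakk>
           \<Longrightarrow> d x y = (SUP i\<in>I. ennreal (di i x y))"
  shows
    "(\<forall>(\<rho>0 :: 'a \<Rightarrow> real) (\<rho>0i :: 'i \<Rightarrow> 'a \<Rightarrow> real) (\<rho>i :: 'i \<Rightarrow> real \<Rightarrow> 'a \<Rightarrow> real)
        (\<rho> :: real \<Rightarrow> 'a \<Rightarrow> real).
        \<rho>0 \<in> Linf_plus m \<longrightarrow>
        (\<forall>i\<in>I. is_l2_projection m
                 (l2_closure m (energy_domain m (cheeger_semi T (di i) m))) \<rho>0 (\<rho>0i i)) \<longrightarrow>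
        (\<forall>i\<in>I. gradient_curve m (cheeger_semi T (di i) m) (\<rho>0i i) (\<rho>i i)) \<longrightarrow>
        gradient_curve m (cheeger T d m) \<rho>0 \<rho> \<longrightarrow>
        (\<forall>t\<ge>0. l2_tendsto m (\<lambda>i. \<rho>i i t) (\<rho> t) (net_filter I le)))
     \<and>
     (\<forall>f \<in> energy_domain m (cheeger T d m).
        \<exists>(J :: ('i \<times> nat) set) leJ \<beta> (fj :: 'i \<times> nat \<Rightarrow> 'a \<Rightarrow> real).
          subnet_map J leJ I le \<beta> \<and>
          (\<forall>j\<in>J. bounded (fj j ` topspace T) \<and>
                  lipschitz_wrt (topspace T) (\<lambda>x y. ennreal (di (\<beta> j) x y)) (fj j)) \<and>
          l2_tendsto m fj f (net_filter J leJ) \<and>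
          l2_tendsto m (\<lambda>j. lip_a (topspace T) (\<lambda>x y. ennreal (di (\<beta> j) x y)) (fj j))
            (min_relaxed_slope T d m f) (net_filter J leJ))"
proof -
  interpret monotone_approximation T d m I le di
    using assms by unfold_locales (auto simp: ext_metric_top_space_def)
  show ?thesis
  proof (intro conjI allI impI ballI)
    fix \<rho>0 :: "'a \<Rightarrow> real" and \<rho>0i :: "'i \<Rightarrow> 'a \<Rightarrow> real" and \<rho>i :: "'i \<Rightarrow> real \<Rightarrow> 'a \<Rightarrow> real"
      and \<rho> :: "real \<Rightarrow> 'a \<Rightarrow> real" and t :: real
    assume "\<rho>0 \<in> Linf_plus m"
      and *: "\<forall>i\<in>I. is_l2_projection m (l2_closure m (energy_domain m (Chi i))) \<rho>0 (\<rho>0i i)"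
        "\<forall>i\<in>I. gradient_curve m (Chi i) (\<rho>0i i) (\<rho>i i)" "gradient_curve m Ch \<rho>0 \<rho>" "0 \<le> t"
    then have "\<rho>0 \<in> borel_measurable m" by (simp add: Linf_plus_def)
    then show "l2_tendsto m (\<lambda>i. \<rho>i i t) (\<rho> t) (net_filter I le)" using flows_converge * by blast
  next
    fix f assume "f \<in> energy_domain m Ch"
    from recovery_subnet[OF this]
    show "\<exists>(J :: ('i \<times> nat) set) leJ \<beta> (fj :: 'i \<times> nat \<Rightarrow> 'a \<Rightarrow> real).
          subnet_map J leJ I le \<beta> \<and> (\<forall>j\<in>J. lip_bi (\<beta> j) (fj j)) \<and>
          l2_tendsto m fj f (net_filter J leJ) \<and>
          l2_tendsto m (\<lambda>j. slope_i (\<beta> j) (fj j)) (min_relaxed_slope T d m f) (net_filter J leJ)" .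
  qed
qed

end
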